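(* Let $\alpha$ be a free action of a countable group $G$ and $\beta$ a free action of a countable group $H$ (both on standard probability spaces), and suppose $\alpha$ and $\beta$ are orbit equivalent. If $\alpha$ is hyperlinear, then $\beta$ is hyperlinear; if $\alpha$ is sofic, then $\beta$ is sofic.
   Context: Actions are measure preserving actions of countable groups on standard Borel probability spaces $(X,\mathcal{B},\mu)$; free means essentially free. Two actions are orbit equivalent if there is a measure space isomorphism between the underlying spaces carrying orbits onto orbits almost everywhere. Fix a free ultrafilter $\omega$ on $\mathbb{N}$. $Tr$ denotes the normalized trace and $\|x\|_2=Tr(x^*x)^{1/2}$. For positive integers $(n_k)_k$, $\Pi_{k\to\omega}M_{n_k}(\mathbb{C})$ is the tracial ultraproduct (bounded sequences $(x_k)$, $x_k\in M_{n_k}(\mathbb{C})$, modulo those with $\lim_{k\to\omega}\|x_k\|_2=0$, with trace $\lim_{k\to\omega}Tr(x_k)$). $D_{n}\subset M_{n}(\mathbb{C})$ is the algebra of diagonal matrices, $P_{n}$ the group of permutation matrices, and $\Pi_{k\to\omega}D_{n_k}$, $\Pi_{k\to\omega}P_{n_k}$ are the subsets of elements represented by sequences in $D_{n_k}$, respectively $P_{n_k}$. $R$ is the hyperfinite $II_1$ factor and $R^\omega$ its tracial ultrapower. The crossed product $L^\infty(X)\rtimes_\alpha G$, generated by $L^\infty(X)$ and unitaries $u_g$, carries the trace $Tr(\sum_g f_gu_g)=\int_X f_e\,d\mu$. Embeddings are unital trace-preserving $*$-homomorphisms. An action $\alpha$ of $G$ on $X$ is hyperlinear if $L^\infty(X)\rtimes_\alpha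 G$ embeds in $R^\omega$. It is sofic if for some sequence $(n_k)$ there is an embedding $\Theta:L^\infty(X)\rtimes_\alpha G\to\Pi_{k\to\omega}M_{n_k}(\mathbb{C})$ with $\Theta(L^\infty(X))\subset\Pi_{k\to\omega}D_{n_k}$ and $\Theta(u_g)\in\Pi_{k\to\omega}P_{n_k}$ for all $g\in G$. *)

theory Defs
  imports
    "HOL-Probability.Probability"
    "HOL-Algebra.Group_Action"
    "HOL-Algebra.QuotRing"
    "Jordan_Normal_Form.Schur_Decomposition"
begin

section \<open>Actions and orbit equivalence\<close>

definition standard_borel :: "'a measure \<Rightarrow> bool" where
  "standard_borel M \<longleftrightarrow>
     (\<exists>T. topspace T = space M \<and> completely_metrizable_space T \<and> second_countable T \<and>
          sets M = sigma_sets (space M) {U. openin T U})"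

text \<open>The points outside \<^term>\<open>space M\<close> play no role: \<^const>\<open>group_action\<close> makes every
  \<open>\<alpha> g\<close> a bijection of \<^term>\<open>space M\<close> that is extensional.\<close>

definition pmp_action :: "('g, 'm) monoid_scheme \<Rightarrow> 'a measure \<Rightarrow> ('g \<Rightarrow> 'a \<Rightarrow> 'a) \<Rightarrow> bool" where
  "pmp_action G M \<alpha> \<longleftrightarrow>
     group G \<and> countable (carrier G) \<and> prob_space M \<and> standard_borel M \<and>
     group_action G (space M) \<alpha> \<and>
     (\<forall>g\<in>carrier G. \<alpha> g \<in> M \<rightarrow>\<^sub>M M \<and> distr M M (\<alpha> g) = M)"

definition free_action :: "('g, 'm) monoid_scheme \<Rightarrow> 'a measure \<Rightarrow> ('g \<Rightarrow> 'a \<Rightarrow> 'a) \<Rightarrow> bool" where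
  "free_action G M \<alpha> \<longleftrightarrow> (AE x in M. \<forall>g\<in>carrier G. g \<noteq> \<one>\<^bsub>G\<^esub> \<longrightarrow> \<alpha> g x \<noteq> x)"

text \<open>An isomorphism of measure spaces is only required to be defined between conull measurable
  sets \<open>X\<close> and \<open>Y\<close>.\<close>

definition measure_space_iso ::
    "'a measure \<Rightarrow> 'b measure \<Rightarrow> 'a set \<Rightarrow> 'b set \<Rightarrow> ('a \<Rightarrow> 'b) \<Rightarrow> bool" where
  "measure_space_iso M N X Y \<phi> \<longleftrightarrow>
     X \<in> sets M \<and> space M - X \<in> null_sets M \<and>
     Y \<in> sets N \<and> space N - Y \<in> null_sets N \<and>
     bij_betw \<phi> X Y \<and>
     \<phi> \<in> restrict_space M X \<rightarrow>\<^sub>M restrict_space N Y \<and>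
     inv_into X \<phi> \<in> restrict_space N Y \<rightarrow>\<^sub>M restrict_space M X \<and>
     distr (restrict_space M X) (restrict_space N Y) \<phi> = restrict_space N Y"

definition orbit_equivalent ::
    "('g, 'm) monoid_scheme \<Rightarrow> 'a measure \<Rightarrow> ('g \<Rightarrow> 'a \<Rightarrow> 'a) \<Rightarrow>
     ('h, 'n) monoid_scheme \<Rightarrow> 'b measure \<Rightarrow> ('h \<Rightarrow> 'b \<Rightarrow> 'b) \<Rightarrow> bool" where
  "orbit_equivalent G M \<alpha> H N \<beta> \<longleftrightarrow>
     (\<exists>X Y \<phi>. measure_space_iso M N X Y \<phi> \<and>
        (AE x in M. x \<in> X \<longrightarrow>
           \<phi> ` (Group_Action.orbit G \<alpha> x \<inter> X) = Group_Action.orbit H \<beta> (\<phi> x) \<inter> Y))"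


section \<open>Hilbert spaces and von Neumann algebras\<close>

text \<open>Vector spaces are records over \<^const>\<open>vectorspace\<close>, as in HOL-Algebra; the fields \<open>mult\<close> and
  \<open>one\<close> that such a record inherits are not used. The inner product is linear in the first argument.\<close>

record 'v hilbert = "(complex, 'v) module" +
  inner_prod :: "'v \<Rightarrow> 'v \<Rightarrow> complex"

definition hnorm :: "'v hilbert \<Rightarrow> 'v \<Rightarrow> real" where
  "hnorm H x = sqrt (Re (inner_prod H x x))"

definition hilbert_space :: "'v hilbert \<Rightarrow> bool" where
  "hilbert_space H \<longleftrightarrow>
     vectorspace class_ring H \<and>
     (\<forall>x\<in>carrier H. \<forall>y\<in>carrier H. \<forall>z\<in>carrier H.
        inner_prod H (x \<oplus>\<^bsub>H\<^esub> y) z = inner_prod H x z + inner_prod H y z) \<and>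
     (\<forall>c. \<forall>x\<in>carrier H. \<forall>y\<in>carrier H.
        inner_prod H (c \<odot>\<^bsub>H\<^esub> x) y = c * inner_prod H x y) \<and>
     (\<forall>x\<in>carrier H. \<forall>y\<in>carrier H. inner_prod H y x = cnj (inner_prod H x y)) \<and>
     (\<forall>x\<in>carrier H. x \<noteq> \<zero>\<^bsub>H\<^esub> \<longrightarrow> 0 < Re (inner_prod H x x)) \<and>
     (\<forall>s. (\<forall>n::nat. s n \<in> carrier H) \<and>
          (\<forall>e>0. \<exists>n0. \<forall>m\<ge>n0. \<forall>n\<ge>n0. hnorm H (s m \<ominus>\<^bsub>H\<^esub> s n) < e) \<longrightarrow>
          (\<exists>x\<in>carrier H. (\<lambda>n. hnorm H (s n \<ominus>\<^bsub>H\<^esub> x)) \<longlonglongrightarrow> 0))"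

definition bounded_ops :: "'v hilbert \<Rightarrow> ('v \<Rightarrow> 'v) set" where
  "bounded_ops H =
     {T \<in> carrier H \<rightarrow>\<^sub>E carrier H.
        (\<forall>x\<in>carrier H. \<forall>y\<in>carrier H. T (x \<oplus>\<^bsub>H\<^esub> y) = T x \<oplus>\<^bsub>H\<^esub> T y) \<and>
        (\<forall>c. \<forall>x\<in>carrier H. T (c \<odot>\<^bsub>H\<^esub> x) = c \<odot>\<^bsub>H\<^esub> T x) \<and>
        (\<exists>c. \<forall>x\<in>carrier H. hnorm H (T x) \<le> c * hnorm H x)}"

definition op_norm :: "'v hilbert \<Rightarrow> ('v \<Rightarrow> 'v) \<Rightarrow> real" where
  "op_norm H T = Inf {c. 0 \<le> c \<and> (\<forall>x\<in>carrier H. hnorm H (T x) \<le> c * hnorm H x)}"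

definition op_adjoint :: "'v hilbert \<Rightarrow> ('v \<Rightarrow> 'v) \<Rightarrow> 'v \<Rightarrow> 'v" where
  "op_adjoint H T =
     (THE S. S \<in> bounded_ops H \<and>
        (\<forall>x\<in>carrier H. \<forall>y\<in>carrier H. inner_prod H (T x) y = inner_prod H x (S y)))"

definition commutant :: "'v hilbert \<Rightarrow> ('v \<Rightarrow> 'v) set \<Rightarrow> ('v \<Rightarrow> 'v) set" where
  "commutant H S =
     {T \<in> bounded_ops H. \<forall>A\<in>S. compose (carrier H) T A = compose (carrier H) A T}"

definition von_neumann_algebra :: "'v hilbert \<Rightarrow> ('v \<Rightarrow> 'v) set \<Rightarrow> bool" where
  "von_neumann_algebra H A \<longleftrightarrow>
     A \<subseteq> bounded_ops H \<and> (\<forall>T\<in>A. op_adjoint H T \<in> A) \<and> commutant H (commutant H A) = A"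

text \<open>A *-algebra with a trace, and one that in addition carries an operator norm.\<close>

record 'a tracial_alg = "(complex, 'a) module" +
  star :: "'a \<Rightarrow> 'a"
  tr :: "'a \<Rightarrow> complex"

record 'a normed_tracial_alg = "'a tracial_alg" +
  opnorm :: "'a \<Rightarrow> real"

definition operator_alg ::
    "'v hilbert \<Rightarrow> ('v \<Rightarrow> 'v) set \<Rightarrow> (('v \<Rightarrow> 'v) \<Rightarrow> complex) \<Rightarrow> ('v \<Rightarrow> 'v) normed_tracial_alg" where
  "operator_alg H A \<tau> =
     \<lparr>carrier = A,
      monoid.mult = compose (carrier H),
      one = (\<lambda>x\<in>carrier H. x),
      ring.zero = (\<lambda>x\<in>carrier H. \<zero>\<^bsub>H\<^esub>),
      add = (\<lambda>S T. \<lambda>x\<in>carrier H. S x \<oplus>\<^bsub>H\<^esub> T x),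
      module.smult = (\<lambda>c T. \<lambda>x\<in>carrier H. c \<odot>\<^bsub>H\<^esub> T x),
      star = op_adjoint H,
      tr = \<tau>,
      opnorm = op_norm H\<rparr>"

definition tnorm2 :: "('a, 'm) tracial_alg_scheme \<Rightarrow> 'a \<Rightarrow> real" where
  "tnorm2 A x = sqrt (Re (tr A (star A x \<otimes>\<^bsub>A\<^esub> x)))"

definition embedding ::
    "('a, 'm) tracial_alg_scheme \<Rightarrow> ('b, 'n) tracial_alg_scheme \<Rightarrow> ('a \<Rightarrow> 'b) \<Rightarrow> bool" where
  "embedding A B \<Theta> \<longleftrightarrow>
     \<Theta> \<in> Ring.ring_hom A B \<and>
     (\<forall>c. \<forall>x\<in>carrier A. \<Theta> (c \<odot>\<^bsub>A\<^esub> x) = c \<odot>\<^bsub>B\<^esub> \<Theta> x) \<and>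
     (\<forall>x\<in>carrier A. \<Theta> (star A x) = star B (\<Theta> x)) \<and>
     (\<forall>x\<in>carrier A. tr B (\<Theta> x) = tr A x)"


section \<open>The hyperfinite \<open>II\<^sub>1\<close> factor\<close>

definition factor :: "'v hilbert \<Rightarrow> ('v \<Rightarrow> 'v) set \<Rightarrow> bool" where
  "factor H A \<longleftrightarrow>
     von_neumann_algebra H A \<and> A \<inter> commutant H A = {\<lambda>x\<in>carrier H. c \<odot>\<^bsub>H\<^esub> x | c. True}"

text \<open>Normality (ultraweak continuity) of a state is expressed by the existence of a square
  summable sequence of vectors implementing it.\<close>

definition faithful_normal_tracial_state ::
    "'v hilbert \<Rightarrow> ('v \<Rightarrow> 'v) set \<Rightarrow> (('v \<Rightarrow> 'v) \<Rightarrow> complex) \<Rightarrow> bool" where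
  "faithful_normal_tracial_state H A \<tau> \<longleftrightarrow>
     (let V = operator_alg H A \<tau> in
        (\<forall>S\<in>A. \<forall>T\<in>A. \<tau> (S \<oplus>\<^bsub>V\<^esub> T) = \<tau> S + \<tau> T) \<and>
        (\<forall>c. \<forall>T\<in>A. \<tau> (c \<odot>\<^bsub>V\<^esub> T) = c * \<tau> T) \<and>
        \<tau> \<one>\<^bsub>V\<^esub> = 1 \<and>
        (\<forall>T\<in>A. \<tau> (star V T \<otimes>\<^bsub>V\<^esub> T) \<in> \<real> \<and> 0 \<le> Re (\<tau> (star V T \<otimes>\<^bsub>V\<^esub> T))) \<and>
        (\<forall>T\<in>A. \<tau> (star V T \<otimes>\<^bsub>V\<^esub> T) = 0 \<longrightarrow> T = \<zero>\<^bsub>V\<^esub>) \<and>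
        (\<forall>S\<in>A. \<forall>T\<in>A. \<tau> (S \<otimes>\<^bsub>V\<^esub> T) = \<tau> (T \<otimes>\<^bsub>V\<^esub> S)) \<and>
        (\<exists>\<xi>. (\<forall>n::nat. \<xi> n \<in> carrier H) \<and> summable (\<lambda>n. (hnorm H (\<xi> n))\<^sup>2) \<and>
             (\<forall>T\<in>A. \<tau> T = (\<Sum>n. inner_prod H (T (\<xi> n)) (\<xi> n)))))"

definition finite_dim_star_subalgebra ::
    "'v hilbert \<Rightarrow> ('v \<Rightarrow> 'v) set \<Rightarrow> ('v \<Rightarrow> 'v) set \<Rightarrow> bool" where
  "finite_dim_star_subalgebra H A B \<longleftrightarrow>
     (let V = operator_alg H A (\<lambda>_. 0) in
        B \<subseteq> A \<and> \<one>\<^bsub>V\<^esub> \<in> B \<and>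
        (\<forall>S\<in>B. \<forall>T\<in>B. S \<oplus>\<^bsub>V\<^esub> T \<in> B \<and> S \<otimes>\<^bsub>V\<^esub> T \<in> B) \<and>
        (\<forall>c. \<forall>T\<in>B. c \<odot>\<^bsub>V\<^esub> T \<in> B) \<and>
        (\<forall>T\<in>B. star V T \<in> B) \<and>
        vectorspace.fin_dim class_ring (V\<lparr>carrier := B\<rparr>))"

text \<open>The hyperfinite \<open>II\<^sub>1\<close> factor is unique up to isomorphism and its trace is unique, so any
  \<open>H\<close>, \<open>A\<close>, \<open>\<tau>\<close> satisfying this predicate is a model of it.\<close>

definition hyperfinite_II1_factor ::
    "'v hilbert \<Rightarrow> ('v \<Rightarrow> 'v) set \<Rightarrow> (('v \<Rightarrow> 'v) \<Rightarrow> complex) \<Rightarrow> bool" where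
  "hyperfinite_II1_factor H A \<tau> \<longleftrightarrow>
     hilbert_space H \<and> factor H A \<and>
     \<not> vectorspace.fin_dim class_ring (operator_alg H A \<tau>) \<and>
     faithful_normal_tracial_state H A \<tau> \<and>
     (\<exists>B::nat \<Rightarrow> ('v \<Rightarrow> 'v) set.
        (\<forall>n. finite_dim_star_subalgebra H A (B n)) \<and> (\<forall>n. B n \<subseteq> B (Suc n)) \<and>
        commutant H (commutant H (\<Union>n. B n)) = A)"


section \<open>Crossed products\<close>

text \<open>The elements of \<open>L\<^sup>2(N)\<close> are classes of almost everywhere equal functions.\<close>

definition ae_class :: "'a measure \<Rightarrow> ('a \<Rightarrow> complex) \<Rightarrow> ('a \<Rightarrow> complex) set" where
  "ae_class N f = {g \<in> borel_measurable N. AE x in N. g x = f x}"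

definition rep :: "'a set \<Rightarrow> 'a" where
  "rep X = (SOME x. x \<in> X)"

definition L2_space :: "'a measure \<Rightarrow> ('a \<Rightarrow> complex) set hilbert" where
  "L2_space N =
     \<lparr>carrier = {ae_class N f | f. f \<in> borel_measurable N \<and> integrable N (\<lambda>x. (cmod (f x))\<^sup>2)},
      monoid.mult = undefined,
      one = undefined,
      ring.zero = ae_class N (\<lambda>_. 0),
      add = (\<lambda>\<xi> \<eta>. ae_class N (\<lambda>x. rep \<xi> x + rep \<eta> x)),
      module.smult = (\<lambda>c \<xi>. ae_class N (\<lambda>x. c * rep \<xi> x)),
      inner_prod = (\<lambda>\<xi> \<eta>. LINT x|N. rep \<xi> x * cnj (rep \<eta> x))\<rparr>"

text \<open>The group measure space construction: the crossed product acts on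
  \<open>L\<^sup>2(X \<times> G) = L\<^sup>2(X) \<otimes> \<ell>\<^sup>2(G)\<close> by
  \<open>(f \<xi>)(x, k) = f x * \<xi> (x, k)\<close> and \<open>(u\<^sub>g \<xi>)(x, k) = \<xi> (g\<^sup>-\<^sup>1 x, g\<^sup>-\<^sup>1 k)\<close>, so that
  \<open>u\<^sub>g f u\<^sub>g\<^sup>* = f \<circ> g\<^sup>-\<^sup>1\<close>.\<close>

definition cp_measure :: "('g, 'm) monoid_scheme \<Rightarrow> 'a measure \<Rightarrow> ('a \<times> 'g) measure" where
  "cp_measure G M = M \<Otimes>\<^sub>M count_space (carrier G)"

abbreviation cp_hilbert ::
    "('g, 'm) monoid_scheme \<Rightarrow> 'a measure \<Rightarrow> ('a \<times> 'g \<Rightarrow> complex) set hilbert" where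
  "cp_hilbert G M \<equiv> L2_space (cp_measure G M)"

type_synonym ('a, 'g) cp_op = "('a \<times> 'g \<Rightarrow> complex) set \<Rightarrow> ('a \<times> 'g \<Rightarrow> complex) set"

definition cp_fun :: "('g, 'm) monoid_scheme \<Rightarrow> 'a measure \<Rightarrow> ('a \<Rightarrow> complex) \<Rightarrow> ('a, 'g) cp_op" where
  "cp_fun G M f =
     (\<lambda>\<xi>\<in>carrier (cp_hilbert G M). ae_class (cp_measure G M) (\<lambda>(x, k). f x * rep \<xi> (x, k)))"

definition cp_unitary ::
    "('g, 'm) monoid_scheme \<Rightarrow> 'a measure \<Rightarrow> ('g \<Rightarrow> 'a \<Rightarrow> 'a) \<Rightarrow> 'g \<Rightarrow> ('a, 'g) cp_op" where
  "cp_unitary G M \<alpha> g =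
     (\<lambda>\<xi>\<in>carrier (cp_hilbert G M).
        ae_class (cp_measure G M)
          (\<lambda>(x, k). rep \<xi> (\<alpha> (inv\<^bsub>G\<^esub> g) x, inv\<^bsub>G\<^esub> g \<otimes>\<^bsub>G\<^esub> k)))"

text \<open>The copy of \<open>L\<^sup>\<infinity>(X)\<close> in the crossed product.\<close>

definition cp_Linf :: "('g, 'm) monoid_scheme \<Rightarrow> 'a measure \<Rightarrow> ('a, 'g) cp_op set" where
  "cp_Linf G M =
     {cp_fun G M f | f. f \<in> borel_measurable M \<and> (\<exists>c. AE x in M. cmod (f x) \<le> c)}"

text \<open>The trace is the vector state of \<open>1 \<otimes> \<delta>\<^sub>e\<close>, which takes the value
  \<open>\<integral> f\<^sub>e\<close> at \<open>\<Sum> f\<^sub>g u\<^sub>g\<close>.\<close>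

definition cp_vector :: "('g, 'm) monoid_scheme \<Rightarrow> 'a measure \<Rightarrow> ('a \<times> 'g \<Rightarrow> complex) set" where
  "cp_vector G M = ae_class (cp_measure G M) (\<lambda>(x, k). if k = \<one>\<^bsub>G\<^esub> then 1 else 0)"

definition crossed_product ::
    "('g, 'm) monoid_scheme \<Rightarrow> 'a measure \<Rightarrow> ('g \<Rightarrow> 'a \<Rightarrow> 'a) \<Rightarrow> ('a, 'g) cp_op normed_tracial_alg" where
  "crossed_product G M \<alpha> =
     operator_alg (cp_hilbert G M)
       (commutant (cp_hilbert G M) (commutant (cp_hilbert G M)
          (cp_Linf G M \<union> cp_unitary G M \<alpha> ` carrier G)))
       (\<lambda>T. inner_prod (cp_hilbert G M) (T (cp_vector G M)) (cp_vector G M))"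


section \<open>Tracial ultraproducts\<close>

definition free_ultrafilter :: "nat filter \<Rightarrow> bool" where
  "free_ultrafilter \<omega> \<longleftrightarrow>
     \<omega> \<noteq> bot \<and>
     (\<forall>P. eventually P \<omega> \<or> eventually (\<lambda>k. \<not> P k) \<omega>) \<and>
     (\<forall>n. eventually (\<lambda>k. k \<noteq> n) \<omega>)"

definition bounded_seqs :: "(nat \<Rightarrow> 'a normed_tracial_alg) \<Rightarrow> (nat \<Rightarrow> 'a) ring" where
  "bounded_seqs A =
     \<lparr>carrier = {x. (\<forall>k. x k \<in> carrier (A k)) \<and> (\<exists>c. \<forall>k. opnorm (A k) (x k) \<le> c)},
      monoid.mult = (\<lambda>x y k. x k \<otimes>\<^bsub>A k\<^esub> y k),
      one = (\<lambda>k. \<one>\<^bsub>A k\<^esub>),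
      ring.zero = (\<lambda>k. \<zero>\<^bsub>A k\<^esub>),
      add = (\<lambda>x y k. x k \<oplus>\<^bsub>A k\<^esub> y k)\<rparr>"

definition null_seqs :: "nat filter \<Rightarrow> (nat \<Rightarrow> 'a normed_tracial_alg) \<Rightarrow> (nat \<Rightarrow> 'a) set" where
  "null_seqs \<omega> A =
     {x \<in> carrier (bounded_seqs A). ((\<lambda>k. tnorm2 (A k) (x k)) \<longlongrightarrow> 0) \<omega>}"

definition seq_class :: "nat filter \<Rightarrow> (nat \<Rightarrow> 'a normed_tracial_alg) \<Rightarrow> (nat \<Rightarrow> 'a) \<Rightarrow> (nat \<Rightarrow> 'a) set" where
  "seq_class \<omega> A x = null_seqs \<omega> A +>\<^bsub>bounded_seqs A\<^esub> x"

definition ultraproduct ::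
    "nat filter \<Rightarrow> (nat \<Rightarrow> 'a normed_tracial_alg) \<Rightarrow> (nat \<Rightarrow> 'a) set tracial_alg" where
  "ultraproduct \<omega> A =
     (let Q = bounded_seqs A Quot null_seqs \<omega> A in
      \<lparr>carrier = carrier Q,
       monoid.mult = monoid.mult Q,
       one = \<one>\<^bsub>Q\<^esub>,
       ring.zero = \<zero>\<^bsub>Q\<^esub>,
       add = add Q,
       module.smult = (\<lambda>c X. seq_class \<omega> A (\<lambda>k. c \<odot>\<^bsub>A k\<^esub> rep X k)),
       star = (\<lambda>X. seq_class \<omega> A (\<lambda>k. star (A k) (rep X k))),
       tr = (\<lambda>X. Lim \<omega> (\<lambda>k. tr (A k) (rep X k)))\<rparr>)"

text \<open>The elements of the ultraproduct represented by sequences with \<open>k\<close>-th term in \<open>S k\<close>.\<close>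

definition ultraproduct_subset ::
    "nat filter \<Rightarrow> (nat \<Rightarrow> 'a normed_tracial_alg) \<Rightarrow> (nat \<Rightarrow> 'a set) \<Rightarrow> (nat \<Rightarrow> 'a) set set" where
  "ultraproduct_subset \<omega> A S =
     {seq_class \<omega> A x | x. x \<in> carrier (bounded_seqs A) \<and> (\<forall>k. x k \<in> S k)}"

definition matrix_alg :: "nat \<Rightarrow> complex mat normed_tracial_alg" where
  "matrix_alg n =
     \<lparr>carrier = carrier_mat n n,
      monoid.mult = (*),
      one = 1\<^sub>m n,
      ring.zero = 0\<^sub>m n n,
      add = (+),
      module.smult = (\<cdot>\<^sub>m),
      star = mat_adjoint,
      tr = (\<lambda>A. (\<Sum>i<n. A $$ (i, i)) / of_nat n),
      opnorm = (\<lambda>A. Sup {sqrt (Re ((A *\<^sub>v v) \<bullet>c (A *\<^sub>v v))) | v.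
                          v \<in> carrier_vec n \<and> Re (v \<bullet>c v) \<le> 1})\<rparr>"

definition diagonal_matrices :: "nat \<Rightarrow> complex mat set" where
  "diagonal_matrices n = {A \<in> carrier_mat n n. diagonal_mat A}"

definition permutation_matrices :: "nat \<Rightarrow> complex mat set" where
  "permutation_matrices n =
     {mat n n (\<lambda>(i, j). if i = p j then 1 else 0) | p. p permutes {..<n}}"


section \<open>Hyperlinear and sofic actions\<close>

text \<open>The parameter \<open>R\<close> is to be the hyperfinite \<open>II\<^sub>1\<close> factor.\<close>

definition hyperlinear_action ::
    "nat filter \<Rightarrow> 'r normed_tracial_alg \<Rightarrow>
     ('g, 'm) monoid_scheme \<Rightarrow> 'a measure \<Rightarrow> ('g \<Rightarrow> 'a \<Rightarrow> 'a) \<Rightarrow> bool" where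
  "hyperlinear_action \<omega> R G M \<alpha> \<longleftrightarrow>
     (\<exists>\<Theta>. embedding (crossed_product G M \<alpha>) (ultraproduct \<omega> (\<lambda>_. R)) \<Theta>)"

definition sofic_action ::
    "nat filter \<Rightarrow> ('g, 'm) monoid_scheme \<Rightarrow> 'a measure \<Rightarrow> ('g \<Rightarrow> 'a \<Rightarrow> 'a) \<Rightarrow> bool" where
  "sofic_action \<omega> G M \<alpha> \<longleftrightarrow>
     (\<exists>(n :: nat \<Rightarrow> nat) \<Theta>. (\<forall>k. 0 < n k) \<and>
        embedding (crossed_product G M \<alpha>) (ultraproduct \<omega> (\<lambda>k. matrix_alg (n k))) \<Theta> \<and>
        \<Theta> ` cp_Linf G M \<subseteq>
          ultraproduct_subset \<omega> (\<lambda>k. matrix_alg (n k)) (\<lambda>k. diagonal_matrices (n k)) \<and>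
        (\<forall>g\<in>carrier G. \<Theta> (cp_unitary G M \<alpha> g) \<in>
          ultraproduct_subset \<omega> (\<lambda>k. matrix_alg (n k)) (\<lambda>k. permutation_matrices (n k))))"

end

theory Submission
  imports Defs
begin

text \<open>An orbit equivalence \<open>\<phi>\<close> of free actions induces, up to null sets, a measure isomorphism
  \<open>\<Phi> (x, k) = (\<phi> x, l)\<close> of \<open>X \<times> G\<close> onto \<open>Y \<times> H\<close>, where \<open>l\<^sup>-\<^sup>1 \<phi> x = \<phi> (k\<^sup>-\<^sup>1 x)\<close>.
  Conjugation by the unitary \<open>\<xi> \<mapsto> \<xi> \<circ> \<Phi>\<close> embeds the crossed product of \<open>\<beta>\<close> into that of \<open>\<alpha>\<close>,
  taking \<open>L\<^sup>\<infinity>(Y)\<close> to \<open>L\<^sup>\<infinity>(X)\<close> and \<open>u\<^sub>h\<close> to \<open>V = \<Sum>\<^sub>g 1\<^sub>E u\<^sub>g\<close>, where \<open>E = E(h, g)\<close> is the set of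
  \<open>x\<close> with \<open>\<phi> (g\<^sup>-\<^sup>1 x) = h\<^sup>-\<^sup>1 \<phi> x\<close>. This settles hyperlinearity.

  For soficity it remains to represent \<open>\<Theta> V\<close> by permutation matrices. A finite part of the sum
  carries almost all of the trace, so in the matrix algebras most rows of \<open>\<Theta> V\<close> are close to rows of
  permutation matrices. Since \<open>V\<close> is unitary, only few columns are hit twice or missed, and the
  partial map of the rows extends to a permutation that is close to \<open>\<Theta> V\<close> in the 2-norm.\<close>

section \<open>Square integrable functions\<close>

text \<open>The sum defining V is infinite, while \<Theta> is only assumed to respect finite sums,
  products, adjoints and traces. So V is handled through the identities 1_E V = 1_E u_g, one for
  each g. For membership of V in the bicommutant, the countably many sets E, for fixed h, cover the
  space up to a null set. For the matrices, finitely many of them leave out a set of small measure,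
  and preservation of the trace turns small measure into a small 2-norm. Freeness of \<beta> makes l
  unique, freeness of \<alpha> makes the sets E(h, g) with fixed h disjoint. Both are wanted at
  every point, which is why everything is restricted to invariant conull sets on which the orbit
  equivalence holds without exceptions. The adjoint is a definite description, and the elements of a
  bicommutant are given by no formula. Conjugation can be shown to respect their adjoints only once
  all bounded operators on \<open>L2_space P\<close> are known to have one; hence completeness and
  the Riesz representation, proved on functions rather than on classes.\<close>

definition L2_fun :: "'a measure \<Rightarrow> ('a \<Rightarrow> complex) set" where
  "L2_fun P = {f \<in> borel_measurable P. integrable P (\<lambda>x. (cmod (f x))\<^sup>2)}"

definition L2_ip :: "'a measure \<Rightarrow> ('a \<Rightarrow> complex) \<Rightarrow> ('a \<Rightarrow> complex) \<Rightarrow> complex" where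
  "L2_ip P f g = (LINT x|P. f x * cnj (g x))"

definition L2_sq :: "'a measure \<Rightarrow> ('a \<Rightarrow> complex) \<Rightarrow> real" where
  "L2_sq P f = (LINT x|P. (cmod (f x))\<^sup>2)"

lemma L2_fun_measurable[measurable_dest]: "f \<in> L2_fun P \<Longrightarrow> f \<in> borel_measurable P"
  by (simp add: L2_fun_def)

lemma borel_measurable_cnj[measurable (raw)]:
  "f \<in> borel_measurable P \<Longrightarrow> (\<lambda>x. cnj (f x)) \<in> borel_measurable P"
  by (rule borel_measurable_continuous_on) (auto intro: continuous_intros)

lemma cmod_add_square_le: "(cmod (a + b))\<^sup>2 \<le> 2 * (cmod a)\<^sup>2 + 2 * (cmod b)\<^sup>2"
proof -
  have "(cmod (a + b))\<^sup>2 \<le> (cmod a + cmod b)\<^sup>2"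
    by (intro power_mono norm_triangle_ineq) auto
  also have "\<dots> \<le> 2 * (cmod a)\<^sup>2 + 2 * (cmod b)\<^sup>2"
    using sum_squares_bound[of "cmod a" "cmod b"] by (simp add: power2_sum)
  finally show ?thesis .
qed

lemma L2_fun_add: assumes "f \<in> L2_fun P" "g \<in> L2_fun P" shows "(\<lambda>x. f x + g x) \<in> L2_fun P"
proof -
  have m[measurable]: "f \<in> borel_measurable P" "g \<in> borel_measurable P"
    using assms by (auto simp: L2_fun_def)
  have "integrable P (\<lambda>x. 2 * (cmod (f x))\<^sup>2 + 2 * (cmod (g x))\<^sup>2)"
    using assms by (auto simp: L2_fun_def)
  then have "integrable P (\<lambda>x. (cmod (f x + g x))\<^sup>2)"
    by (rule Bochner_Integration.integrable_bound)
       (auto intro!: AE_I2 order_trans[OF cmod_add_square_le])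
  then show ?thesis by (simp add: L2_fun_def)
qed

lemma L2_fun_scale: "f \<in> L2_fun P \<Longrightarrow> (\<lambda>x. c * f x) \<in> L2_fun P"
  by (auto simp: L2_fun_def norm_mult power_mult_distrib)

lemma L2_fun_diff: "f \<in> L2_fun P \<Longrightarrow> g \<in> L2_fun P \<Longrightarrow> (\<lambda>x. f x - g x) \<in> L2_fun P"
  using L2_fun_add[of f P "\<lambda>x. (-1) * g x"] L2_fun_scale[of g P "-1"] by simp

lemma L2_fun_zero: "(\<lambda>_. 0) \<in> L2_fun P"
  by (simp add: L2_fun_def)

lemma L2_fun_cong_AE: "f \<in> L2_fun P \<Longrightarrow> g \<in> borel_measurable P \<Longrightarrow> AE x in P. g x = f x \<Longrightarrow> g \<in> L2_fun P"
  unfolding L2_fun_def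
  by (auto intro: integrable_cong_AE_imp)

lemma L2_integrable_mult_cnj:
  assumes "f \<in> L2_fun P" "g \<in> L2_fun P" shows "integrable P (\<lambda>x. f x * cnj (g x))"
proof -
  have m[measurable]: "f \<in> borel_measurable P" "g \<in> borel_measurable P"
    using assms by (auto simp: L2_fun_def)
  have "integrable P (\<lambda>x. (cmod (f x))\<^sup>2 + (cmod (g x))\<^sup>2)"
    using assms by (auto simp: L2_fun_def)
  then show ?thesis
  proof (rule Bochner_Integration.integrable_bound)
    have "cmod (f x * cnj (g x)) \<le> (cmod (f x))\<^sup>2 + (cmod (g x))\<^sup>2" for x
      using sum_squares_bound[of "cmod (f x)" "cmod (g x)"]
        mult_nonneg_nonneg[OF norm_ge_zero norm_ge_zero, of "f x" "g x"]
      unfolding norm_mult complex_mod_cnj mult.assoc by linarith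
    then show "AE x in P. norm (f x * cnj (g x)) \<le> norm ((cmod (f x))\<^sup>2 + (cmod (g x))\<^sup>2)"
      by (auto intro!: AE_I2)
  qed measurable
qed

lemma L2_ip_add_left: "f \<in> L2_fun P \<Longrightarrow> g \<in> L2_fun P \<Longrightarrow> h \<in> L2_fun P \<Longrightarrow>
  L2_ip P (\<lambda>x. f x + g x) h = L2_ip P f h + L2_ip P g h"
  unfolding L2_ip_def
  by (subst Bochner_Integration.integral_add[symmetric])
     (auto simp: algebra_simps L2_integrable_mult_cnj)

lemma L2_ip_scale_left: "L2_ip P (\<lambda>x. c * f x) g = c * L2_ip P f g"
  unfolding L2_ip_def by (simp add: mult.assoc)

lemma L2_ip_cnj: "cnj (L2_ip P f g) = L2_ip P g f"
proof -
  have "cnj (L2_ip P f g) = (LINT x|P. cnj (f x * cnj (g x)))"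
    unfolding L2_ip_def by (rule Bochner_Integration.integral_cnj[symmetric])
  then show ?thesis by (simp add: L2_ip_def mult.commute)
qed

lemma L2_ip_self: "L2_ip P f f = complex_of_real (L2_sq P f)"
  unfolding L2_ip_def L2_sq_def
  by (simp add: complex_norm_square[symmetric] integral_complex_of_real[symmetric] del: of_real_power integral_complex_of_real)

lemma L2_sq_nonneg: "0 \<le> L2_sq P f"
  unfolding L2_sq_def by (intro Bochner_Integration.integral_nonneg) auto

lemma L2_sq_scale: "L2_sq P (\<lambda>x. c * f x) = (cmod c)\<^sup>2 * L2_sq P f"
  unfolding L2_sq_def by (simp add: norm_mult power_mult_distrib)

lemma L2_sq_eq_0_iff: assumes "f \<in> L2_fun P" shows "L2_sq P f = 0 \<longleftrightarrow> (AE x in P. f x = 0)"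
  using assms unfolding L2_sq_def L2_fun_def
  by (subst integral_nonneg_eq_0_iff_AE) auto

lemma L2_sq_add: assumes "f \<in> L2_fun P" "g \<in> L2_fun P"
  shows "L2_sq P (\<lambda>x. f x + g x) = L2_sq P f + L2_sq P g + 2 * Re (L2_ip P f g)"
proof -
  have ex: "(cmod (f x + g x))\<^sup>2 = (cmod (f x))\<^sup>2 + (cmod (g x))\<^sup>2 + 2 * Re (f x * cnj (g x))" for x
    unfolding cmod_power2 by (simp add: power2_eq_square algebra_simps)
  have i: "integrable P (\<lambda>x. f x * cnj (g x))"
    by (rule L2_integrable_mult_cnj[OF assms])
  have "integrable P (\<lambda>x. Re (f x * cnj (g x)))"
    using i by (rule integrable_Re)
  moreover have "(LINT x|P. Re (f x * cnj (g x))) = Re (L2_ip P f g)"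
    unfolding L2_ip_def using i by (rule integral_Re)
  moreover have "integrable P (\<lambda>x. (cmod (f x))\<^sup>2)" "integrable P (\<lambda>x. (cmod (g x))\<^sup>2)"
    using assms by (auto simp: L2_fun_def)
  ultimately show ?thesis
    unfolding L2_sq_def ex by (simp del: times_complex.sel(1))
qed

text \<open>The discriminant criterion, read off at the vertex t = - b / c. It yields Cauchy-Schwarz
  and, with a = 0, the vanishing of the first variation in \<open>L2_Riesz\<close>.\<close>

lemma real_quadratic_nonneg:
  assumes "\<And>t::real. 0 \<le> a + 2 * t * b + t\<^sup>2 * c" "0 \<le> c"
  shows "b\<^sup>2 \<le> a * c"
proof (cases "c = 0")
  case True
  have "b = 0"
  proof (rule ccontr)
    assume "b \<noteq> 0"
    \<comment> \<open>For c = 0 the polynomial is affine, and at this t it takes the value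
      -1.\<close>
    then show False using assms(1)[of "- (a + 1) / (2 * b)"] True by (simp add: field_simps)
  qed
  then show ?thesis using True by simp
next
  case False
  then show ?thesis using assms(1)[of "- b / c"] assms(2)
    by (simp add: field_simps power2_eq_square)
qed

lemma L2_Cauchy_Schwarz:
  assumes "f \<in> L2_fun P" "g \<in> L2_fun P"
  shows "cmod (L2_ip P f g) \<le> sqrt (L2_sq P f) * sqrt (L2_sq P g)"
proof -
  define w where "w = L2_ip P f g"
  \<comment> \<open>A factor of modulus 1 that rotates the inner product to its modulus, so that
    real multiples t suffice below.\<close>
  define c where "c = (if w = 0 then 1 else cnj (w / complex_of_real (cmod w)))"
  have c1: "cmod c = 1" and cw: "c * w = complex_of_real (cmod w)"
    unfolding c_def by (auto simp: norm_divide complex_norm_square[symmetric] power2_eq_square mult.commute[of "cnj _"])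
  have cw': "L2_ip P (\<lambda>x. c * f x) g = cmod w"
    by (simp add: L2_ip_scale_left w_def[symmetric] cw)
  have "0 \<le> L2_sq P f + 2 * t * cmod w + t\<^sup>2 * L2_sq P g" for t :: real
  proof -
    have "0 \<le> L2_sq P (\<lambda>x. c * f x + complex_of_real t * g x)" by (rule L2_sq_nonneg)
    also have "\<dots> = L2_sq P f + t\<^sup>2 * L2_sq P g + 2 * Re (L2_ip P (\<lambda>x. c * f x) (\<lambda>x. complex_of_real t * g x))"
      using assms by (subst L2_sq_add) (auto intro: L2_fun_scale simp: L2_sq_scale c1)
    also have "L2_ip P (\<lambda>x. c * f x) (\<lambda>x. complex_of_real t * g x) = cnj (L2_ip P (\<lambda>x. complex_of_real t * g x) (\<lambda>x. c * f x))"
      by (simp add: L2_ip_cnj)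
    also have "\<dots> = complex_of_real t * cmod w"
      by (simp add: L2_ip_scale_left[of P "complex_of_real t"] L2_ip_cnj cw')
    finally show ?thesis by (simp add: algebra_simps)
  qed
  then have "(cmod w)\<^sup>2 \<le> L2_sq P f * L2_sq P g"
    by (rule real_quadratic_nonneg) (rule L2_sq_nonneg)
  then show ?thesis
    unfolding w_def by (simp add: real_le_rsqrt real_sqrt_mult[symmetric])
qed

text \<open>Riesz-Fischer: a rapidly Cauchy subsequence converges almost everywhere, and Fatou's
  lemma compares all late members of the full sequence with its limit.\<close>

lemma L2_complete:
  assumes f: "\<And>n. f n \<in> L2_fun P"
    and c: "\<And>e. e > 0 \<Longrightarrow> \<exists>N. \<forall>m\<ge>N. \<forall>n\<ge>N. L2_sq P (\<lambda>x. f m x - f n x) < e"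
  shows "\<exists>u\<in>L2_fun P. (\<lambda>n. L2_sq P (\<lambda>x. f n x - u x)) \<longlonglongrightarrow> 0"
proof -
  have m[measurable]: "\<And>n. f n \<in> borel_measurable P" using f by (auto simp: L2_fun_def)
  have sqnn: "(\<integral>\<^sup>+x. ennreal ((cmod (g x))\<^sup>2) \<partial>P) = ennreal (L2_sq P g)" if "g \<in> L2_fun P" for g
    using that unfolding L2_sq_def L2_fun_def by (intro nn_integral_eq_integral) auto
  obtain N where N: "\<And>k m n. m \<ge> N k \<Longrightarrow> n \<ge> N k \<Longrightarrow> L2_sq P (\<lambda>x. f m x - f n x) < (1/4)^k"
    using c[of "(1/4)^k" for k] by (metis zero_less_divide_1_iff zero_less_numeral zero_less_power)
  \<comment> \<open>The maximum puts \<open>r k\<close> beyond all thresholds \<open>N j\<close>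
    with j at most k; the indices need not increase strictly.\<close>
  define r where "r k = Max (N ` {..k})" for k
  have rN: "r k \<ge> N j" if "j \<le> k" for j k
    unfolding r_def using that by (intro Max_ge) auto
  define D where "D k x = f (r (Suc k)) x - f (r k) x" for k x
  have D2: "D k \<in> L2_fun P" for k unfolding D_def using f by (intro L2_fun_diff)
  have Dm[measurable]: "\<And>k. D k \<in> borel_measurable P" unfolding D_def by measurable
  \<comment> \<open>The decay 4^-k leaves room for the weight 2^k below: the weighted sum of squares
    is still integrable, and where it is finite \<open>D k x\<close> is dominated by a geometric
    sequence with ratio 1 / sqrt 2.\<close>
  have Db: "L2_sq P (D k) \<le> (1/4)^k" for k
    unfolding D_def using N[of k "r (Suc k)" "r k"] rN[of k k] rN[of k "Suc k"] by (simp add: less_imp_le)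
  have "(\<integral>\<^sup>+x. (\<Sum>k. ennreal (2^k * (cmod (D k x))\<^sup>2)) \<partial>P) = (\<Sum>k. \<integral>\<^sup>+x. ennreal (2^k * (cmod (D k x))\<^sup>2) \<partial>P)"
    by (rule nn_integral_suminf) measurable
  also have "\<dots> \<le> (\<Sum>k. ennreal ((1/2)^k))"
  proof (rule suminf_le)
    fix k
    have "(\<integral>\<^sup>+x. ennreal (2^k * (cmod (D k x))\<^sup>2) \<partial>P) = ennreal (2^k) * (\<integral>\<^sup>+x. ennreal ((cmod (D k x))\<^sup>2) \<partial>P)"
      by (subst nn_integral_cmult[symmetric]) (auto simp: ennreal_mult)
    also have "\<dots> = ennreal (2^k * L2_sq P (D k))"
      using D2 by (simp add: sqnn ennreal_mult L2_sq_nonneg)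
    also have "\<dots> \<le> ennreal ((1/2)^k)"
    proof (rule ennreal_leI)
      have "2^k * L2_sq P (D k) \<le> 2^k * (1/4)^k" using Db[of k] by simp
      also have "\<dots> = ((2::real) * (1/4))^k" by (rule power_mult_distrib[symmetric])
      finally show "2^k * L2_sq P (D k) \<le> (1/2)^k" by simp
    qed
    finally show "(\<integral>\<^sup>+x. ennreal (2^k * (cmod (D k x))\<^sup>2) \<partial>P) \<le> ennreal ((1/2)^k)" .
  qed auto
  also have "\<dots> = ennreal (\<Sum>k. (1/2)^k)"
    by (rule suminf_ennreal2) (auto intro!: summable_geometric)
  also have "\<dots> < \<infinity>" by simp
  finally have "AE x in P. (\<Sum>k. ennreal (2^k * (cmod (D k x))\<^sup>2)) \<noteq> \<infinity>"
    by (intro nn_integral_PInf_AE) auto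
  then have conv: "AE x in P. convergent (\<lambda>k. f (r k) x)"
  proof eventually_elim
    case (elim x)
    have s: "summable (\<lambda>k. 2^k * (cmod (D k x))\<^sup>2)"
      using elim by (intro summable_suminf_not_top) auto
    then have "(\<lambda>k. 2^k * (cmod (D k x))\<^sup>2) \<longlonglongrightarrow> 0" by (rule summable_LIMSEQ_zero)
    then have "Bseq (\<lambda>k. 2^k * (cmod (D k x))\<^sup>2)" using convergentI convergent_imp_Bseq by blast
    then obtain K where K: "K > 0" "\<And>k. norm (2^k * (cmod (D k x))\<^sup>2) \<le> K"
      by (auto simp: Bseq_def)
    have "cmod (D k x) \<le> sqrt K * (1 / sqrt 2)^k" for k
    proof (rule power2_le_imp_le)
      have "(cmod (D k x))\<^sup>2 \<le> K / 2^k" using K(2)[of k] by (simp add: field_simps)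
      also have "\<dots> = (sqrt K * (1 / sqrt 2)^k)\<^sup>2"
        using K(1) by (simp add: power_mult_distrib power_divide power_mult[symmetric] mult.commute[of k 2])
          (simp add: power_mult power_divide)
      finally show "(cmod (D k x))\<^sup>2 \<le> (sqrt K * (1 / sqrt 2)^k)\<^sup>2" .
    qed (use K in auto)
    moreover have "summable (\<lambda>k. sqrt K * (1 / sqrt 2)^k)"
      by (intro summable_mult summable_geometric) auto
    ultimately have "summable (\<lambda>k. D k x)"
      by (rule summable_comparison_test'[of _ 0, rotated])
    then have "convergent (\<lambda>n. \<Sum>k<n. D k x)" by (simp add: summable_iff_convergent)
    moreover have "(\<Sum>k<n. D k x) = f (r n) x - f (r 0) x" for n
      unfolding D_def by (rule sum_lessThan_telescope)
    ultimately have "convergent (\<lambda>n. f (r n) x - f (r 0) x + f (r 0) x)"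
      by (intro convergent_add convergent_const) simp
    then show ?case by simp
  qed
  define u where "u x = lim (\<lambda>k. f (r k) x)" for x
  have um[measurable]: "u \<in> borel_measurable P" unfolding u_def by measurable
  have ulim: "AE x in P. (\<lambda>k. f (r k) x) \<longlonglongrightarrow> u x"
    using conv by eventually_elim (simp add: u_def convergent_LIMSEQ_iff)
  \<comment> \<open>Fatou's lemma along the subsequence r, applied to the distance from a fixed
    \<open>f m\<close>.\<close>
  have bnd: "(\<integral>\<^sup>+x. ennreal ((cmod (f m x - u x))\<^sup>2) \<partial>P) \<le> ennreal ((1/4)^j)" if "m \<ge> N j" for m j
  proof -
    have "(\<integral>\<^sup>+x. ennreal ((cmod (f m x - u x))\<^sup>2) \<partial>P) = (\<integral>\<^sup>+x. liminf (\<lambda>k. ennreal ((cmod (f m x - f (r k) x))\<^sup>2)) \<partial>P)"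
    proof (rule nn_integral_cong_AE)
      show "AE x in P. ennreal ((cmod (f m x - u x))\<^sup>2) = liminf (\<lambda>k. ennreal ((cmod (f m x - f (r k) x))\<^sup>2))"
        using ulim
      proof eventually_elim
        case (elim x)
        have "(\<lambda>k. ennreal ((cmod (f m x - f (r k) x))\<^sup>2)) \<longlonglongrightarrow> ennreal ((cmod (f m x - u x))\<^sup>2)"
          by (intro tendsto_intros elim)
        then show ?case by (intro lim_imp_Liminf[symmetric]) auto
      qed
    qed
    also have "\<dots> \<le> liminf (\<lambda>k. \<integral>\<^sup>+x. ennreal ((cmod (f m x - f (r k) x))\<^sup>2) \<partial>P)"
      by (rule nn_integral_liminf) measurable
    also have "\<dots> \<le> ennreal ((1/4)^j)"
    proof (rule Liminf_le)
      show "\<forall>\<^sub>F k in sequentially. (\<integral>\<^sup>+x. ennreal ((cmod (f m x - f (r k) x))\<^sup>2) \<partial>P) \<le> ennreal ((1/4)^j)"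
        unfolding eventually_sequentially
      proof (intro exI[of _ j] allI impI)
        fix k assume "j \<le> k"
        have "(\<lambda>x. f m x - f (r k) x) \<in> L2_fun P" using f by (intro L2_fun_diff)
        from sqnn[OF this] N[OF that rN[OF \<open>j \<le> k\<close>]]
        show "(\<integral>\<^sup>+x. ennreal ((cmod (f m x - f (r k) x))\<^sup>2) \<partial>P) \<le> ennreal ((1/4)^j)"
          by (simp add: ennreal_leI)
      qed
    qed simp
    finally show ?thesis .
  qed
  have du: "(\<lambda>x. f m x - u x) \<in> L2_fun P" if "m \<ge> N j" for m j
  proof -
    have "integrable P (\<lambda>x. (cmod (f m x - u x))\<^sup>2)"
      using bnd[OF that] by (intro integrableI_bounded) (auto simp: le_less_trans)
    then show ?thesis by (simp add: L2_fun_def)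
  qed
  have u: "u \<in> L2_fun P"
    using L2_fun_diff[OF f[of "N 0"] du[of 0 "N 0"]] by simp
  have le: "L2_sq P (\<lambda>x. f m x - u x) \<le> (1/4)^j" if "m \<ge> N j" for m j
    using bnd[OF that] sqnn[OF du[OF that]] by simp
  have "(\<lambda>n. L2_sq P (\<lambda>x. f n x - u x)) \<longlonglongrightarrow> 0"
  proof (rule LIMSEQ_I)
    fix e :: real assume "e > 0"
    then obtain j where j: "(1/4::real)^j < e" using real_arch_pow_inv[of e "1/4"] by auto
    show "\<exists>no. \<forall>n\<ge>no. norm (L2_sq P (\<lambda>x. f n x - u x) - 0) < e"
    proof (intro exI[of _ "N j"] allI impI)
      fix n assume "N j \<le> n"
      from le[OF this] j L2_sq_nonneg[of P "\<lambda>x. f n x - u x"]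
      show "norm (L2_sq P (\<lambda>x. f n x - u x) - 0) < e" by simp
    qed
  qed
  with u show ?thesis by blast
qed

lemma L2_parallelogram:
  assumes "f \<in> L2_fun P" "g \<in> L2_fun P"
  shows "L2_sq P (\<lambda>x. f x - g x) = 2 * L2_sq P f + 2 * L2_sq P g - 4 * L2_sq P (\<lambda>x. (1/2) * (f x + g x))"
proof -
  have "L2_ip P f (\<lambda>x. (-1) * g x) = cnj (L2_ip P (\<lambda>x. (-1) * g x) f)" by (simp add: L2_ip_cnj)
  also have "\<dots> = - L2_ip P f g" by (subst L2_ip_scale_left) (simp add: L2_ip_cnj)
  finally have "L2_ip P f (\<lambda>x. (-1) * g x) = - L2_ip P f g" .
  then show ?thesis
    using L2_sq_add[OF assms] L2_sq_add[OF assms(1) L2_fun_scale[OF assms(2), of "-1"]]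
      L2_sq_scale[of P "1/2" "\<lambda>x. f x + g x"] L2_sq_scale[of P "-1" g]
    by (simp add: field_simps power2_eq_square)
qed

text \<open>A variational proof. If u represents F, then J f = ||f - u||^2 - ||u||^2, so u is sought
  as a minimiser of J. The parallelogram law makes minimising sequences Cauchy, and the first
  variation of J vanishes at u exactly if u represents F.\<close>

lemma L2_Riesz:
  assumes add: "\<And>f g. f \<in> L2_fun P \<Longrightarrow> g \<in> L2_fun P \<Longrightarrow> F (\<lambda>x. f x + g x) = F f + F g"
    and scale: "\<And>c f. f \<in> L2_fun P \<Longrightarrow> F (\<lambda>x. c * f x) = c * F f"
    and bound: "\<And>f. f \<in> L2_fun P \<Longrightarrow> cmod (F f) \<le> C * sqrt (L2_sq P f)"
  shows "\<exists>u\<in>L2_fun P. \<forall>f\<in>L2_fun P. F f = L2_ip P f u"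
proof -
  define J where "J f = L2_sq P f - 2 * Re (F f)" for f
  have Jlow: "J f \<ge> - C\<^sup>2" if "f \<in> L2_fun P" for f
  proof -
    have "Re (F f) \<le> C * sqrt (L2_sq P f)" using bound[OF that] complex_Re_le_cmod order_trans by blast
    moreover have "2 * C * sqrt (L2_sq P f) \<le> C\<^sup>2 + (sqrt (L2_sq P f))\<^sup>2" by (rule sum_squares_bound)
    ultimately show ?thesis unfolding J_def using L2_sq_nonneg[of P f] by simp
  qed
  define d where "d = (INF f\<in>L2_fun P. J f)"
  have bdd: "bdd_below (J ` L2_fun P)" using Jlow by (auto intro!: bdd_belowI)
  have dle: "d \<le> J f" if "f \<in> L2_fun P" for f
    unfolding d_def using bdd that by (rule cINF_lower)
  have "\<exists>f\<in>L2_fun P. J f < d + 1 / real (Suc n)" for n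
  proof -
    have "d < d + 1 / real (Suc n)" by simp
    then show ?thesis
      using cINF_less_iff[of "L2_fun P" J "d + 1 / real (Suc n)"] bdd L2_fun_zero unfolding d_def by blast
  qed
  then obtain f where f: "\<And>n. f n \<in> L2_fun P" "\<And>n. J (f n) < d + 1 / real (Suc n)" by metis
  have diff: "L2_sq P (\<lambda>x. f m x - f n x) \<le> 2 / real (Suc m) + 2 / real (Suc n)" for m n
  proof -
    let ?h = "\<lambda>x. (1/2) * (f m x + f n x)"
    have h: "?h \<in> L2_fun P" using f by (intro L2_fun_scale L2_fun_add)
    have "F ?h = (1/2) * (F (f m) + F (f n))"
      by (subst scale) (auto simp: add f intro!: L2_fun_add)
    from arg_cong[OF this, of Re] have "Re (F ?h) = (Re (F (f m)) + Re (F (f n))) / 2"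
      by (rule trans) (simp del: Re_divide)
    then have "L2_sq P (\<lambda>x. f m x - f n x) = 2 * J (f m) + 2 * J (f n) - 4 * J ?h"
      unfolding L2_parallelogram[OF f(1) f(1)] J_def by (simp add: field_simps)
    then show ?thesis using f(2)[of m] f(2)[of n] dle[OF h] by simp
  qed
  have "\<exists>u\<in>L2_fun P. (\<lambda>n. L2_sq P (\<lambda>x. f n x - u x)) \<longlonglongrightarrow> 0"
  proof (rule L2_complete[OF f(1)])
    fix e :: real assume "e > 0"
    then obtain N where N: "inverse (real (Suc N)) < e / 4" using reals_Archimedean[of "e/4"] by auto
    have "L2_sq P (\<lambda>x. f m x - f n x) < e" if "m \<ge> N" "n \<ge> N" for m n
    proof -
      have "1 / real (Suc m) \<le> 1 / real (Suc N)" "1 / real (Suc n) \<le> 1 / real (Suc N)"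
        using that by (auto simp: field_simps)
      then show ?thesis using diff[of m n] N by (simp add: inverse_eq_divide)
    qed
    then show "\<exists>N. \<forall>m\<ge>N. \<forall>n\<ge>N. L2_sq P (\<lambda>x. f m x - f n x) < e" by blast
  qed
  then obtain u where u: "u \<in> L2_fun P" and lim: "(\<lambda>n. L2_sq P (\<lambda>x. f n x - u x)) \<longlonglongrightarrow> 0" by blast
  have Jadd: "J (\<lambda>x. a x + b x) = J a + L2_sq P b + 2 * Re (L2_ip P b a - F b)"
    if "a \<in> L2_fun P" "b \<in> L2_fun P" for a b
  proof -
    have "Re (L2_ip P a b) = Re (L2_ip P b a)" using arg_cong[OF L2_ip_cnj[of P a b], of Re] by simp
    then show ?thesis unfolding J_def using that by (simp add: L2_sq_add add)
  qed
  \<comment> \<open>J is continuous along the minimising sequence: expand \<open>J (f n)\<close>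
    around u and let the difference tend to 0.\<close>
  have Ju: "J u \<le> d"
  proof -
    define K where "K = sqrt (L2_sq P u) + \<bar>C\<bar>"
    have "J u \<le> d + 1 / real (Suc n) + 2 * K * sqrt (L2_sq P (\<lambda>x. f n x - u x))" for n
    proof -
      let ?b = "\<lambda>x. f n x - u x"
      have b: "?b \<in> L2_fun P" using f u by (intro L2_fun_diff)
      have "J (f n) = J u + L2_sq P ?b + 2 * Re (L2_ip P ?b u - F ?b)"
        using Jadd[OF u b] by simp
      moreover have "cmod (L2_ip P ?b u - F ?b) \<le> K * sqrt (L2_sq P ?b)"
      proof -
        have "cmod (L2_ip P ?b u - F ?b) \<le> cmod (L2_ip P ?b u) + cmod (F ?b)" by (rule norm_triangle_ineq4)
        also have "\<dots> \<le> sqrt (L2_sq P ?b) * sqrt (L2_sq P u) + C * sqrt (L2_sq P ?b)"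
          by (intro add_mono L2_Cauchy_Schwarz b u bound)
        also have "\<dots> \<le> sqrt (L2_sq P ?b) * sqrt (L2_sq P u) + \<bar>C\<bar> * sqrt (L2_sq P ?b)"
          by (intro add_mono mult_right_mono) (auto simp: L2_sq_nonneg)
        finally show ?thesis by (simp add: K_def algebra_simps)
      qed
      moreover have "- Re (L2_ip P ?b u - F ?b) \<le> cmod (L2_ip P ?b u - F ?b)"
        using abs_Re_le_cmod[of "L2_ip P ?b u - F ?b"] by linarith
      ultimately show ?thesis using f(2)[of n] L2_sq_nonneg[of P ?b] by argo
    qed
    moreover have "(\<lambda>n. d + 1 / real (Suc n) + 2 * K * sqrt (L2_sq P (\<lambda>x. f n x - u x))) \<longlonglongrightarrow> d + 0 + 2 * K * sqrt 0"
      by (intro tendsto_intros lim LIMSEQ_Suc lim_1_over_n)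
    ultimately show ?thesis by (intro LIMSEQ_le_const) auto
  qed
  have re0: "Re (L2_ip P g u - F g) = 0" if g: "g \<in> L2_fun P" for g
  proof -
    have "(Re (L2_ip P g u - F g))\<^sup>2 \<le> 0 * L2_sq P g"
    proof (rule real_quadratic_nonneg)
      fix t :: real
      let ?g = "\<lambda>x. complex_of_real t * g x"
      have g': "?g \<in> L2_fun P" using g by (rule L2_fun_scale)
      have "J u \<le> J (\<lambda>x. u x + ?g x)" using Ju dle[OF L2_fun_add[OF u g']] by simp
      also have "\<dots> = J u + t\<^sup>2 * L2_sq P g + 2 * (t * Re (L2_ip P g u - F g))"
        using Jadd[OF u g'] g by (simp add: L2_sq_scale L2_ip_scale_left scale algebra_simps)
      finally show "0 \<le> 0 + 2 * t * Re (L2_ip P g u - F g) + t\<^sup>2 * L2_sq P g" by (simp add: mult.assoc)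
    qed (rule L2_sq_nonneg)
    then show ?thesis by simp
  qed
  \<comment> \<open>Real multiples of g only see the real part; applying the result to i times g
    gives the imaginary part.\<close>
  have "F g = L2_ip P g u" if g: "g \<in> L2_fun P" for g
  proof -
    have "Re (L2_ip P (\<lambda>x. \<i> * g x) u - F (\<lambda>x. \<i> * g x)) = 0" using L2_fun_scale[OF g] by (rule re0)
    then have "Im (L2_ip P g u - F g) = 0" using g by (simp add: L2_ip_scale_left scale)
    with re0[OF g] show ?thesis by (simp add: complex_eq_iff)
  qed
  with u show ?thesis by blast
qed

section \<open>Operators on \<open>L\<^sup>2\<close>\<close>

lemma rep_ae_class:
  assumes "f \<in> borel_measurable P"
  shows "rep (ae_class P f) \<in> borel_measurable P" "AE x in P. rep (ae_class P f) x = f x"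
proof -
  have "f \<in> ae_class P f" using assms by (simp add: ae_class_def)
  then have "rep (ae_class P f) \<in> ae_class P f" unfolding rep_def by (rule someI[of "\<lambda>x. x \<in> ae_class P f"])
  then show "rep (ae_class P f) \<in> borel_measurable P" "AE x in P. rep (ae_class P f) x = f x"
    by (auto simp: ae_class_def)
qed

lemma ae_class_eqI:
  assumes "AE x in P. f x = g x" shows "ae_class P f = ae_class P g"
proof -
  have "(AE x in P. h x = f x) \<longleftrightarrow> (AE x in P. h x = g x)" for h
  proof
    show "AE x in P. h x = g x" if "AE x in P. h x = f x" using that assms by eventually_elim simp
    show "AE x in P. h x = f x" if "AE x in P. h x = g x" using that assms by eventually_elim simp
  qed
  then show ?thesis by (simp add: ae_class_def)
qed

lemma ae_class_eqD:
  assumes "f \<in> borel_measurable P" "ae_class P f = ae_class P g" shows "AE x in P. f x = g x"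
proof -
  have "f \<in> ae_class P g" using assms by (auto simp: ae_class_def)
  then show ?thesis by (simp add: ae_class_def)
qed

lemma L2_ip_cong_AE:
  assumes [measurable]: "f \<in> borel_measurable P" "f' \<in> borel_measurable P" "g \<in> borel_measurable P" "g' \<in> borel_measurable P"
    and "AE x in P. f x = f' x" "AE x in P. g x = g' x"
  shows "L2_ip P f g = L2_ip P f' g'"
  unfolding L2_ip_def using assms(5,6) by (intro integral_cong_AE) auto

lemma ae_class_in_L2: "f \<in> L2_fun P \<Longrightarrow> ae_class P f \<in> carrier (L2_space P)"
  by (auto simp: L2_space_def L2_fun_def)

lemma L2_space_carrierE:
  assumes "\<xi> \<in> carrier (L2_space P)"
  obtains f where "f \<in> L2_fun P" "\<xi> = ae_class P f"
  using assms by (auto simp: L2_space_def L2_fun_def)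

lemma rep_L2_fun: "f \<in> L2_fun P \<Longrightarrow> rep (ae_class P f) \<in> L2_fun P"
  by (rule L2_fun_cong_AE) (auto intro: rep_ae_class L2_fun_measurable)

lemma rep_in_L2_fun: "\<xi> \<in> carrier (L2_space P) \<Longrightarrow> rep \<xi> \<in> L2_fun P"
  by (auto elim!: L2_space_carrierE intro: rep_L2_fun)

lemma ae_class_rep:
  assumes "\<xi> \<in> carrier (L2_space P)" shows "ae_class P (rep \<xi>) = \<xi>"
  using assms
  by (auto elim!: L2_space_carrierE intro!: ae_class_eqI rep_ae_class(2) L2_fun_measurable)

lemma L2_space_add:
  assumes "f \<in> L2_fun P" "g \<in> L2_fun P"
  shows "ae_class P f \<oplus>\<^bsub>L2_space P\<^esub> ae_class P g = ae_class P (\<lambda>x. f x + g x)"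
  using rep_ae_class(2)[of f P] rep_ae_class(2)[of g P] assms
  by (auto simp: L2_space_def L2_fun_measurable intro!: ae_class_eqI)

lemma L2_space_smult:
  assumes "f \<in> L2_fun P"
  shows "c \<odot>\<^bsub>L2_space P\<^esub> ae_class P f = ae_class P (\<lambda>x. c * f x)"
  using rep_ae_class(2)[of f P] assms
  by (auto simp: L2_space_def L2_fun_measurable intro!: ae_class_eqI)

lemma L2_space_inner:
  assumes "f \<in> L2_fun P" "g \<in> L2_fun P"
  shows "inner_prod (L2_space P) (ae_class P f) (ae_class P g) = L2_ip P f g"
proof -
  have "inner_prod (L2_space P) (ae_class P f) (ae_class P g) = L2_ip P (rep (ae_class P f)) (rep (ae_class P g))"
    by (simp add: L2_space_def L2_ip_def)
  also have "\<dots> = L2_ip P f g"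
    using assms by (intro L2_ip_cong_AE rep_ae_class L2_fun_measurable)
  finally show ?thesis .
qed

lemma L2_space_hnorm:
  "f \<in> L2_fun P \<Longrightarrow> hnorm (L2_space P) (ae_class P f) = sqrt (L2_sq P f)"
  by (simp add: hnorm_def L2_space_inner L2_ip_self)

lemma L2_space_add_closed:
  "x \<in> carrier (L2_space P) \<Longrightarrow> y \<in> carrier (L2_space P) \<Longrightarrow> x \<oplus>\<^bsub>L2_space P\<^esub> y \<in> carrier (L2_space P)"
  by (auto elim!: L2_space_carrierE simp: L2_space_add intro!: ae_class_in_L2 L2_fun_add)

lemma L2_space_smult_closed:
  "x \<in> carrier (L2_space P) \<Longrightarrow> c \<odot>\<^bsub>L2_space P\<^esub> x \<in> carrier (L2_space P)"
  by (auto elim!: L2_space_carrierE simp: L2_space_smult intro!: ae_class_in_L2 L2_fun_scale)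

lemma L2_space_inner_add_left:
  "x \<in> carrier (L2_space P) \<Longrightarrow> y \<in> carrier (L2_space P) \<Longrightarrow> z \<in> carrier (L2_space P) \<Longrightarrow>
   inner_prod (L2_space P) (x \<oplus>\<^bsub>L2_space P\<^esub> y) z = inner_prod (L2_space P) x z + inner_prod (L2_space P) y z"
  by (auto elim!: L2_space_carrierE simp: L2_space_add L2_space_inner L2_fun_add L2_ip_add_left)

lemma L2_space_inner_smult_left:
  "x \<in> carrier (L2_space P) \<Longrightarrow> z \<in> carrier (L2_space P) \<Longrightarrow>
   inner_prod (L2_space P) (c \<odot>\<^bsub>L2_space P\<^esub> x) z = c * inner_prod (L2_space P) x z"
  by (auto elim!: L2_space_carrierE simp: L2_space_smult L2_space_inner L2_fun_scale L2_ip_scale_left)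

lemma L2_space_inner_cnj:
  "x \<in> carrier (L2_space P) \<Longrightarrow> y \<in> carrier (L2_space P) \<Longrightarrow>
   cnj (inner_prod (L2_space P) x y) = inner_prod (L2_space P) y x"
  by (auto elim!: L2_space_carrierE simp: L2_space_inner L2_ip_cnj)

lemma L2_space_Cauchy_Schwarz:
  "x \<in> carrier (L2_space P) \<Longrightarrow> y \<in> carrier (L2_space P) \<Longrightarrow>
   cmod (inner_prod (L2_space P) x y) \<le> hnorm (L2_space P) x * hnorm (L2_space P) y"
  by (auto elim!: L2_space_carrierE simp: L2_space_inner L2_space_hnorm L2_Cauchy_Schwarz)

lemma L2_space_inner_self:
  "x \<in> carrier (L2_space P) \<Longrightarrow> inner_prod (L2_space P) x x = complex_of_real ((hnorm (L2_space P) x)\<^sup>2)"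
  by (auto elim!: L2_space_carrierE simp: L2_space_inner L2_space_hnorm L2_ip_self L2_sq_nonneg
      of_real_power[symmetric] simp del: of_real_power)

lemma hnorm_nonneg_L2: "x \<in> carrier (L2_space P) \<Longrightarrow> 0 \<le> hnorm (L2_space P) x"
  by (auto elim!: L2_space_carrierE simp: L2_space_hnorm L2_sq_nonneg)

lemma L2_space_inner_nondegenerate:
  assumes x: "x \<in> carrier (L2_space P)" and y: "y \<in> carrier (L2_space P)"
    and eq: "\<And>z. z \<in> carrier (L2_space P) \<Longrightarrow> inner_prod (L2_space P) z x = inner_prod (L2_space P) z y"
  shows "x = y"
proof -
  obtain f where f: "f \<in> L2_fun P" "x = ae_class P f" using x by (rule L2_space_carrierE)
  obtain g where g: "g \<in> L2_fun P" "y = ae_class P g" using y by (rule L2_space_carrierE)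
  define h where "h = (\<lambda>x. f x + (-1) * g x)"
  have h: "h \<in> L2_fun P" unfolding h_def using f g by (intro L2_fun_add L2_fun_scale)
  have "L2_ip P h f = L2_ip P h g"
    using eq[OF ae_class_in_L2[OF h]] f g h by (simp add: L2_space_inner)
  then have "L2_ip P f h = L2_ip P g h" by (metis L2_ip_cnj)
  moreover have "L2_ip P h h = L2_ip P f h + (-1) * L2_ip P g h"
    using L2_ip_add_left[OF f(1) L2_fun_scale[OF g(1), of "-1"] h, folded h_def]
    unfolding L2_ip_scale_left .
  ultimately have "L2_sq P h = 0" by (simp add: L2_ip_self)
  then have "AE x in P. h x = 0" using L2_sq_eq_0_iff[OF h] by simp
  then show ?thesis unfolding f g by (intro ae_class_eqI) (simp add: h_def)
qed

section \<open>Bounded operators and adjoints on L2\<close>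

lemma bounded_opsD:
  assumes "T \<in> bounded_ops H"
  shows "T \<in> carrier H \<rightarrow>\<^sub>E carrier H"
    "x \<in> carrier H \<Longrightarrow> T x \<in> carrier H"
    "x \<in> carrier H \<Longrightarrow> y \<in> carrier H \<Longrightarrow> T (x \<oplus>\<^bsub>H\<^esub> y) = T x \<oplus>\<^bsub>H\<^esub> T y"
    "x \<in> carrier H \<Longrightarrow> T (c \<odot>\<^bsub>H\<^esub> x) = c \<odot>\<^bsub>H\<^esub> T x"
    "\<exists>c. \<forall>x\<in>carrier H. hnorm H (T x) \<le> c * hnorm H x"
  using assms unfolding bounded_ops_def by auto

text \<open>Nondegeneracy of the inner product and extensionality make the definite description in
  \<open>op_adjoint\<close> unique, so exhibiting one bounded S identifies the adjoint.\<close>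

lemma op_adjoint_L2_eqI:
  assumes S: "S \<in> bounded_ops (L2_space P)"
    and eq: "\<And>x y. x \<in> carrier (L2_space P) \<Longrightarrow> y \<in> carrier (L2_space P) \<Longrightarrow>
      inner_prod (L2_space P) (T x) y = inner_prod (L2_space P) x (S y)"
  shows "op_adjoint (L2_space P) T = S"
  unfolding op_adjoint_def
proof (rule the_equality)
  fix S' assume S': "S' \<in> bounded_ops (L2_space P) \<and> (\<forall>x\<in>carrier (L2_space P). \<forall>y\<in>carrier (L2_space P).
      inner_prod (L2_space P) (T x) y = inner_prod (L2_space P) x (S' y))"
  show "S' = S"
  proof (rule extensionalityI)
    show "S' \<in> extensional (carrier (L2_space P))"
      using bounded_opsD(1)[OF conjunct1[OF S']] by (simp add: PiE_def)
    show "S \<in> extensional (carrier (L2_space P))"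
      using bounded_opsD(1)[OF S] by (simp add: PiE_def)
    fix y assume y: "y \<in> carrier (L2_space P)"
    show "S' y = S y"
    proof (rule L2_space_inner_nondegenerate)
      show "S' y \<in> carrier (L2_space P)" by (rule bounded_opsD(2)[OF conjunct1[OF S'] y])
      show "S y \<in> carrier (L2_space P)" by (rule bounded_opsD(2)[OF S y])
      fix z assume "z \<in> carrier (L2_space P)"
      then show "inner_prod (L2_space P) z (S' y) = inner_prod (L2_space P) z (S y)"
        using S' y by (simp add: eq[symmetric])
    qed
  qed
qed (use S in \<open>simp add: eq\<close>)

text \<open>S y is the Riesz representative of x |-> <T x, y>, and S is bounded because ||S y||^2 =
  <T (S y), y>.\<close>

lemma op_adjoint_L2_exists:
  assumes T: "T \<in> bounded_ops (L2_space P)"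
  shows "\<exists>S\<in>bounded_ops (L2_space P). \<forall>x\<in>carrier (L2_space P). \<forall>y\<in>carrier (L2_space P).
      inner_prod (L2_space P) (T x) y = inner_prod (L2_space P) x (S y)"
proof -
  let ?H = "L2_space P" and ?C = "carrier (L2_space P)"
  obtain c0 where c0: "\<And>x. x \<in> ?C \<Longrightarrow> hnorm ?H (T x) \<le> c0 * hnorm ?H x"
    using bounded_opsD(5)[OF T] by blast
  \<comment> \<open>The constant in \<open>bounded_ops\<close> comes without a sign.\<close>
  define c where "c = \<bar>c0\<bar>"
  have c: "hnorm ?H (T x) \<le> c * hnorm ?H x" if "x \<in> ?C" for x
    using c0[OF that] mult_right_mono[of c0 c "hnorm ?H x"] hnorm_nonneg_L2[OF that]
    unfolding c_def by linarith
  note TC = bounded_opsD(2)[OF T]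
  have "\<exists>z\<in>?C. \<forall>x\<in>?C. inner_prod ?H (T x) y = inner_prod ?H x z" if y: "y \<in> ?C" for y
  proof -
    define F where "F f = inner_prod ?H (T (ae_class P f)) y" for f
    have "\<exists>u\<in>L2_fun P. \<forall>f\<in>L2_fun P. F f = L2_ip P f u"
    proof (rule L2_Riesz)
      fix f g assume fg: "f \<in> L2_fun P" "g \<in> L2_fun P"
      show "F (\<lambda>x. f x + g x) = F f + F g"
        unfolding F_def L2_space_add[OF fg, symmetric] using fg y
        by (simp add: bounded_opsD(3)[OF T] ae_class_in_L2 L2_space_inner_add_left TC)
    next
      fix a f assume f: "f \<in> L2_fun P"
      show "F (\<lambda>x. a * f x) = a * F f"
        unfolding F_def L2_space_smult[OF f, symmetric] using f y
        by (simp add: bounded_opsD(4)[OF T] ae_class_in_L2 L2_space_inner_smult_left TC)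
    next
      fix f assume f: "f \<in> L2_fun P"
      have "cmod (F f) \<le> hnorm ?H (T (ae_class P f)) * hnorm ?H y"
        unfolding F_def using f y by (intro L2_space_Cauchy_Schwarz TC ae_class_in_L2)
      also have "\<dots> \<le> (c * hnorm ?H (ae_class P f)) * hnorm ?H y"
        using f y by (intro mult_right_mono c ae_class_in_L2 hnorm_nonneg_L2)
      finally show "cmod (F f) \<le> (c * hnorm ?H y) * sqrt (L2_sq P f)"
        by (simp add: L2_space_hnorm[OF f] mult_ac)
    qed
    then obtain u where u: "u \<in> L2_fun P" "\<And>f. f \<in> L2_fun P \<Longrightarrow> F f = L2_ip P f u" by blast
    show ?thesis
    proof (rule bexI[of _ "ae_class P u"])
      show "\<forall>x\<in>?C. inner_prod ?H (T x) y = inner_prod ?H x (ae_class P u)"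
        using u by (auto elim!: L2_space_carrierE simp: F_def L2_space_inner)
    qed (rule ae_class_in_L2[OF u(1)])
  qed
  then obtain S0 where S0: "\<And>y. y \<in> ?C \<Longrightarrow> S0 y \<in> ?C"
    "\<And>x y. y \<in> ?C \<Longrightarrow> x \<in> ?C \<Longrightarrow> inner_prod ?H (T x) y = inner_prod ?H x (S0 y)"
    by metis
  have ir: "inner_prod ?H z (x \<oplus>\<^bsub>?H\<^esub> y) = inner_prod ?H z x + inner_prod ?H z y"
    if "x \<in> ?C" "y \<in> ?C" "z \<in> ?C" for x y z
    using that by (simp add: L2_space_inner_cnj[of _ _ z, symmetric] L2_space_add_closed L2_space_inner_add_left)
  have sr: "inner_prod ?H z (a \<odot>\<^bsub>?H\<^esub> x) = cnj a * inner_prod ?H z x"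
    if "x \<in> ?C" "z \<in> ?C" for a x z
    using that by (simp add: L2_space_inner_cnj[of _ _ z, symmetric] L2_space_smult_closed L2_space_inner_smult_left)
  define S where "S = (\<lambda>y\<in>?C. S0 y)"
  have "S \<in> bounded_ops ?H"
    unfolding bounded_ops_def
  proof (intro CollectI conjI ballI allI)
    show "S \<in> ?C \<rightarrow>\<^sub>E ?C" using S0 by (auto simp: S_def)
    show "S (x \<oplus>\<^bsub>?H\<^esub> y) = S x \<oplus>\<^bsub>?H\<^esub> S y" if "x \<in> ?C" "y \<in> ?C" for x y
      using that by (intro L2_space_inner_nondegenerate[where P=P])
        (simp_all add: S_def S0(1) L2_space_add_closed ir TC S0(2)[symmetric])
    show "S (a \<odot>\<^bsub>?H\<^esub> x) = a \<odot>\<^bsub>?H\<^esub> S x" if "x \<in> ?C" for a x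
      using that by (intro L2_space_inner_nondegenerate[where P=P])
        (simp_all add: S_def S0(1) L2_space_smult_closed sr TC S0(2)[symmetric])
    show "\<exists>c. \<forall>x\<in>?C. hnorm ?H (S x) \<le> c * hnorm ?H x"
    proof (intro exI[of _ c] ballI)
      fix y assume y: "y \<in> ?C"
      let ?n = "hnorm ?H (S0 y)"
      have "?n\<^sup>2 = cmod (inner_prod ?H (S0 y) (S0 y))"
        using S0(1)[OF y] by (simp add: L2_space_inner_self norm_power)
      also have "inner_prod ?H (S0 y) (S0 y) = inner_prod ?H (T (S0 y)) y"
        using S0 y by simp
      also have "cmod \<dots> \<le> hnorm ?H (T (S0 y)) * hnorm ?H y"
        using S0 y by (intro L2_space_Cauchy_Schwarz TC)
      also have "\<dots> \<le> (c * ?n) * hnorm ?H y"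
        using S0 y by (intro mult_right_mono c hnorm_nonneg_L2)
      finally have *: "?n * ?n \<le> ?n * (c * hnorm ?H y)" by (simp add: power2_eq_square mult_ac)
      have "?n \<le> c * hnorm ?H y"
      proof (cases "?n = 0")
        case True
        then show ?thesis using hnorm_nonneg_L2[OF y] by (simp add: c_def)
      next
        case False
        then have "0 < ?n" using hnorm_nonneg_L2[OF S0(1)[OF y]] by simp
        with * show ?thesis by simp
      qed
      then show "hnorm ?H (S y) \<le> c * hnorm ?H y" using y by (simp add: S_def)
    qed
  qed
  moreover have "\<forall>x\<in>?C. \<forall>y\<in>?C. inner_prod ?H (T x) y = inner_prod ?H x (S y)"
    using S0 by (simp add: S_def)
  ultimately show ?thesis by blast
qed

lemma L2_op_eqI:
  assumes "S \<in> extensional (carrier (L2_space P))" "T \<in> extensional (carrier (L2_space P))"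
    and "\<And>f. f \<in> L2_fun P \<Longrightarrow> S (ae_class P f) = T (ae_class P f)"
  shows "S = T"
  using assms by (intro extensionalityI[of S _ T]) (auto elim!: L2_space_carrierE)

text \<open>For operators given by a formula t on functions, as Koopman and multiplication operators
  are: linearity becomes an identity of functions instead of classes.\<close>

lemma L2_bounded_opsI:
  assumes ext: "T \<in> extensional (carrier (L2_space P))"
    and T: "\<And>f. f \<in> L2_fun P \<Longrightarrow> T (ae_class P f) = ae_class P (t f)"
    and t: "\<And>f. f \<in> L2_fun P \<Longrightarrow> t f \<in> L2_fun P"
    and add: "\<And>f g. t (\<lambda>x. f x + g x) = (\<lambda>x. t f x + t g x)"
    and scale: "\<And>a f. t (\<lambda>x. a * f x) = (\<lambda>x. a * t f x)"
    and bound: "\<And>f. f \<in> L2_fun P \<Longrightarrow> L2_sq P (t f) \<le> C\<^sup>2 * L2_sq P f" "0 \<le> C"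
  shows "T \<in> bounded_ops (L2_space P)"
  unfolding bounded_ops_def
proof (intro CollectI conjI ballI allI)
  let ?H = "L2_space P" and ?C = "carrier (L2_space P)"
  show "T \<in> ?C \<rightarrow>\<^sub>E ?C"
    using ext by (auto simp: PiE_iff T elim!: L2_space_carrierE intro!: ae_class_in_L2 t)
  show "T (x \<oplus>\<^bsub>?H\<^esub> y) = T x \<oplus>\<^bsub>?H\<^esub> T y" if "x \<in> ?C" "y \<in> ?C" for x y
    using that by (auto elim!: L2_space_carrierE simp: L2_space_add T t L2_fun_add add)
  show "T (a \<odot>\<^bsub>?H\<^esub> x) = a \<odot>\<^bsub>?H\<^esub> T x" if "x \<in> ?C" for a x
    using that by (auto elim!: L2_space_carrierE simp: L2_space_smult T t L2_fun_scale scale)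
  show "\<exists>c. \<forall>x\<in>?C. hnorm ?H (T x) \<le> c * hnorm ?H x"
  proof (intro exI[of _ C] ballI)
    fix x assume "x \<in> ?C"
    then obtain f where f: "f \<in> L2_fun P" "x = ae_class P f" by (rule L2_space_carrierE)
    have "sqrt (L2_sq P (t f)) \<le> sqrt (C\<^sup>2 * L2_sq P f)" using bound(1)[OF f(1)] by simp
    then show "hnorm ?H (T x) \<le> C * hnorm ?H x"
      using bound(2) f by (simp add: T t L2_space_hnorm real_sqrt_mult)
  qed
qed

section \<open>Koopman operators and multiplication operators\<close>

definition measure_preserving :: "'a measure \<Rightarrow> 'b measure \<Rightarrow> ('a \<Rightarrow> 'b) \<Rightarrow> bool" where
  "measure_preserving P Q \<Phi> \<longleftrightarrow> \<Phi> \<in> P \<rightarrow>\<^sub>M Q \<and> distr P Q \<Phi> = Q"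

lemma measure_preserving_measurable[measurable_dest]: "measure_preserving P Q \<Phi> \<Longrightarrow> \<Phi> \<in> P \<rightarrow>\<^sub>M Q"
  by (simp add: measure_preserving_def)

lemma measure_preserving_comp:
  "measure_preserving P Q \<Phi> \<Longrightarrow> measure_preserving Q S \<Psi> \<Longrightarrow> measure_preserving P S (\<lambda>x. \<Psi> (\<Phi> x))"
  using distr_distr[of \<Psi> Q S \<Phi> P] unfolding measure_preserving_def comp_def
  by (metis measurable_compose)

lemma measure_preserving_AE:
  assumes "measure_preserving P Q \<Phi>" "AE y in Q. R y" shows "AE x in P. R (\<Phi> x)"
proof -
  have \<Phi>: "\<Phi> \<in> P \<rightarrow>\<^sub>M Q" and eq: "distr P Q \<Phi> = Q"
    using assms(1) by (simp_all add: measure_preserving_def)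
  have "AE y in distr P Q \<Phi>. R y" unfolding eq by (rule assms(2))
  then show ?thesis by (rule AE_distrD[OF \<Phi>])
qed

text \<open>Composition with \<Phi>: isometric if \<Phi> preserves the measure, and invertible, with
  inverse the Koopman operator of \<Psi>, if \<Psi> is a measure preserving inverse of \<Phi> up to
  null sets.\<close>

definition koopman :: "'a measure \<Rightarrow> 'b measure \<Rightarrow> ('a \<Rightarrow> 'b) \<Rightarrow> ('b \<Rightarrow> complex) set \<Rightarrow> ('a \<Rightarrow> complex) set" where
  "koopman P Q \<Phi> = (\<lambda>\<xi>\<in>carrier (L2_space Q). ae_class P (\<lambda>x. rep \<xi> (\<Phi> x)))"

definition mult_op :: "'a measure \<Rightarrow> ('a \<Rightarrow> complex) \<Rightarrow> ('a \<Rightarrow> complex) set \<Rightarrow> ('a \<Rightarrow> complex) set" where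
  "mult_op P f = (\<lambda>\<xi>\<in>carrier (L2_space P). ae_class P (\<lambda>x. f x * rep \<xi> x))"

lemma measure_preserving_distr: "measure_preserving P Q \<Phi> \<Longrightarrow> distr P Q \<Phi> = Q"
  by (simp add: measure_preserving_def)

lemma L2_fun_comp:
  assumes \<Phi>: "measure_preserving P Q \<Phi>" and f: "f \<in> L2_fun Q" shows "(\<lambda>x. f (\<Phi> x)) \<in> L2_fun P"
proof -
  note [measurable] = measure_preserving_measurable[OF \<Phi>] L2_fun_measurable[OF f]
  have "integrable (distr P Q \<Phi>) (\<lambda>x. (cmod (f x))\<^sup>2)"
    unfolding measure_preserving_distr[OF \<Phi>] using f by (simp add: L2_fun_def)
  then have "integrable P (\<lambda>x. (cmod (f (\<Phi> x)))\<^sup>2)"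
    by (subst (asm) integrable_distr_eq) measurable
  then show ?thesis by (simp add: L2_fun_def)
qed

lemma L2_ip_comp:
  assumes "measure_preserving P Q \<Phi>" "f \<in> L2_fun Q" "g \<in> L2_fun Q"
  shows "L2_ip P (\<lambda>x. f (\<Phi> x)) (\<lambda>x. g (\<Phi> x)) = L2_ip Q f g"
proof -
  note [measurable] = measure_preserving_measurable[OF assms(1)] L2_fun_measurable[OF assms(2)]
    L2_fun_measurable[OF assms(3)]
  have "L2_ip Q f g = (LINT y|distr P Q \<Phi>. f y * cnj (g y))"
    unfolding measure_preserving_distr[OF assms(1)] by (simp add: L2_ip_def)
  also have "\<dots> = L2_ip P (\<lambda>x. f (\<Phi> x)) (\<lambda>x. g (\<Phi> x))"
    unfolding L2_ip_def by (rule integral_distr) measurable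
  finally show ?thesis ..
qed

lemma L2_sq_comp:
  assumes "measure_preserving P Q \<Phi>" "f \<in> L2_fun Q"
  shows "L2_sq P (\<lambda>x. f (\<Phi> x)) = L2_sq Q f"
  using L2_ip_comp[OF assms assms(2)] by (simp add: L2_ip_self)

lemma koopman_ae_class:
  assumes "measure_preserving P Q \<Phi>" "f \<in> L2_fun Q"
  shows "koopman P Q \<Phi> (ae_class Q f) = ae_class P (\<lambda>x. f (\<Phi> x))"
proof -
  have "AE y in Q. rep (ae_class Q f) y = f y" using assms by (intro rep_ae_class L2_fun_measurable)
  then have "AE x in P. rep (ae_class Q f) (\<Phi> x) = f (\<Phi> x)"
    by (rule measure_preserving_AE[OF assms(1)])
  then show ?thesis using assms by (simp add: koopman_def ae_class_in_L2 ae_class_eqI)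
qed

lemma koopman_extensional: "koopman P Q \<Phi> \<in> extensional (carrier (L2_space Q))"
  by (simp add: koopman_def)

lemma koopman_bounded:
  assumes "measure_preserving P P \<Phi>" shows "koopman P P \<Phi> \<in> bounded_ops (L2_space P)"
  by (rule L2_bounded_opsI[where t="\<lambda>f x. f (\<Phi> x)" and C=1])
     (use assms in \<open>auto simp: koopman_ae_class L2_fun_comp L2_sq_comp koopman_extensional\<close>)

lemma koopman_comp:
  assumes "measure_preserving P Q \<Phi>" "measure_preserving Q S \<Psi>"
  shows "compose (carrier (L2_space S)) (koopman P Q \<Phi>) (koopman Q S \<Psi>) = koopman P S (\<lambda>x. \<Psi> (\<Phi> x))"
  by (rule L2_op_eqI)
     (use assms in \<open>auto simp: koopman_ae_class L2_fun_comp koopman_extensional compose_def ae_class_in_L2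
        measure_preserving_comp[OF assms]\<close>)

lemma koopman_AE_id:
  assumes "measure_preserving P P \<Phi>" "AE x in P. \<Phi> x = x"
  shows "koopman P P \<Phi> = (\<lambda>\<xi>\<in>carrier (L2_space P). \<xi>)"
proof (rule L2_op_eqI)
  fix f assume f: "f \<in> L2_fun P"
  have "AE x in P. f (\<Phi> x) = f x" using assms(2) by eventually_elim simp
  then show "koopman P P \<Phi> (ae_class P f) = (\<lambda>\<xi>\<in>carrier (L2_space P). \<xi>) (ae_class P f)"
    using f assms by (simp add: koopman_ae_class ae_class_in_L2 ae_class_eqI)
qed (auto simp: koopman_extensional)

text \<open>Substituting \<open>\<Psi> x\<close> for x in the integral of
  \<open>f (\<Phi> x) * cnj (g x)\<close> removes the map from f and puts \<Psi> on g.\<close>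

lemma op_adjoint_koopman:
  assumes \<Phi>: "measure_preserving P P \<Phi>" and \<Psi>: "measure_preserving P P \<Psi>"
    and inv: "AE x in P. \<Phi> (\<Psi> x) = x"
  shows "op_adjoint (L2_space P) (koopman P P \<Phi>) = koopman P P \<Psi>"
proof (rule op_adjoint_L2_eqI)
  fix x y assume "x \<in> carrier (L2_space P)" "y \<in> carrier (L2_space P)"
  then obtain f g where f: "f \<in> L2_fun P" "x = ae_class P f" and g: "g \<in> L2_fun P" "y = ae_class P g"
    by (auto elim!: L2_space_carrierE)
  have [measurable]: "f \<in> borel_measurable P" "g \<in> borel_measurable P" "\<Phi> \<in> P \<rightarrow>\<^sub>M P" "\<Psi> \<in> P \<rightarrow>\<^sub>M P"
    using f(1) g(1) \<Phi> \<Psi> by (simp_all add: L2_fun_measurable measure_preserving_measurable)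
  have "L2_ip P (\<lambda>x. f (\<Phi> x)) g = L2_ip P (\<lambda>x. f (\<Phi> (\<Psi> x))) (\<lambda>x. g (\<Psi> x))"
    by (rule L2_ip_comp[OF \<Psi> L2_fun_comp[OF \<Phi> f(1)] g(1), symmetric])
  also have "\<dots> = L2_ip P f (\<lambda>x. g (\<Psi> x))"
  proof (rule L2_ip_cong_AE)
    show "AE x in P. f (\<Phi> (\<Psi> x)) = f x" using inv by eventually_elim simp
  qed auto
  finally show "inner_prod (L2_space P) (koopman P P \<Phi> x) y = inner_prod (L2_space P) x (koopman P P \<Psi> y)"
    using f g \<Phi> \<Psi> by (simp add: koopman_ae_class L2_fun_comp L2_space_inner)
qed (rule koopman_bounded[OF \<Psi>])

lemma L2_fun_mult:
  assumes b[measurable]: "b \<in> borel_measurable P" and c: "AE x in P. cmod (b x) \<le> c" and f: "f \<in> L2_fun P"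
  shows "(\<lambda>x. b x * f x) \<in> L2_fun P" "L2_sq P (\<lambda>x. b x * f x) \<le> c\<^sup>2 * L2_sq P f"
proof -
  have [measurable]: "f \<in> borel_measurable P" and i: "integrable P (\<lambda>x. (cmod (f x))\<^sup>2)"
    using f by (auto simp: L2_fun_def)
  have le: "AE x in P. (cmod (b x * f x))\<^sup>2 \<le> c\<^sup>2 * (cmod (f x))\<^sup>2"
    using c by eventually_elim (auto simp: norm_mult power_mult_distrib intro!: mult_right_mono power_mono)
  have i2: "integrable P (\<lambda>x. c\<^sup>2 * (cmod (f x))\<^sup>2)" using i by simp
  have i3: "integrable P (\<lambda>x. (cmod (b x * f x))\<^sup>2)"
    by (rule Bochner_Integration.integrable_bound[OF i2]) (use le in auto)
  then show "(\<lambda>x. b x * f x) \<in> L2_fun P" by (simp add: L2_fun_def)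
  show "L2_sq P (\<lambda>x. b x * f x) \<le> c\<^sup>2 * L2_sq P f"
    unfolding L2_sq_def using integral_mono_AE[OF i3 i2 le] by simp
qed

lemma mult_op_ae_class:
  assumes "f \<in> L2_fun P"
  shows "mult_op P b (ae_class P f) = ae_class P (\<lambda>x. b x * f x)"
proof -
  have "AE x in P. b x * rep (ae_class P f) x = b x * f x"
    using rep_ae_class(2)[OF L2_fun_measurable[OF assms]] by eventually_elim simp
  then show ?thesis using assms by (simp add: mult_op_def ae_class_in_L2 ae_class_eqI)
qed

lemma mult_op_extensional: "mult_op P b \<in> extensional (carrier (L2_space P))"
  by (simp add: mult_op_def)

lemma mult_op_bounded:
  assumes b: "b \<in> borel_measurable P" "AE x in P. cmod (b x) \<le> c"
  shows "mult_op P b \<in> bounded_ops (L2_space P)"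
proof -
  have c: "AE x in P. cmod (b x) \<le> \<bar>c\<bar>" using b(2) by eventually_elim simp
  show ?thesis
    by (rule L2_bounded_opsI[where t="\<lambda>f x. b x * f x" and C="\<bar>c\<bar>"])
       (use L2_fun_mult[OF b(1) c] in \<open>auto simp: mult_op_ae_class mult_op_extensional algebra_simps\<close>)
qed

lemma mult_op_cong:
  assumes "AE x in P. b x = b' x" shows "mult_op P b = mult_op P b'"
proof (rule L2_op_eqI)
  fix f assume f: "f \<in> L2_fun P"
  have "AE x in P. b x * f x = b' x * f x" using assms by eventually_elim simp
  with f show "mult_op P b (ae_class P f) = mult_op P b' (ae_class P f)"
    by (simp add: mult_op_ae_class ae_class_eqI)
qed (auto simp: mult_op_extensional)

lemma mult_op_comp:
  assumes "b' \<in> borel_measurable P" "AE x in P. cmod (b' x) \<le> c"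
  shows "compose (carrier (L2_space P)) (mult_op P b) (mult_op P b') = mult_op P (\<lambda>x. b x * b' x)"
  by (rule L2_op_eqI)
     (use L2_fun_mult[OF assms] in \<open>auto simp: mult_op_ae_class mult_op_extensional compose_def ae_class_in_L2 mult.assoc\<close>)

lemma op_adjoint_mult_op:
  assumes b: "b \<in> borel_measurable P" "AE x in P. cmod (b x) \<le> c"
  shows "op_adjoint (L2_space P) (mult_op P b) = mult_op P (\<lambda>x. cnj (b x))"
proof (rule op_adjoint_L2_eqI)
  have b': "(\<lambda>x. cnj (b x)) \<in> borel_measurable P" "AE x in P. cmod (cnj (b x)) \<le> c"
    using b by auto
  then show "mult_op P (\<lambda>x. cnj (b x)) \<in> bounded_ops (L2_space P)" by (rule mult_op_bounded)
  fix x y assume "x \<in> carrier (L2_space P)" "y \<in> carrier (L2_space P)"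
  then obtain f g where f: "f \<in> L2_fun P" "x = ae_class P f" and g: "g \<in> L2_fun P" "y = ae_class P g"
    by (auto elim!: L2_space_carrierE)
  show "inner_prod (L2_space P) (mult_op P b x) y = inner_prod (L2_space P) x (mult_op P (\<lambda>x. cnj (b x)) y)"
    using f g L2_fun_mult(1)[OF b f(1)] L2_fun_mult(1)[OF b' g(1)]
    by (simp add: mult_op_ae_class L2_space_inner L2_ip_def mult_ac)
qed

lemma koopman_unitary:
  assumes \<Phi>: "measure_preserving P Q \<Phi>"
  shows "x \<in> carrier (L2_space Q) \<Longrightarrow> koopman P Q \<Phi> x \<in> carrier (L2_space P)"
    "x \<in> carrier (L2_space Q) \<Longrightarrow> y \<in> carrier (L2_space Q) \<Longrightarrow>
      koopman P Q \<Phi> (x \<oplus>\<^bsub>L2_space Q\<^esub> y) = koopman P Q \<Phi> x \<oplus>\<^bsub>L2_space P\<^esub> koopman P Q \<Phi> y"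
    "x \<in> carrier (L2_space Q) \<Longrightarrow> koopman P Q \<Phi> (c \<odot>\<^bsub>L2_space Q\<^esub> x) = c \<odot>\<^bsub>L2_space P\<^esub> koopman P Q \<Phi> x"
    "x \<in> carrier (L2_space Q) \<Longrightarrow> y \<in> carrier (L2_space Q) \<Longrightarrow>
      inner_prod (L2_space P) (koopman P Q \<Phi> x) (koopman P Q \<Phi> y) = inner_prod (L2_space Q) x y"
  using \<Phi> by (auto elim!: L2_space_carrierE simp: koopman_ae_class L2_space_add L2_space_smult L2_fun_add
      L2_fun_scale L2_fun_comp L2_space_inner L2_ip_comp intro!: ae_class_in_L2)

section \<open>Conjugation by measure isomorphisms\<close>

lemma embedding_comp:
  assumes f: "embedding A B f" and g: "embedding B C g"
  shows "embedding A C (\<lambda>x. g (f x))"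
proof -
  have fh: "f \<in> Ring.ring_hom A B" and gh: "g \<in> Ring.ring_hom B C"
    using f g by (simp_all add: embedding_def)
  have "g \<circ> f \<in> Ring.ring_hom A C" by (rule ring_hom_trans[OF fh gh])
  moreover have "\<And>x. x \<in> carrier A \<Longrightarrow> f x \<in> carrier B" by (rule ring_hom_closed[OF fh])
  ultimately show ?thesis using f g by (simp add: embedding_def comp_def)
qed

text \<open>Conjugation by the unitary of the overview, where the Koopman operator of \<Psi> stands
  for its inverse.\<close>

definition koopman_conj ::
    "'a measure \<Rightarrow> 'b measure \<Rightarrow> ('a \<Rightarrow> 'b) \<Rightarrow> ('b \<Rightarrow> 'a) \<Rightarrow>
     (('b \<Rightarrow> complex) set \<Rightarrow> ('b \<Rightarrow> complex) set) \<Rightarrow> ('a \<Rightarrow> complex) set \<Rightarrow> ('a \<Rightarrow> complex) set" where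
  "koopman_conj P Q \<Phi> \<Psi> T = (\<lambda>\<xi>\<in>carrier (L2_space P). koopman P Q \<Phi> (T (koopman Q P \<Psi> \<xi>)))"

text \<open>Both maps are total and inverse to each other almost everywhere, which is all that
  operators on classes can detect.\<close>

locale measure_iso =
  fixes P :: "'a measure" and Q :: "'b measure" and \<Phi> :: "'a \<Rightarrow> 'b" and \<Psi> :: "'b \<Rightarrow> 'a"
  assumes \<Phi>: "measure_preserving P Q \<Phi>" and \<Psi>: "measure_preserving Q P \<Psi>"
    and \<Psi>\<Phi>: "AE x in P. \<Psi> (\<Phi> x) = x" and \<Phi>\<Psi>: "AE y in Q. \<Phi> (\<Psi> y) = y"
begin

abbreviation "W \<equiv> koopman P Q \<Phi>"
abbreviation "V \<equiv> koopman Q P \<Psi>"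
abbreviation "Ad \<equiv> koopman_conj P Q \<Phi> \<Psi>"
abbreviation "HP \<equiv> L2_space P"
abbreviation "HQ \<equiv> L2_space Q"

lemma inverse_iso: "measure_iso Q P \<Psi> \<Phi>"
  using \<Phi> \<Psi> \<Psi>\<Phi> \<Phi>\<Psi> by (simp add: measure_iso_def)

lemmas W_closed = koopman_unitary(1)[OF \<Phi>] and W_add = koopman_unitary(2)[OF \<Phi>]
  and W_smult = koopman_unitary(3)[OF \<Phi>] and W_inner = koopman_unitary(4)[OF \<Phi>]
lemmas V_closed = koopman_unitary(1)[OF \<Psi>] and V_add = koopman_unitary(2)[OF \<Psi>]
  and V_smult = koopman_unitary(3)[OF \<Psi>] and V_inner = koopman_unitary(4)[OF \<Psi>]

lemma WV: assumes "x \<in> carrier HP" shows "W (V x) = x"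
proof -
  have "W (V x) = compose (carrier HP) W V x" using assms by (simp add: compose_def)
  also have "\<dots> = x"
    using assms by (simp add: koopman_comp[OF \<Phi> \<Psi>] koopman_AE_id[OF measure_preserving_comp[OF \<Phi> \<Psi>] \<Psi>\<Phi>])
  finally show ?thesis .
qed

lemma VW: assumes "y \<in> carrier HQ" shows "V (W y) = y"
  by (rule measure_iso.WV[OF inverse_iso assms])

lemma Ad_app: "x \<in> carrier HP \<Longrightarrow> Ad T x = W (T (V x))"
  by (simp add: koopman_conj_def)

lemma Ad_extensional: "Ad T \<in> extensional (carrier HP)"
  by (simp add: koopman_conj_def)

lemma hnorm_W: "x \<in> carrier HQ \<Longrightarrow> hnorm HP (W x) = hnorm HQ x"
  by (simp add: hnorm_def W_inner)

lemma hnorm_V: "x \<in> carrier HP \<Longrightarrow> hnorm HQ (V x) = hnorm HP x"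
  by (simp add: hnorm_def V_inner)

lemma Ad_bounded:
  assumes T: "T \<in> bounded_ops HQ" shows "Ad T \<in> bounded_ops HP"
proof -
  obtain c where c: "\<And>x. x \<in> carrier HQ \<Longrightarrow> hnorm HQ (T x) \<le> c * hnorm HQ x"
    using bounded_opsD(5)[OF T] by blast
  have cl: "Ad T x \<in> carrier HP" if "x \<in> carrier HP" for x
    using that by (simp add: Ad_app W_closed V_closed bounded_opsD(2)[OF T])
  have "hnorm HP (Ad T x) \<le> c * hnorm HP x" if "x \<in> carrier HP" for x
    using that c[OF V_closed[OF that]] by (simp add: Ad_app hnorm_W hnorm_V V_closed bounded_opsD(2)[OF T])
  then show ?thesis
    using cl Ad_extensional unfolding bounded_ops_def
    by (auto simp: PiE_iff Ad_app L2_space_add_closed L2_space_smult_closed V_add W_add V_smult W_smult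
        V_closed bounded_opsD(2-4)[OF T])
qed

lemma Ad_compose:
  assumes "T \<in> bounded_ops HQ"
  shows "Ad (compose (carrier HQ) S T) = compose (carrier HP) (Ad S) (Ad T)"
  by (rule extensionalityI[of _ "carrier HP"])
     (simp_all add: Ad_extensional compose_def Ad_app V_closed W_closed VW bounded_opsD(2)[OF assms])

lemma Ad_inverse:
  assumes T: "T \<in> bounded_ops HQ" shows "koopman_conj Q P \<Psi> \<Phi> (Ad T) = T"
proof (rule extensionalityI)
  show "T \<in> extensional (carrier HQ)" using bounded_opsD(1)[OF T] by (simp add: PiE_def)
  show "koopman_conj Q P \<Psi> \<Phi> (Ad T) \<in> extensional (carrier HQ)" by (simp add: koopman_conj_def)
  fix x assume "x \<in> carrier HQ"
  then show "koopman_conj Q P \<Psi> \<Phi> (Ad T) x = T x"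
    by (simp add: measure_iso.Ad_app[OF inverse_iso] Ad_app W_closed VW bounded_opsD(2)[OF T])
qed

lemma Ad_op_adjoint:
  assumes T: "T \<in> bounded_ops HQ" shows "Ad (op_adjoint HQ T) = op_adjoint HP (Ad T)"
proof -
  obtain S where S: "S \<in> bounded_ops HQ"
    and eq: "\<And>x y. x \<in> carrier HQ \<Longrightarrow> y \<in> carrier HQ \<Longrightarrow> inner_prod HQ (T x) y = inner_prod HQ x (S y)"
    using op_adjoint_L2_exists[OF T] by blast
  have "op_adjoint HQ T = S" by (rule op_adjoint_L2_eqI[OF S eq])
  moreover have "op_adjoint HP (Ad T) = Ad S"
  proof (rule op_adjoint_L2_eqI[OF Ad_bounded[OF S]])
    fix x y assume xy: "x \<in> carrier HP" "y \<in> carrier HP"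
    have "inner_prod HP (Ad T x) y = inner_prod HP (W (T (V x))) (W (V y))"
      using xy by (simp add: Ad_app WV)
    also have "\<dots> = inner_prod HQ (T (V x)) (V y)"
      using xy by (simp add: W_inner V_closed bounded_opsD(2)[OF T])
    also have "\<dots> = inner_prod HQ (V x) (S (V y))" using xy by (simp add: eq V_closed)
    also have "\<dots> = inner_prod HP (W (V x)) (W (S (V y)))"
      using xy by (simp add: W_inner V_closed bounded_opsD(2)[OF S])
    finally show "inner_prod HP (Ad T x) y = inner_prod HP x (Ad S y)"
      using xy by (simp add: Ad_app WV)
  qed
  ultimately show ?thesis by simp
qed

lemma Ad_embedding:
  assumes B: "B1 \<subseteq> bounded_ops HQ" "\<And>T. T \<in> B1 \<Longrightarrow> Ad T \<in> B2"
    and \<tau>: "\<And>T. T \<in> B1 \<Longrightarrow> \<tau>2 (Ad T) = \<tau>1 T"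
  shows "embedding (operator_alg HQ B1 \<tau>1) (operator_alg HP B2 \<tau>2) Ad"
proof -
  have b: "T \<in> bounded_ops HQ" if "T \<in> B1" for T using that B by blast
  have TC: "T x \<in> carrier HQ" if "T \<in> B1" "x \<in> carrier HQ" for T x
    using bounded_opsD(2)[OF b] that by blast
  have "Ad \<in> Ring.ring_hom (operator_alg HQ B1 \<tau>1) (operator_alg HP B2 \<tau>2)"
  proof (rule ring_hom_memI)
    fix S T assume S: "S \<in> carrier (operator_alg HQ B1 \<tau>1)" and T: "T \<in> carrier (operator_alg HQ B1 \<tau>1)"
    show "Ad (S \<otimes>\<^bsub>operator_alg HQ B1 \<tau>1\<^esub> T) = Ad S \<otimes>\<^bsub>operator_alg HP B2 \<tau>2\<^esub> Ad T"
      using T b by (simp add: operator_alg_def Ad_compose)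
    show "Ad (S \<oplus>\<^bsub>operator_alg HQ B1 \<tau>1\<^esub> T) = Ad S \<oplus>\<^bsub>operator_alg HP B2 \<tau>2\<^esub> Ad T"
      by (rule extensionalityI[of _ "carrier HP"])
         (use S T in \<open>simp_all add: operator_alg_def Ad_extensional Ad_app V_closed W_add TC\<close>)
  next
    show "Ad \<one>\<^bsub>operator_alg HQ B1 \<tau>1\<^esub> = \<one>\<^bsub>operator_alg HP B2 \<tau>2\<^esub>"
      by (rule extensionalityI[of _ "carrier HP"])
         (simp_all add: operator_alg_def Ad_extensional Ad_app V_closed WV)
  qed (use B in \<open>auto simp: operator_alg_def\<close>)
  moreover have "Ad (c \<odot>\<^bsub>operator_alg HQ B1 \<tau>1\<^esub> T) = c \<odot>\<^bsub>operator_alg HP B2 \<tau>2\<^esub> Ad T"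
    if "T \<in> carrier (operator_alg HQ B1 \<tau>1)" for c T
    by (rule extensionalityI[of _ "carrier HP"])
       (use that in \<open>simp_all add: operator_alg_def Ad_extensional Ad_app V_closed W_smult TC\<close>)
  ultimately show ?thesis
    using b \<tau> by (simp add: embedding_def operator_alg_def Ad_op_adjoint)
qed

text \<open>If T commutes with A2, it commutes with all \<open>Ad A\<close> for A in A1, as these
  lie in the bicommutant of A2. Pulled back, \<open>inv.Ad T\<close> commutes with A1, hence with S;
  pushed forward again, T commutes with \<open>Ad S\<close>. So only the images of the generators
  have to be located.\<close>

lemma Ad_bicommutant:
  assumes A1: "A1 \<subseteq> bounded_ops HQ"
    and A2: "\<And>T. T \<in> A1 \<Longrightarrow> Ad T \<in> commutant HP (commutant HP A2)"
    and S: "S \<in> commutant HQ (commutant HQ A1)"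
  shows "Ad S \<in> commutant HP (commutant HP A2)"
proof -
  interpret inv: measure_iso Q P \<Psi> \<Phi> by (rule inverse_iso)
  have Sb: "S \<in> bounded_ops HQ" using S by (simp add: commutant_def)
  show ?thesis
    unfolding commutant_def[of HP "commutant HP A2"]
  proof (intro CollectI conjI ballI)
    show "Ad S \<in> bounded_ops HP" by (rule Ad_bounded[OF Sb])
    fix T assume T: "T \<in> commutant HP A2"
    have Tb: "T \<in> bounded_ops HP" using T by (simp add: commutant_def)
    have T'b: "inv.Ad T \<in> bounded_ops HQ" by (rule inv.Ad_bounded[OF Tb])
    have "inv.Ad T \<in> commutant HQ A1"
      unfolding commutant_def
    proof (intro CollectI conjI ballI T'b)
      fix A assume A: "A \<in> A1"
      have Ab: "A \<in> bounded_ops HQ" using A A1 by blast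
      have "compose (carrier HP) (Ad A) T = compose (carrier HP) T (Ad A)"
        using A2[OF A] T by (simp add: commutant_def[of HP "commutant HP A2"])
      then have "inv.Ad (compose (carrier HP) (Ad A) T) = inv.Ad (compose (carrier HP) T (Ad A))" by simp
      then show "compose (carrier HQ) (inv.Ad T) A = compose (carrier HQ) A (inv.Ad T)"
        by (simp add: inv.Ad_compose Tb Ad_bounded Ab Ad_inverse)
    qed
    then have "compose (carrier HQ) S (inv.Ad T) = compose (carrier HQ) (inv.Ad T) S"
      using S by (simp add: commutant_def[of HQ "commutant HQ A1"])
    then have "Ad (compose (carrier HQ) S (inv.Ad T)) = Ad (compose (carrier HQ) (inv.Ad T) S)" by simp
    then show "compose (carrier HP) (Ad S) T = compose (carrier HP) T (Ad S)"
      by (simp add: Ad_compose T'b Sb inv.Ad_inverse Tb)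
  qed
qed

end

section \<open>Products in commutants\<close>

lemma bicommutant_contains: "A \<subseteq> bounded_ops H \<Longrightarrow> A \<subseteq> commutant H (commutant H A)"
  by (auto simp: commutant_def)

lemma compose_bounded_L2:
  assumes S: "S \<in> bounded_ops (L2_space P)" and T: "T \<in> bounded_ops (L2_space P)"
  shows "compose (carrier (L2_space P)) S T \<in> bounded_ops (L2_space P)"
proof -
  obtain c where c: "\<And>x. x \<in> carrier (L2_space P) \<Longrightarrow> hnorm (L2_space P) (S x) \<le> c * hnorm (L2_space P) x"
    using bounded_opsD(5)[OF S] by blast
  obtain d where d: "\<And>x. x \<in> carrier (L2_space P) \<Longrightarrow> hnorm (L2_space P) (T x) \<le> d * hnorm (L2_space P) x"
    using bounded_opsD(5)[OF T] by blast
  have "hnorm (L2_space P) (S (T x)) \<le> (\<bar>c\<bar> * d) * hnorm (L2_space P) x" if x: "x \<in> carrier (L2_space P)" for x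
  proof -
    have "hnorm (L2_space P) (S (T x)) \<le> c * hnorm (L2_space P) (T x)"
      by (rule c[OF bounded_opsD(2)[OF T x]])
    also have "\<dots> \<le> \<bar>c\<bar> * hnorm (L2_space P) (T x)"
      using hnorm_nonneg_L2[OF bounded_opsD(2)[OF T x]] by (intro mult_right_mono) auto
    also have "\<dots> \<le> \<bar>c\<bar> * (d * hnorm (L2_space P) x)" by (intro mult_left_mono d x) auto
    finally show ?thesis by (simp add: mult.assoc)
  qed
  then show ?thesis
    unfolding bounded_ops_def
    by (auto simp: compose_def L2_space_add_closed L2_space_smult_closed bounded_opsD(2-4)[OF S] bounded_opsD(2-4)[OF T])
qed

lemma commutant_L2_compose_closed:
  assumes D: "D \<subseteq> bounded_ops (L2_space P)"
    and S: "S \<in> commutant (L2_space P) D" and T: "T \<in> commutant (L2_space P) D"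
  shows "compose (carrier (L2_space P)) S T \<in> commutant (L2_space P) D"
  unfolding commutant_def
proof (intro CollectI conjI ballI)
  let ?C = "carrier (L2_space P)"
  have Sb: "S \<in> bounded_ops (L2_space P)" and Tb: "T \<in> bounded_ops (L2_space P)"
    using S T by (auto simp: commutant_def)
  show "compose ?C S T \<in> bounded_ops (L2_space P)" by (rule compose_bounded_L2[OF Sb Tb])
  fix A assume A: "A \<in> D"
  have Ab: "A \<in> bounded_ops (L2_space P)" using A D by blast
  have comm: "S (A x) = A (S x)" "T (A x) = A (T x)" if "x \<in> ?C" for x
  proof -
    have "compose ?C S A x = compose ?C A S x" "compose ?C T A x = compose ?C A T x"
      using S T A by (simp_all add: commutant_def)
    then show "S (A x) = A (S x)" "T (A x) = A (T x)" using that by (simp_all add: compose_def)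
  qed
  show "compose ?C (compose ?C S T) A = compose ?C A (compose ?C S T)"
    by (rule extensionalityI[of _ ?C])
       (simp_all add: compose_def comm bounded_opsD(2)[OF Ab] bounded_opsD(2)[OF Tb])
qed

section \<open>Actions and cocycles\<close>

text \<open>In a T1 space with a countable base two points agree once every base set around the
  first contains the second. The set where f and g differ is therefore a countable union of
  measurable sets. The measurability of the cocycle rests on this.\<close>

lemma standard_borel_eq_sets:
  assumes N: "standard_borel N" and f[measurable]: "f \<in> S \<rightarrow>\<^sub>M N" and g[measurable]: "g \<in> S \<rightarrow>\<^sub>M N"
  shows "{x \<in> space S. f x = g x} \<in> sets S"
proof -
  obtain T where T: "topspace T = space N" "completely_metrizable_space T" "second_countable T"
    "sets N = sigma_sets (space N) {U. openin T U}"
    using N unfolding standard_borel_def by blast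
  have t1: "t1_space T"
    by (rule metrizable_imp_t1_space[OF completely_metrizable_imp_metrizable_space[OF T(2)]])
  obtain B where B: "countable B" "\<And>V. V \<in> B \<Longrightarrow> openin T V"
    "\<And>U x. openin T U \<Longrightarrow> x \<in> U \<Longrightarrow> \<exists>V\<in>B. x \<in> V \<and> V \<subseteq> U"
    using T(3) unfolding second_countable_def by metis
  have [measurable]: "V \<in> sets N" if "V \<in> B" for V
    using B(2)[OF that] T(4) by (auto intro: sigma_sets.Basic)
  have sep: "f x = g x" if x: "x \<in> space S" and V: "\<And>V. V \<in> B \<Longrightarrow> f x \<in> V \<Longrightarrow> g x \<in> V" for x
  proof (rule ccontr)
      assume "f x \<noteq> g x"
      moreover have "f x \<in> topspace T" "g x \<in> topspace T"
        using x measurable_space[OF f] measurable_space[OF g] T(1) by auto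
      ultimately obtain U where U: "openin T U" "f x \<in> U" "g x \<notin> U"
        using t1 unfolding T1_Spaces.t1_space_def by blast
      then obtain W where "W \<in> B" "f x \<in> W" "W \<subseteq> U" using B(3) by blast
      with V U show False by blast
    qed
  have "{x \<in> space S. f x = g x} = space S - (\<Union>V\<in>B. {x \<in> space S. f x \<in> V \<and> g x \<notin> V})"
    using sep by auto
  also have "\<dots> \<in> sets S"
  proof (intro sets.Diff sets.top sets.countable_UN'' B(1))
    fix V assume "V \<in> B"
    then have [measurable]: "V \<in> sets N" by measurable
    show "{x \<in> space S. f x \<in> V \<and> g x \<notin> V} \<in> sets S" by measurable
  qed
  finally show ?thesis .
qed

section \<open>Products with a countable discrete set\<close>

lemma AE_obtain_measurable:
  assumes "AE x in M. R x"
  obtains E where "E \<in> sets M" "\<And>x. x \<in> E \<Longrightarrow> R x" "AE x in M. x \<in> E"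
proof -
  obtain Z where Z: "{x \<in> space M. \<not> R x} \<subseteq> Z" "emeasure M Z = 0" "Z \<in> sets M"
    using assms by (rule AE_E)
  have "AE x in M. x \<notin> Z" using Z by (intro AE_not_in) (auto simp: null_sets_def)
  then have "AE x in M. x \<in> space M - Z" by (rule AE_mp) (auto intro: AE_I2)
  then show ?thesis using Z by (intro that[of "space M - Z"]) auto
qed

lemma measurable_pair_count_space:
  assumes I: "countable I" and f: "\<And>k. k \<in> I \<Longrightarrow> (\<lambda>x. f (x, k)) \<in> M \<rightarrow>\<^sub>M L"
  shows "f \<in> M \<Otimes>\<^sub>M count_space I \<rightarrow>\<^sub>M L"
proof -
  have "(\<lambda>(k, x). f (x, k)) \<in> count_space I \<Otimes>\<^sub>M M \<rightarrow>\<^sub>M L"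
    using f by (intro measurable_pair_measure_countable1 I) auto
  then show ?thesis by (rule measurable_pair_swap[where f="\<lambda>(k, x). f (x, k)", simplified])
qed

lemma AE_cp_fst:
  assumes I: "countable I" and R: "AE x in M. R x" shows "AE z in M \<Otimes>\<^sub>M count_space I. R (fst z)"
proof -
  obtain E where E: "E \<in> sets M" "\<And>x. x \<in> E \<Longrightarrow> R x" "AE x in M. x \<in> E"
    using AE_obtain_measurable[OF R] by blast
  interpret sigma_finite_measure "count_space I" by (rule sigma_finite_measure_count_space_countable[OF I])
  have "space M - E \<in> null_sets M" using E by (simp add: AE_iff_null_sets[symmetric] AE_iff_null set_diff_eq)
  then have "(space M - E) \<times> I \<in> null_sets (M \<Otimes>\<^sub>M count_space I)"
    by (intro times_in_null_sets1) auto
  then show ?thesis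
    by (rule AE_I') (use E in \<open>auto simp: space_pair_measure\<close>)
qed

text \<open>On almost every fibre \<open>l x\<close> is a bijection and preserves counting measure,
  so after integrating over the fibres only the effect of \<theta> on the base remains. The shifts
  behind the unitaries u_g and the map \<Phi> of an orbit equivalence both have this form.\<close>

lemma measure_preserving_fibred:
  assumes G: "countable G" and H: "countable H" and \<theta>: "measure_preserving M N \<theta>"
    and l: "\<And>k. k \<in> G \<Longrightarrow> (\<lambda>x. l x k) \<in> M \<rightarrow>\<^sub>M count_space H"
    and bij: "AE x in M. bij_betw (l x) G H"
  shows "measure_preserving (M \<Otimes>\<^sub>M count_space G) (N \<Otimes>\<^sub>M count_space H) (\<lambda>(x, k). (\<theta> x, l x k))"
proof -
  let ?P = "M \<Otimes>\<^sub>M count_space G" and ?Q = "N \<Otimes>\<^sub>M count_space H" and ?F = "\<lambda>(x, k). (\<theta> x, l x k)"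
  interpret cG: sigma_finite_measure "count_space G" by (rule sigma_finite_measure_count_space_countable[OF G])
  interpret cH: sigma_finite_measure "count_space H" by (rule sigma_finite_measure_count_space_countable[OF H])
  note [measurable] = measure_preserving_measurable[OF \<theta>]
  have F[measurable]: "?F \<in> ?P \<rightarrow>\<^sub>M ?Q"
    by (rule measurable_pair_count_space[OF G]) (use l in simp)
  have "distr ?P ?Q ?F = ?Q"
  proof (rule measure_eqI)
    fix A assume "A \<in> sets (distr ?P ?Q ?F)"
    then have A[measurable]: "A \<in> sets ?Q" by simp
    define J where "J y = (\<integral>\<^sup>+ m. indicator A (y, m) \<partial>count_space H)" for y
    have J[measurable]: "J \<in> borel_measurable N" unfolding J_def by measurable
    have "emeasure (distr ?P ?Q ?F) A = emeasure ?P (?F -` A \<inter> space ?P)"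
      by (rule emeasure_distr) measurable
    also have "\<dots> = (\<integral>\<^sup>+ x. \<integral>\<^sup>+ k. indicator (?F -` A \<inter> space ?P) (x, k) \<partial>count_space G \<partial>M)"
      by (rule cG.emeasure_pair_measure) measurable
    also have "\<dots> = (\<integral>\<^sup>+ x. J (\<theta> x) \<partial>M)"
    proof (rule nn_integral_cong_AE)
      show "AE x in M. (\<integral>\<^sup>+ k. indicator (?F -` A \<inter> space ?P) (x, k) \<partial>count_space G) = J (\<theta> x)"
        using bij AE_space
      proof eventually_elim
        case (elim x)
        have "(\<integral>\<^sup>+ k. indicator (?F -` A \<inter> space ?P) (x, k) \<partial>count_space G)
            = (\<integral>\<^sup>+ k. indicator A (\<theta> x, l x k) \<partial>count_space G)"
          using elim(2) by (intro nn_integral_cong) (auto simp: space_pair_measure split: split_indicator)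
        also have "\<dots> = J (\<theta> x)"
          unfolding J_def by (rule nn_integral_bij_count_space[OF elim(1)])
        finally show ?case .
      qed
    qed
    also have "\<dots> = (\<integral>\<^sup>+ y. J y \<partial>distr M N \<theta>)"
      by (rule nn_integral_distr[symmetric]) measurable
    also have "\<dots> = emeasure ?Q A"
      unfolding measure_preserving_distr[OF \<theta>] J_def by (rule cH.emeasure_pair_measure[symmetric]) (rule A)
    finally show "emeasure (distr ?P ?Q ?F) A = emeasure ?Q A" .
  qed simp
  with F show ?thesis by (simp add: measure_preserving_def)
qed

section \<open>Measure preserving actions and freeness\<close>

locale pmp =
  fixes G :: "('g, 'm) monoid_scheme" and M :: "'a measure" and \<alpha> :: "'g \<Rightarrow> 'a \<Rightarrow> 'a"
  assumes pmp: "pmp_action G M \<alpha>"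
begin

lemma is_group: "group G" and countable_G: "countable (carrier G)" and prob: "prob_space M"
  and std: "standard_borel M" and act: "group_action G (space M) \<alpha>"
  using pmp by (auto simp: pmp_action_def)

lemma act_mp: "g \<in> carrier G \<Longrightarrow> measure_preserving M M (\<alpha> g)"
  using pmp by (simp add: pmp_action_def measure_preserving_def)

sublocale gr: group G by (rule is_group)

lemma act_mult: "x \<in> space M \<Longrightarrow> g \<in> carrier G \<Longrightarrow> h \<in> carrier G \<Longrightarrow> \<alpha> (g \<otimes>\<^bsub>G\<^esub> h) x = \<alpha> g (\<alpha> h x)"
  by (rule group_action.composition_rule[OF act])

lemma act_one: "x \<in> space M \<Longrightarrow> \<alpha> \<one>\<^bsub>G\<^esub> x = x"
  using fun_cong[OF group_action.id_eq_one[OF act], of x] by simp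

lemma act_closed: "x \<in> space M \<Longrightarrow> g \<in> carrier G \<Longrightarrow> \<alpha> g x \<in> space M"
  using group_action.element_image[OF act] by blast

lemma act_inv: "x \<in> space M \<Longrightarrow> g \<in> carrier G \<Longrightarrow> \<alpha> (inv\<^bsub>G\<^esub> g) (\<alpha> g x) = x"
  "x \<in> space M \<Longrightarrow> g \<in> carrier G \<Longrightarrow> \<alpha> g (\<alpha> (inv\<^bsub>G\<^esub> g) x) = x"
  by (simp_all add: act_mult[symmetric] act_one)

text \<open>The point map that induces u_g. Once u_g is a Koopman operator, its adjoint, products
  and conjugates are computed on points.\<close>

definition shift :: "'g \<Rightarrow> 'a \<times> 'g \<Rightarrow> 'a \<times> 'g" where
  "shift g = (\<lambda>(x, k). (\<alpha> (inv\<^bsub>G\<^esub> g) x, inv\<^bsub>G\<^esub> g \<otimes>\<^bsub>G\<^esub> k))"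

lemma shift_mp: assumes g: "g \<in> carrier G" shows "measure_preserving (cp_measure G M) (cp_measure G M) (shift g)"
  unfolding cp_measure_def shift_def
proof (rule measure_preserving_fibred[OF countable_G countable_G])
  show "measure_preserving M M (\<alpha> (inv\<^bsub>G\<^esub> g))" using g by (simp add: act_mp)
  have "bij_betw (\<lambda>k. inv\<^bsub>G\<^esub> g \<otimes>\<^bsub>G\<^esub> k) (carrier G) (carrier G)"
    by (rule bij_betw_byWitness[where f'="\<lambda>k. g \<otimes>\<^bsub>G\<^esub> k"])
       (use g in \<open>auto simp: gr.m_assoc[symmetric]\<close>)
  then show "AE x in M. bij_betw (\<lambda>k. inv\<^bsub>G\<^esub> g \<otimes>\<^bsub>G\<^esub> k) (carrier G) (carrier G)" by simp
qed (use g in auto)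

lemma cp_unitary_koopman: "cp_unitary G M \<alpha> g = koopman (cp_measure G M) (cp_measure G M) (shift g)"
  by (simp add: cp_unitary_def koopman_def shift_def case_prod_beta')

end

text \<open>A version of freeness without exceptional points: X is conull, invariant, and all its
  points have trivial stabiliser.\<close>

locale free_pmp = pmp G M \<alpha> for G :: "('g, 'm) monoid_scheme" and M :: "'a measure" and \<alpha> +
  fixes X :: "'a set"
  assumes X_sets[measurable]: "X \<in> sets M" and X_AE: "AE x in M. x \<in> X"
    and X_inv: "x \<in> X \<Longrightarrow> g \<in> carrier G \<Longrightarrow> \<alpha> g x \<in> X"
    and X_free: "x \<in> X \<Longrightarrow> g \<in> carrier G \<Longrightarrow> \<alpha> g x = x \<Longrightarrow> g = \<one>\<^bsub>G\<^esub>"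
begin

lemma X_space: "x \<in> X \<Longrightarrow> x \<in> space M"
  using sets.sets_into_space[OF X_sets] by blast

lemma act_inj:
  assumes x: "x \<in> X" and g: "g \<in> carrier G" and h: "h \<in> carrier G" and eq: "\<alpha> g x = \<alpha> h x"
  shows "g = h"
proof -
  have "\<alpha> (inv\<^bsub>G\<^esub> h \<otimes>\<^bsub>G\<^esub> g) x = x"
    using X_space[OF x] g h eq by (simp add: act_mult act_inv)
  then have "inv\<^bsub>G\<^esub> h \<otimes>\<^bsub>G\<^esub> g = \<one>\<^bsub>G\<^esub>" using X_free[OF x] g h by simp
  then show ?thesis using g h by (metis gr.inv_equality gr.inv_closed gr.inv_inv)
qed

end

section \<open>Orbit equivalences and their cocycles\<close>

locale oe_data = A: free_pmp G M \<alpha> X + B: free_pmp H N \<beta> Y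
  for G :: "('g, 'm) monoid_scheme" and M :: "'a measure" and \<alpha> X
    and H :: "('h, 'n) monoid_scheme" and N :: "'b measure" and \<beta> Y +
  fixes \<phi> :: "'a \<Rightarrow> 'b" and \<psi> :: "'b \<Rightarrow> 'a"
  assumes \<phi>_mp: "measure_preserving M N \<phi>" and \<psi>_mp: "measure_preserving N M \<psi>"
    and \<phi>_X: "x \<in> X \<Longrightarrow> \<phi> x \<in> Y" and \<psi>_Y: "y \<in> Y \<Longrightarrow> \<psi> y \<in> X"
    and \<psi>\<phi>: "x \<in> X \<Longrightarrow> \<psi> (\<phi> x) = x" and \<phi>\<psi>: "y \<in> Y \<Longrightarrow> \<phi> (\<psi> y) = y"
    and \<phi>_orbit: "x \<in> X \<Longrightarrow> g \<in> carrier G \<Longrightarrow> \<exists>h\<in>carrier H. \<phi> (\<alpha> g x) = \<beta> h (\<phi> x)"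
    and \<psi>_orbit: "y \<in> Y \<Longrightarrow> h \<in> carrier H \<Longrightarrow> \<exists>g\<in>carrier G. \<psi> (\<beta> h y) = \<alpha> g (\<psi> y)"
begin

text \<open>In terms of the Zimmer cocycle c, given by \<phi> (g x) = c(g, x) \<phi> x, this is the
  inverse of c(k^-1, x); the inverses match those in the definition of u_g. The default off X keeps
  all values in \<open>carrier H\<close>.\<close>

definition coc :: "'a \<Rightarrow> 'g \<Rightarrow> 'h" where
  "coc x k = (if x \<in> X then THE l. l \<in> carrier H \<and> \<beta> (inv\<^bsub>H\<^esub> l) (\<phi> x) = \<phi> (\<alpha> (inv\<^bsub>G\<^esub> k) x) else \<one>\<^bsub>H\<^esub>)"

definition \<Phi> :: "'a \<times> 'g \<Rightarrow> 'b \<times> 'h" where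
  "\<Phi> = (\<lambda>(x, k). (\<phi> x, coc x k))"

text \<open>Existence is the orbit condition on \<phi>, uniqueness is freeness of \<beta> at
  \<open>\<phi> x\<close>.\<close>

lemma coc_ex1:
  assumes x: "x \<in> X" and k: "k \<in> carrier G"
  shows "\<exists>!l. l \<in> carrier H \<and> \<beta> (inv\<^bsub>H\<^esub> l) (\<phi> x) = \<phi> (\<alpha> (inv\<^bsub>G\<^esub> k) x)"
proof -
  obtain h where h: "h \<in> carrier H" "\<phi> (\<alpha> (inv\<^bsub>G\<^esub> k) x) = \<beta> h (\<phi> x)"
    using \<phi>_orbit[OF x, of "inv\<^bsub>G\<^esub> k"] k by auto
  show ?thesis
  proof (rule ex1I[of _ "inv\<^bsub>H\<^esub> h"])
    fix l assume l: "l \<in> carrier H \<and> \<beta> (inv\<^bsub>H\<^esub> l) (\<phi> x) = \<phi> (\<alpha> (inv\<^bsub>G\<^esub> k) x)"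
    then have "inv\<^bsub>H\<^esub> l = h" using B.act_inj[OF \<phi>_X[OF x], of "inv\<^bsub>H\<^esub> l" h] h by simp
    then show "l = inv\<^bsub>H\<^esub> h" using l by auto
  qed (use h in simp)
qed

lemma coc:
  assumes x: "x \<in> X" and k: "k \<in> carrier G"
  shows "coc x k \<in> carrier H" "\<beta> (inv\<^bsub>H\<^esub> (coc x k)) (\<phi> x) = \<phi> (\<alpha> (inv\<^bsub>G\<^esub> k) x)"
  using theI'[OF coc_ex1[OF x k]] x by (auto simp: coc_def)

lemma coc_outside: "x \<notin> X \<Longrightarrow> coc x k = \<one>\<^bsub>H\<^esub>"
  by (simp add: coc_def)

lemma coc_eqI:
  assumes x: "x \<in> X" and k: "k \<in> carrier G" and l: "l \<in> carrier H"
    and eq: "\<beta> (inv\<^bsub>H\<^esub> l) (\<phi> x) = \<phi> (\<alpha> (inv\<^bsub>G\<^esub> k) x)"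
  shows "coc x k = l"
  using coc_ex1[OF x k] coc[OF x k] l eq by blast

text \<open>The assumptions are symmetric in the two actions, so every fact about \<phi> and its
  cocycle is available for \<psi> as well.\<close>

lemma inverse_data: "oe_data H N \<beta> Y G M \<alpha> X \<psi> \<phi>"
  using \<phi>_mp \<psi>_mp \<phi>_X \<psi>_Y \<psi>\<phi> \<phi>\<psi> \<phi>_orbit \<psi>_orbit
  by (intro oe_data.intro oe_data_axioms.intro A.free_pmp_axioms B.free_pmp_axioms) auto

text \<open>The inverse map is the cocycle of the inverse orbit equivalence at
  \<open>\<phi> x\<close>.\<close>

lemma coc_bij: assumes x: "x \<in> X" shows "bij_betw (coc x) (carrier G) (carrier H)"
proof -
  interpret inv: oe_data H N \<beta> Y G M \<alpha> X \<psi> \<phi> by (rule inverse_data)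
  have y: "\<phi> x \<in> Y" by (rule \<phi>_X[OF x])
  show ?thesis
  proof (rule bij_betw_byWitness[where f'="inv.coc (\<phi> x)"])
    show "\<forall>k\<in>carrier G. inv.coc (\<phi> x) (coc x k) = k"
    proof
      fix k assume k: "k \<in> carrier G"
      show "inv.coc (\<phi> x) (coc x k) = k"
        using x k coc[OF x k] by (intro inv.coc_eqI y) (auto simp: \<psi>\<phi> A.X_inv)
    qed
    show "\<forall>l\<in>carrier H. coc x (inv.coc (\<phi> x) l) = l"
    proof
      fix l assume l: "l \<in> carrier H"
      have "\<phi> (\<alpha> (inv\<^bsub>G\<^esub> (inv.coc (\<phi> x) l)) x) = \<phi> (\<psi> (\<beta> (inv\<^bsub>H\<^esub> l) (\<phi> x)))"
        using inv.coc(2)[OF y l] x by (simp add: \<psi>\<phi>)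
      also have "\<dots> = \<beta> (inv\<^bsub>H\<^esub> l) (\<phi> x)" using y l by (simp add: \<phi>\<psi> B.X_inv)
      finally show "coc x (inv.coc (\<phi> x) l) = l"
        using l x by (intro coc_eqI inv.coc(1)[OF y l]) simp_all
    qed
  qed (use coc(1)[OF x] inv.coc(1)[OF y] in auto)
qed

text \<open>Within X each level set is the equality set of two measurable maps into a standard Borel
  space; the default value adds the complement of X to the level set of the neutral element.\<close>

lemma coc_measurable: assumes k: "k \<in> carrier G" shows "(\<lambda>x. coc x k) \<in> M \<rightarrow>\<^sub>M count_space (carrier H)"
proof -
  note [measurable] = measure_preserving_measurable[OF \<phi>_mp] measure_preserving_measurable[OF A.act_mp]
    measure_preserving_measurable[OF B.act_mp]
  have "(\<lambda>x. coc x k) -` {l} \<inter> space M \<in> sets M" if l: "l \<in> carrier H" for l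
  proof -
    have eq: "{x \<in> space M. \<beta> (inv\<^bsub>H\<^esub> l) (\<phi> x) = \<phi> (\<alpha> (inv\<^bsub>G\<^esub> k) x)} \<in> sets M"
    proof (rule standard_borel_eq_sets[OF B.std])
      show "(\<lambda>x. \<beta> (inv\<^bsub>H\<^esub> l) (\<phi> x)) \<in> M \<rightarrow>\<^sub>M N"
        using l by (intro measurable_compose[OF measure_preserving_measurable[OF \<phi>_mp]]
            measure_preserving_measurable B.act_mp) simp
      show "(\<lambda>x. \<phi> (\<alpha> (inv\<^bsub>G\<^esub> k) x)) \<in> M \<rightarrow>\<^sub>M N"
        using k by (intro measurable_compose[OF _ measure_preserving_measurable[OF \<phi>_mp]]
            measure_preserving_measurable A.act_mp) simp
    qed
    have "(\<lambda>x. coc x k) -` {l} \<inter> space M =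
      (X \<inter> {x \<in> space M. \<beta> (inv\<^bsub>H\<^esub> l) (\<phi> x) = \<phi> (\<alpha> (inv\<^bsub>G\<^esub> k) x)}) \<union> (if l = \<one>\<^bsub>H\<^esub> then space M - X else {})"
      (is "?L = ?R")
    proof (rule Set.set_eqI)
      fix x show "x \<in> ?L \<longleftrightarrow> x \<in> ?R"
      proof (cases "x \<in> X")
        case True
        then show ?thesis using coc(2)[OF True k] coc_eqI[OF True k l] A.X_space[OF True] by auto
      next
        case False
        then show ?thesis by (auto simp: coc_outside)
      qed
    qed
    also have "\<dots> \<in> sets M" using eq by auto
    finally show ?thesis .
  qed
  moreover have "(\<lambda>x. coc x k) \<in> space M \<rightarrow> carrier H"
  proof
    fix x show "coc x k \<in> carrier H" by (cases "x \<in> X") (simp_all add: coc(1)[OF _ k] coc_outside)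
  qed
  ultimately show ?thesis
    using B.countable_G by (subst measurable_count_space_eq_countable) auto
qed

lemma \<Phi>_mp: "measure_preserving (cp_measure G M) (cp_measure H N) \<Phi>"
  unfolding cp_measure_def \<Phi>_def
proof (rule measure_preserving_fibred[OF A.countable_G B.countable_G \<phi>_mp coc_measurable])
  show "AE x in M. bij_betw (coc x) (carrier G) (carrier H)"
    using A.X_AE by eventually_elim (simp add: coc_bij)
qed

lemma AE_cp_X: "AE z in cp_measure G M. fst z \<in> X \<and> snd z \<in> carrier G"
proof -
  have "AE z in cp_measure G M. fst z \<in> X"
    unfolding cp_measure_def by (rule AE_cp_fst[OF A.countable_G A.X_AE])
  then show ?thesis using AE_space
    by eventually_elim (auto simp: cp_measure_def space_pair_measure)
qed

end

context oe_data
begin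

interpretation inv: oe_data H N \<beta> Y G M \<alpha> X \<psi> \<phi> by (rule inverse_data)

text \<open>The same construction for the inverse data, so that it preserves the measure by
  symmetry.\<close>

definition "\<Psi> = inv.\<Phi>"

lemma \<Psi>_\<Phi>:
  assumes "x \<in> X" "k \<in> carrier G" shows "\<Psi> (\<Phi> (x, k)) = (x, k)"
proof -
  have "inv.coc (\<phi> x) (coc x k) = k"
    using assms coc[OF assms] by (intro inv.coc_eqI \<phi>_X) (auto simp: \<psi>\<phi> A.X_inv)
  then show ?thesis using assms by (simp add: \<Psi>_def \<Phi>_def inv.\<Phi>_def \<psi>\<phi>)
qed

lemma cp_iso: "measure_iso (cp_measure G M) (cp_measure H N) \<Phi> \<Psi>"
proof
  show "measure_preserving (cp_measure G M) (cp_measure H N) \<Phi>" by (rule \<Phi>_mp)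
  show "measure_preserving (cp_measure H N) (cp_measure G M) \<Psi>" unfolding \<Psi>_def by (rule inv.\<Phi>_mp)
  show "AE z in cp_measure G M. \<Psi> (\<Phi> z) = z"
    using AE_cp_X by eventually_elim (auto simp: \<Psi>_\<Phi>)
  show "AE z in cp_measure H N. \<Phi> (\<Psi> z) = z"
    using inv.AE_cp_X
  proof eventually_elim
    case (elim z)
    obtain y l where z: "z = (y, l)" by (cases z)
    have "coc (\<psi> y) (inv.coc y l) = l"
      using elim inv.coc[of y l] by (intro coc_eqI \<psi>_Y) (auto simp: z \<phi>\<psi> B.X_inv)
    then show ?case using elim by (simp add: z \<Psi>_def \<Phi>_def inv.\<Phi>_def \<phi>\<psi>)
  qed
qed

text \<open>On E(h, g) the map \<Phi> turns the shift by g into the shift by h. On the base this is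
  the defining equation of E(h, g); on the second coordinate it is the cocycle identity, checked
  through the uniqueness in \<open>coc_eqI\<close>.\<close>

lemma shift_conj:
  assumes h: "h \<in> carrier H" and g: "g \<in> carrier G" and x: "x \<in> X" and k: "k \<in> carrier G"
    and eq: "\<phi> (\<alpha> (inv\<^bsub>G\<^esub> g) x) = \<beta> (inv\<^bsub>H\<^esub> h) (\<phi> x)"
  shows "\<Psi> (B.shift h (\<Phi> (x, k))) = A.shift g (x, k)"
proof -
  have gx: "\<alpha> (inv\<^bsub>G\<^esub> g) x \<in> X" using x g by (simp add: A.X_inv)
  have k': "inv\<^bsub>G\<^esub> g \<otimes>\<^bsub>G\<^esub> k \<in> carrier G" using g k by simp
  have "coc (\<alpha> (inv\<^bsub>G\<^esub> g) x) (inv\<^bsub>G\<^esub> g \<otimes>\<^bsub>G\<^esub> k) = inv\<^bsub>H\<^esub> h \<otimes>\<^bsub>H\<^esub> coc x k"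
  proof (rule coc_eqI[OF gx k'])
    have 1: "\<phi> x \<in> space N" by (rule B.X_space[OF \<phi>_X[OF x]])
    have l: "coc x k \<in> carrier H" by (rule coc(1)[OF x k])
    have "\<beta> (inv\<^bsub>H\<^esub> (inv\<^bsub>H\<^esub> h \<otimes>\<^bsub>H\<^esub> coc x k)) (\<phi> (\<alpha> (inv\<^bsub>G\<^esub> g) x))
        = \<beta> (inv\<^bsub>H\<^esub> (coc x k)) (\<beta> h (\<beta> (inv\<^bsub>H\<^esub> h) (\<phi> x)))"
      using h l 1 by (simp add: eq B.gr.inv_mult_group B.act_mult B.act_closed)
    also have "\<dots> = \<phi> (\<alpha> (inv\<^bsub>G\<^esub> k) x)" using h 1 coc(2)[OF x k] by (simp add: B.act_inv)
    also have "\<dots> = \<phi> (\<alpha> (inv\<^bsub>G\<^esub> k) (\<alpha> g (\<alpha> (inv\<^bsub>G\<^esub> g) x)))"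
      using g A.X_space[OF x] by (simp add: A.act_inv)
    also have "\<dots> = \<phi> (\<alpha> (inv\<^bsub>G\<^esub> (inv\<^bsub>G\<^esub> g \<otimes>\<^bsub>G\<^esub> k)) (\<alpha> (inv\<^bsub>G\<^esub> g) x))"
      using g k A.X_space[OF x] by (simp add: A.gr.inv_mult_group A.act_mult A.act_closed)
    finally show "\<beta> (inv\<^bsub>H\<^esub> (inv\<^bsub>H\<^esub> h \<otimes>\<^bsub>H\<^esub> coc x k)) (\<phi> (\<alpha> (inv\<^bsub>G\<^esub> g) x)) =
      \<phi> (\<alpha> (inv\<^bsub>G\<^esub> (inv\<^bsub>G\<^esub> g \<otimes>\<^bsub>G\<^esub> k)) (\<alpha> (inv\<^bsub>G\<^esub> g) x))" .
  qed (use h coc(1)[OF x k] in simp)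
  then have "B.shift h (\<Phi> (x, k)) = \<Phi> (\<alpha> (inv\<^bsub>G\<^esub> g) x, inv\<^bsub>G\<^esub> g \<otimes>\<^bsub>G\<^esub> k)"
    by (simp add: \<Phi>_def B.shift_def eq)
  then show ?thesis using \<Psi>_\<Phi>[OF gx k'] by (simp add: A.shift_def)
qed

end

section \<open>Orbit equivalence on invariant sets\<close>

lemma (in pmp) AE_invariant:
  assumes "AE x in M. R x" shows "AE x in M. \<forall>g\<in>carrier G. R (\<alpha> g x)"
  using measure_preserving_AE[OF act_mp assms] by (simp add: AE_ball_countable[OF countable_G])

lemma (in pmp) sets_Collect_action:
  assumes E: "E \<in> sets M" shows "{x \<in> space M. \<forall>g\<in>carrier G. \<alpha> g x \<in> E} \<in> sets M"
proof -
  have "{x \<in> space M. \<forall>g\<in>carrier G. \<alpha> g x \<in> E} = space M - (\<Union>g\<in>carrier G. {x \<in> space M. \<alpha> g x \<notin> E})"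
    by auto
  also have "\<dots> \<in> sets M"
  proof (intro sets.Diff sets.top sets.countable_UN'' countable_G)
    fix g assume "g \<in> carrier G"
    note [measurable] = measure_preserving_measurable[OF act_mp[OF this]] E
    show "{x \<in> space M. \<alpha> g x \<notin> E} \<in> sets M" by measurable
  qed
  finally show ?thesis .
qed

text \<open>Constant values off the conull sets make both maps total without changing any image
  measure. That \<open>\<psi>'\<close> preserves the measure follows from \<open>\<phi>'\<close>
  doing so, since \<open>\<psi>' \<circ> \<phi>'\<close> is the identity almost everywhere.\<close>

lemma measure_space_iso_extend:
  assumes iso: "measure_space_iso M N X Y \<phi>" and x0: "x0 \<in> space M" and y0: "y0 \<in> space N"
  defines "\<phi>' \<equiv> (\<lambda>x. if x \<in> X then \<phi> x else y0)"
    and "\<psi>' \<equiv> (\<lambda>y. if y \<in> Y then inv_into X \<phi> y else x0)"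
  shows "measure_preserving M N \<phi>'" "measure_preserving N M \<psi>'" "AE x in M. x \<in> X" "AE y in N. y \<in> Y"
proof -
  have X[measurable]: "X \<in> sets M" and Xn: "space M - X \<in> null_sets M"
    and Y[measurable]: "Y \<in> sets N" and Yn: "space N - Y \<in> null_sets N"
    and bij: "bij_betw \<phi> X Y"
    and \<phi>[measurable]: "\<phi> \<in> restrict_space M X \<rightarrow>\<^sub>M restrict_space N Y"
    and \<psi>[measurable]: "inv_into X \<phi> \<in> restrict_space N Y \<rightarrow>\<^sub>M restrict_space M X"
    and distr: "distr (restrict_space M X) (restrict_space N Y) \<phi> = restrict_space N Y"
    using iso by (auto simp: measure_space_iso_def)
  have XM: "X \<subseteq> space M" by (rule sets.sets_into_space[OF X])
  have YN: "Y \<subseteq> space N" by (rule sets.sets_into_space[OF Y])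
  show AEX: "AE x in M. x \<in> X" by (rule AE_I'[OF Xn]) auto
  show AEY: "AE y in N. y \<in> Y" by (rule AE_I'[OF Yn]) auto
  have \<phi>'[measurable]: "\<phi>' \<in> M \<rightarrow>\<^sub>M N"
    unfolding \<phi>'_def
  proof (subst measurable_If_restrict_space_iff)
    show "{x \<in> space M. x \<in> X} \<in> sets M" using XM by (simp add: Int_absorb1 Collect_conj_eq)
    show "\<phi> \<in> restrict_space M {x. x \<in> X} \<rightarrow>\<^sub>M N \<and> (\<lambda>x. y0) \<in> restrict_space M {x. x \<notin> X} \<rightarrow>\<^sub>M N"
      using \<phi> y0 by (simp add: measurable_restrict_space2_iff)
  qed
  have \<psi>'[measurable]: "\<psi>' \<in> N \<rightarrow>\<^sub>M M"
    unfolding \<psi>'_def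
  proof (subst measurable_If_restrict_space_iff)
    show "{x \<in> space N. x \<in> Y} \<in> sets N" using YN by (simp add: Int_absorb1 Collect_conj_eq)
    show "inv_into X \<phi> \<in> restrict_space N {x. x \<in> Y} \<rightarrow>\<^sub>M M \<and> (\<lambda>x. x0) \<in> restrict_space N {x. x \<notin> Y} \<rightarrow>\<^sub>M M"
      using \<psi> x0 by (simp add: measurable_restrict_space2_iff)
  qed
  have d\<phi>: "distr M N \<phi>' = N"
  proof (rule measure_eqI)
    fix A assume "A \<in> sets (distr M N \<phi>')"
    then have A[measurable]: "A \<in> sets N" by simp
    have AY: "A \<inter> Y \<in> sets (restrict_space N Y)"
      by (rule sets_restrict_space_iff[THEN iffD2]) (use YN in auto)
    have pre: "\<phi> -` (A \<inter> Y) \<inter> X = \<phi>' -` A \<inter> X"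
      using bij by (auto simp: \<phi>'_def bij_betw_def)
    have "emeasure (distr M N \<phi>') A = emeasure M (\<phi>' -` A \<inter> space M)"
      by (rule emeasure_distr) measurable
    also have "\<dots> = emeasure M (\<phi>' -` A \<inter> X)"
    proof (rule emeasure_eq_AE)
      show "AE x in M. (x \<in> \<phi>' -` A \<inter> space M) = (x \<in> \<phi>' -` A \<inter> X)"
        using AEX by eventually_elim (use XM in auto)
      have "\<phi>' -` A \<inter> X = (\<phi>' -` A \<inter> space M) \<inter> X" using XM by auto
      also have "\<dots> \<in> sets M" by measurable
      finally show "\<phi>' -` A \<inter> X \<in> sets M" .
    qed measurable
    also have "\<dots> = emeasure (restrict_space M X) (\<phi> -` (A \<inter> Y) \<inter> X)"
      unfolding pre by (rule emeasure_restrict_space[symmetric]) (use XM in auto)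
    also have "\<dots> = emeasure (restrict_space N Y) (A \<inter> Y)"
      using emeasure_distr[OF \<phi> AY] XM by (simp add: distr space_restrict_space Int_absorb2)
    also have "\<dots> = emeasure N (A \<inter> Y)"
      by (rule emeasure_restrict_space) (use YN in auto)
    also have "\<dots> = emeasure N A"
      by (rule emeasure_eq_AE) (use AEY in auto)
    finally show "emeasure (distr M N \<phi>') A = emeasure N A" .
  qed simp
  then show "measure_preserving M N \<phi>'" by (simp add: measure_preserving_def)
  have "distr N M \<psi>' = distr (distr M N \<phi>') M \<psi>'" by (simp add: d\<phi>)
  also have "\<dots> = distr M M (\<psi>' \<circ> \<phi>')" by (rule distr_distr) measurable
  also have "\<dots> = distr M M (\<lambda>x. x)"
  proof (rule distr_cong_AE)
    show "AE x in M. (\<psi>' \<circ> \<phi>') x = x"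
      using AEX by eventually_elim (use bij in \<open>auto simp: \<psi>'_def \<phi>'_def bij_betw_def\<close>)
  qed auto
  also have "\<dots> = M" by (rule distr_id)
  finally show "measure_preserving N M \<psi>'" by (simp add: measure_preserving_def)
qed

text \<open>Cutting down to good invariant sets on both sides seems to require going back and forth
  between M and N forever. One pass is enough: points are kept only if their whole orbit is good, in
  N and then in M, and the final set Y is transported from X, so that it inherits its invariance
  through the orbit equivalence.\<close>

lemma oe_data_exists:
  fixes G :: "('g, 'm) monoid_scheme" and M :: "'a measure" and H :: "('h, 'n) monoid_scheme" and N :: "'b measure"
  assumes G: "pmp_action G M \<alpha>" "free_action G M \<alpha>" and H: "pmp_action H N \<beta>" "free_action H N \<beta>"
    and oe: "orbit_equivalent G M \<alpha> H N \<beta>"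
  shows "\<exists>X Y \<phi> \<psi>. oe_data G M \<alpha> X H N \<beta> Y \<phi> \<psi>"
proof -
  interpret A: pmp G M \<alpha> by standard (rule G)
  interpret B: pmp H N \<beta> by standard (rule H)
  obtain X0 Y0 \<phi>0 where iso: "measure_space_iso M N X0 Y0 \<phi>0"
    and orb: "AE x in M. x \<in> X0 \<longrightarrow> \<phi>0 ` (Group_Action.orbit G \<alpha> x \<inter> X0) = Group_Action.orbit H \<beta> (\<phi>0 x) \<inter> Y0"
    using oe unfolding orbit_equivalent_def by blast
  obtain x0 y0 where xy0: "x0 \<in> space M" "y0 \<in> space N"
    using prob_space.not_empty[OF A.prob] prob_space.not_empty[OF B.prob] by blast
  have bij: "bij_betw \<phi>0 X0 Y0" using iso by (simp add: measure_space_iso_def)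
  define \<phi> where "\<phi> = (\<lambda>x. if x \<in> X0 then \<phi>0 x else y0)"
  define \<psi> where "\<psi> = (\<lambda>y. if y \<in> Y0 then inv_into X0 \<phi>0 y else x0)"
  note ext = measure_space_iso_extend[OF iso xy0, folded \<phi>_def \<psi>_def]
  note [measurable] = measure_preserving_measurable[OF ext(1)] measure_preserving_measurable[OF ext(2)]
  have \<psi>\<phi>: "\<psi> (\<phi> x) = x" "\<phi> x \<in> Y0" if "x \<in> X0" for x
    using that bij by (auto simp: \<phi>_def \<psi>_def bij_betw_def)
  have \<phi>\<psi>: "\<phi> (\<psi> y) = y" "\<psi> y \<in> X0" if "y \<in> Y0" for y
    using that bij by (auto simp: \<phi>_def \<psi>_def bij_betw_def f_inv_into_f inv_into_into)
  have "AE x in M. x \<in> X0 \<and> (\<forall>g\<in>carrier G. g \<noteq> \<one>\<^bsub>G\<^esub> \<longrightarrow> \<alpha> g x \<noteq> x) \<and>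
      \<phi>0 ` (Group_Action.orbit G \<alpha> x \<inter> X0) = Group_Action.orbit H \<beta> (\<phi>0 x) \<inter> Y0"
    using orb ext(3) G(2)[unfolded free_action_def] by eventually_elim blast
  then obtain E1 where E1[measurable]: "E1 \<in> sets M" and E1_AE: "AE x in M. x \<in> E1"
    and E1X: "\<And>x. x \<in> E1 \<Longrightarrow> x \<in> X0"
    and E1_free: "\<And>x g. x \<in> E1 \<Longrightarrow> g \<in> carrier G \<Longrightarrow> \<alpha> g x = x \<Longrightarrow> g = \<one>\<^bsub>G\<^esub>"
    and E1_orb: "\<And>x. x \<in> E1 \<Longrightarrow> \<phi>0 ` (Group_Action.orbit G \<alpha> x \<inter> X0) = Group_Action.orbit H \<beta> (\<phi>0 x) \<inter> Y0"
    by (rule AE_obtain_measurable) blast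
  have "AE y in N. y \<in> Y0 \<and> (\<forall>h\<in>carrier H. h \<noteq> \<one>\<^bsub>H\<^esub> \<longrightarrow> \<beta> h y \<noteq> y)"
    using ext(4) H(2)[unfolded free_action_def] by eventually_elim blast
  then obtain E2 where E2[measurable]: "E2 \<in> sets N" and E2_AE: "AE y in N. y \<in> E2"
    and E2Y: "\<And>y. y \<in> E2 \<Longrightarrow> y \<in> Y0"
    and E2_free: "\<And>y h. y \<in> E2 \<Longrightarrow> h \<in> carrier H \<Longrightarrow> \<beta> h y = y \<Longrightarrow> h = \<one>\<^bsub>H\<^esub>"
    by (rule AE_obtain_measurable) blast
  \<comment> \<open>All H-translates of a point of Y2 lie in E2 and hence in Y0. This is what lets
    the orbit equation, which only speaks of points of Y0, be applied to every translate of
    \<open>\<phi> x\<close> in \<open>orb2\<close>.\<close>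
  define Y2 where "Y2 = {y \<in> space N. \<forall>h\<in>carrier H. \<beta> h y \<in> E2}"
  have Y2[measurable]: "Y2 \<in> sets N" unfolding Y2_def by (rule B.sets_Collect_action[OF E2])
  have Y2_AE: "AE y in N. y \<in> Y2"
    using B.AE_invariant[OF E2_AE] AE_space by eventually_elim (simp add: Y2_def)
  define E3 where "E3 = {x \<in> space M. x \<in> E1 \<and> \<phi> x \<in> Y2}"
  have E3[measurable]: "E3 \<in> sets M" unfolding E3_def by measurable
  have E3_AE: "AE x in M. x \<in> E3"
    using E1_AE measure_preserving_AE[OF ext(1) Y2_AE] AE_space by eventually_elim (simp add: E3_def)
  define X where "X = {x \<in> space M. \<forall>g\<in>carrier G. \<alpha> g x \<in> E3}"
  have X[measurable]: "X \<in> sets M" unfolding X_def by (rule A.sets_Collect_action[OF E3])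
  have X_AE: "AE x in M. x \<in> X"
    using A.AE_invariant[OF E3_AE] AE_space by eventually_elim (simp add: X_def)
  have X_space: "x \<in> space M" if "x \<in> X" for x using that by (simp add: X_def)
  have X_inv: "\<alpha> g x \<in> X" if x: "x \<in> X" and g: "g \<in> carrier G" for x g
  proof -
    have "\<alpha> g' (\<alpha> g x) \<in> E3" if "g' \<in> carrier G" for g'
    proof -
      have "\<alpha> (g' \<otimes>\<^bsub>G\<^esub> g) x \<in> E3" using x g that by (simp add: X_def)
      then show ?thesis using A.act_mult[OF X_space[OF x] that g] by simp
    qed
    then show ?thesis using A.act_closed[OF X_space[OF x] g] by (simp add: X_def)
  qed
  have XE3: "x \<in> E3" if "x \<in> X" for x
  proof -
    have "\<alpha> \<one>\<^bsub>G\<^esub> x \<in> E3" using that by (simp add: X_def)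
    then show ?thesis using A.act_one[OF X_space[OF that]] by simp
  qed
  have XE1: "x \<in> E1" and XX0: "x \<in> X0" and XY2: "\<phi> x \<in> Y2" if "x \<in> X" for x
    using XE3[OF that] E1X by (auto simp: E3_def)
  \<comment> \<open>This is the image of X under \<phi>, written as a preimage under \<psi> so that
    it is visibly measurable and conull.\<close>
  define Y where "Y = {y \<in> space N. y \<in> E2 \<and> \<psi> y \<in> X}"
  have Y[measurable]: "Y \<in> sets N" unfolding Y_def by measurable
  have Y_AE: "AE y in N. y \<in> Y"
    using E2_AE measure_preserving_AE[OF ext(2) X_AE] AE_space by eventually_elim (simp add: Y_def)
  have Y2D: "y \<in> space N" "y \<in> E2" if "y \<in> Y2" for y
  proof -
    show y: "y \<in> space N" using that by (simp add: Y2_def)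
    have "\<beta> \<one>\<^bsub>H\<^esub> y \<in> E2" using that by (simp add: Y2_def)
    then show "y \<in> E2" using B.act_one[OF y] by simp
  qed
  have XY: "\<phi> x \<in> Y" if "x \<in> X" for x
    using that Y2D[OF XY2[OF that]] \<psi>\<phi>(1)[OF XX0[OF that]] by (simp add: Y_def)
  have YX: "\<psi> y \<in> X" "\<phi> (\<psi> y) = y" if "y \<in> Y" for y
    using that \<phi>\<psi>(1)[OF E2Y] by (auto simp: Y_def)
  have orb1: "\<exists>h\<in>carrier H. \<phi> (\<alpha> g x) = \<beta> h (\<phi> x)" if x: "x \<in> X" and g: "g \<in> carrier G" for x g
  proof -
    have gx: "\<alpha> g x \<in> X0" by (rule XX0[OF X_inv[OF x g]])
    then have "\<phi>0 (\<alpha> g x) \<in> \<phi>0 ` (Group_Action.orbit G \<alpha> x \<inter> X0)"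
      using g by (auto simp: Group_Action.orbit_def)
    then have "\<phi>0 (\<alpha> g x) \<in> Group_Action.orbit H \<beta> (\<phi>0 x)" using E1_orb[OF XE1[OF x]] by simp
    then show ?thesis using gx XX0[OF x] by (auto simp: Group_Action.orbit_def \<phi>_def)
  qed
  have orb2: "\<exists>g\<in>carrier G. \<beta> h (\<phi> x) = \<phi> (\<alpha> g x)" if x: "x \<in> X" and h: "h \<in> carrier H" for x h
  proof -
    have "\<beta> h (\<phi> x) \<in> Y0" using XY2[OF x] h E2Y by (simp add: Y2_def)
    moreover have "\<phi> x = \<phi>0 x" using XX0[OF x] by (simp add: \<phi>_def)
    ultimately have "\<beta> h (\<phi> x) \<in> Group_Action.orbit H \<beta> (\<phi>0 x) \<inter> Y0"
      using h by (auto simp: Group_Action.orbit_def)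
    then have "\<beta> h (\<phi> x) \<in> \<phi>0 ` (Group_Action.orbit G \<alpha> x \<inter> X0)" using E1_orb[OF XE1[OF x]] by simp
    then show ?thesis by (auto simp: Group_Action.orbit_def \<phi>_def)
  qed
  have Y_inv: "\<beta> h y \<in> Y" and orb3: "\<exists>g\<in>carrier G. \<psi> (\<beta> h y) = \<alpha> g (\<psi> y)"
    if y: "y \<in> Y" and h: "h \<in> carrier H" for y h
  proof -
    obtain g where g: "g \<in> carrier G" "\<beta> h (\<phi> (\<psi> y)) = \<phi> (\<alpha> g (\<psi> y))"
      using orb2[OF YX(1)[OF y] h] by blast
    have eq: "\<beta> h y = \<phi> (\<alpha> g (\<psi> y))" using trans[OF arg_cong[OF YX(2)[OF y, symmetric], of "\<beta> h"] g(2)] .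
    have gx: "\<alpha> g (\<psi> y) \<in> X" by (rule X_inv[OF YX(1)[OF y] g(1)])
    show "\<beta> h y \<in> Y" unfolding eq by (rule XY[OF gx])
    show "\<exists>g\<in>carrier G. \<psi> (\<beta> h y) = \<alpha> g (\<psi> y)"
      unfolding eq \<psi>\<phi>(1)[OF XX0[OF gx]] using g by blast
  qed
  have A: "free_pmp G M \<alpha> X"
    by (intro free_pmp.intro free_pmp_axioms.intro A.pmp_axioms X X_AE X_inv)
      (assumption | rule E1_free[OF XE1])+
  have YE2: "y \<in> E2" if "y \<in> Y" for y using that by (simp add: Y_def)
  have B: "free_pmp H N \<beta> Y"
    by (intro free_pmp.intro free_pmp_axioms.intro B.pmp_axioms Y Y_AE Y_inv)
      (assumption | rule E2_free[OF YE2])+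
  have "oe_data G M \<alpha> X H N \<beta> Y \<phi> \<psi>"
    by (intro oe_data.intro oe_data_axioms.intro A B ext(1,2) XY YX \<psi>\<phi>(1)[OF XX0] orb1 orb3)
      assumption+
  then show ?thesis by blast
qed

section \<open>Crossed products\<close>

definition Linf_fun :: "'a measure \<Rightarrow> ('a \<Rightarrow> complex) set" where
  "Linf_fun M = {f \<in> borel_measurable M. \<exists>c. AE x in M. cmod (f x) \<le> c}"

lemma Linf_indicator: "E \<in> sets M \<Longrightarrow> indicator E \<in> Linf_fun M"
  unfolding Linf_fun_def by (auto intro!: exI[of _ 1] simp: indicator_def)

lemma mult_op_eqD:
  assumes \<xi>: "\<xi> \<in> carrier (L2_space P)" and \<eta>: "\<eta> \<in> carrier (L2_space P)"
    and b[measurable]: "b \<in> borel_measurable P"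
    and eq: "mult_op P b \<xi> = mult_op P b \<eta>"
  shows "AE z in P. b z * rep \<xi> z = b z * rep \<eta> z"
proof -
  note [measurable] = L2_fun_measurable[OF rep_in_L2_fun[OF \<xi>]]
  have "ae_class P (\<lambda>z. b z * rep \<xi> z) = ae_class P (\<lambda>z. b z * rep \<eta> z)"
    using eq \<xi> \<eta> by (simp add: mult_op_def)
  then show ?thesis by (intro ae_class_eqD) measurable
qed

text \<open>The factor b cuts down to points where the two maps agree. In this way an identity of
  point maps on E(h, g) becomes an identity of operators.\<close>

lemma mult_op_koopman_cong:
  assumes \<Gamma>: "measure_preserving P P \<Gamma>" and \<Delta>: "measure_preserving P P \<Delta>"
    and eq: "AE z in P. b z \<noteq> 0 \<longrightarrow> \<Gamma> z = \<Delta> z"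
  shows "compose (carrier (L2_space P)) (mult_op P b) (koopman P P \<Gamma>) =
         compose (carrier (L2_space P)) (mult_op P b) (koopman P P \<Delta>)"
proof (rule L2_op_eqI)
  fix f assume f: "f \<in> L2_fun P"
  have "AE z in P. b z * f (\<Gamma> z) = b z * f (\<Delta> z)" using eq by eventually_elim auto
  then show "compose (carrier (L2_space P)) (mult_op P b) (koopman P P \<Gamma>) (ae_class P f) =
         compose (carrier (L2_space P)) (mult_op P b) (koopman P P \<Delta>) (ae_class P f)"
    using f \<Gamma> \<Delta> by (simp add: compose_def ae_class_in_L2 koopman_ae_class mult_op_ae_class L2_fun_comp ae_class_eqI)
qed (auto simp: compose_def)

lemma mult_op_koopman_conj:
  assumes \<Phi>: "measure_preserving P Q \<Phi>" and \<Psi>: "measure_preserving Q P \<Psi>"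
    and \<Psi>\<Phi>: "AE x in P. \<Psi> (\<Phi> x) = x"
    and b: "b \<in> borel_measurable Q" "AE y in Q. cmod (b y) \<le> c"
  shows "koopman_conj P Q \<Phi> \<Psi> (mult_op Q b) = mult_op P (\<lambda>x. b (\<Phi> x))"
proof (rule L2_op_eqI)
  fix f assume f: "f \<in> L2_fun P"
  have "AE x in P. b (\<Phi> x) * f (\<Psi> (\<Phi> x)) = b (\<Phi> x) * f x" using \<Psi>\<Phi> by eventually_elim simp
  then show "koopman_conj P Q \<Phi> \<Psi> (mult_op Q b) (ae_class P f) = mult_op P (\<lambda>x. b (\<Phi> x)) (ae_class P f)"
    using f \<Phi> \<Psi> L2_fun_mult(1)[OF b L2_fun_comp[OF \<Psi> f]]
    by (simp add: koopman_conj_def ae_class_in_L2 koopman_ae_class mult_op_ae_class L2_fun_comp ae_class_eqI)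
qed (auto simp: koopman_conj_def mult_op_extensional)

lemma koopman_koopman_conj:
  assumes \<Phi>: "measure_preserving P Q \<Phi>" and \<Psi>: "measure_preserving Q P \<Psi>" and \<Delta>: "measure_preserving Q Q \<Delta>"
  shows "koopman_conj P Q \<Phi> \<Psi> (koopman Q Q \<Delta>) = koopman P P (\<lambda>x. \<Psi> (\<Delta> (\<Phi> x)))"
proof (rule L2_op_eqI)
  fix f assume f: "f \<in> L2_fun P"
  show "koopman_conj P Q \<Phi> \<Psi> (koopman Q Q \<Delta>) (ae_class P f) = koopman P P (\<lambda>x. \<Psi> (\<Delta> (\<Phi> x))) (ae_class P f)"
    using f \<Phi> \<Psi> \<Delta> measure_preserving_comp[OF measure_preserving_comp[OF \<Phi> \<Delta>] \<Psi>]
      koopman_ae_class[OF \<Phi> L2_fun_comp[OF \<Delta> L2_fun_comp[OF \<Psi> f]]]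
    by (simp add: koopman_conj_def ae_class_in_L2 koopman_ae_class L2_fun_comp)
qed (auto simp: koopman_conj_def koopman_extensional)

section \<open>The crossed product of one action\<close>

context pmp
begin

abbreviation "P \<equiv> cp_measure G M"
abbreviation "CP \<equiv> crossed_product G M \<alpha>"
abbreviation "gens \<equiv> cp_Linf G M \<union> cp_unitary G M \<alpha> ` carrier G"

lemma cp_fun_mult_op: "cp_fun G M f = mult_op P (\<lambda>z. f (fst z))"
  by (simp add: cp_fun_def mult_op_def case_prod_beta')

lemma cp_Linf_eq: "cp_Linf G M = cp_fun G M ` Linf_fun M"
  by (auto simp: cp_Linf_def Linf_fun_def)

lemma Linf_fst:
  assumes "f \<in> Linf_fun M"
  obtains c where "(\<lambda>z. f (fst z)) \<in> borel_measurable P" "AE z in P. cmod (f (fst z)) \<le> c"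
proof -
  obtain c where c: "AE x in M. cmod (f x) \<le> c" and [measurable]: "f \<in> borel_measurable M"
    using assms by (auto simp: Linf_fun_def)
  have "AE z in P. cmod (f (fst z)) \<le> c" unfolding cp_measure_def by (rule AE_cp_fst[OF countable_G c])
  moreover have "(\<lambda>z. f (fst z)) \<in> borel_measurable P" unfolding cp_measure_def by measurable
  ultimately show ?thesis by (rule that[rotated])
qed

lemma cp_fun_bounded: "f \<in> Linf_fun M \<Longrightarrow> cp_fun G M f \<in> bounded_ops (L2_space P)"
  unfolding cp_fun_mult_op by (auto elim!: Linf_fst intro: mult_op_bounded)

lemma cp_unitary_bounded: "g \<in> carrier G \<Longrightarrow> cp_unitary G M \<alpha> g \<in> bounded_ops (L2_space P)"
  by (simp add: cp_unitary_koopman koopman_bounded shift_mp)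

lemma gens_bounded: "gens \<subseteq> bounded_ops (L2_space P)"
  by (auto simp: cp_Linf_eq cp_fun_bounded cp_unitary_bounded)

lemma carrier_CP: "carrier CP = commutant (L2_space P) (commutant (L2_space P) gens)"
  by (simp add: crossed_product_def operator_alg_def)

lemma CP_bounded: "carrier CP \<subseteq> bounded_ops (L2_space P)"
  by (auto simp: carrier_CP commutant_def)

lemma CP_mult_closed:
  assumes "S \<in> carrier CP" "T \<in> carrier CP" shows "S \<otimes>\<^bsub>CP\<^esub> T \<in> carrier CP"
proof -
  have "compose (carrier (L2_space P)) S T \<in> carrier CP"
    using assms unfolding carrier_CP
    by (intro commutant_L2_compose_closed) (auto simp: commutant_def)
  then show ?thesis by (simp add: crossed_product_def operator_alg_def)
qed

lemma cp_fun_in: "f \<in> Linf_fun M \<Longrightarrow> cp_fun G M f \<in> carrier CP"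
  using bicommutant_contains[OF gens_bounded] by (auto simp: carrier_CP cp_Linf_eq)

lemma cp_unitary_in: "g \<in> carrier G \<Longrightarrow> cp_unitary G M \<alpha> g \<in> carrier CP"
  using bicommutant_contains[OF gens_bounded] by (auto simp: carrier_CP)

lemma cp_fun_mult:
  assumes "g \<in> Linf_fun M"
  shows "cp_fun G M f \<otimes>\<^bsub>CP\<^esub> cp_fun G M g = cp_fun G M (\<lambda>x. f x * g x)"
  using assms by (auto simp: crossed_product_def operator_alg_def cp_fun_mult_op mult_op_comp elim!: Linf_fst)

lemma cp_fun_add:
  assumes f: "f \<in> Linf_fun M" and g: "g \<in> Linf_fun M"
  shows "cp_fun G M f \<oplus>\<^bsub>CP\<^esub> cp_fun G M g = cp_fun G M (\<lambda>x. f x + g x)"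
proof -
  obtain c where c: "(\<lambda>z. f (fst z)) \<in> borel_measurable P" "AE z in P. cmod (f (fst z)) \<le> c"
    by (rule Linf_fst[OF f])
  obtain d where d: "(\<lambda>z. g (fst z)) \<in> borel_measurable P" "AE z in P. cmod (g (fst z)) \<le> d"
    by (rule Linf_fst[OF g])
  have "(\<lambda>\<xi>\<in>carrier (L2_space P). mult_op P (\<lambda>z. f (fst z)) \<xi> \<oplus>\<^bsub>L2_space P\<^esub> mult_op P (\<lambda>z. g (fst z)) \<xi>)
      = mult_op P (\<lambda>z. f (fst z) + g (fst z))"
  proof (rule L2_op_eqI)
    fix h assume h: "h \<in> L2_fun P"
    show "(\<lambda>\<xi>\<in>carrier (L2_space P). mult_op P (\<lambda>z. f (fst z)) \<xi> \<oplus>\<^bsub>L2_space P\<^esub> mult_op P (\<lambda>z. g (fst z)) \<xi>) (ae_class P h)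
      = mult_op P (\<lambda>z. f (fst z) + g (fst z)) (ae_class P h)"
      using h L2_fun_mult(1)[OF c h] L2_fun_mult(1)[OF d h]
      by (simp add: ae_class_in_L2 mult_op_ae_class L2_space_add distrib_right)
  qed (auto simp: mult_op_extensional)
  then show ?thesis by (simp add: crossed_product_def operator_alg_def cp_fun_mult_op)
qed

lemma cp_fun_one: "cp_fun G M (\<lambda>_. 1) = \<one>\<^bsub>CP\<^esub>"
proof -
  have "mult_op P (\<lambda>_. 1) = (\<lambda>\<xi>\<in>carrier (L2_space P). \<xi>)"
    by (rule L2_op_eqI) (auto simp: mult_op_extensional mult_op_ae_class ae_class_in_L2)
  then show ?thesis by (simp add: crossed_product_def operator_alg_def cp_fun_mult_op)
qed

lemma cp_fun_cong: "AE x in M. f x = g x \<Longrightarrow> cp_fun G M f = cp_fun G M g"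
  unfolding cp_fun_mult_op
  by (rule mult_op_cong) (rule AE_cp_fst[OF countable_G, folded cp_measure_def])

lemma star_cp_fun:
  assumes "f \<in> Linf_fun M" shows "star CP (cp_fun G M f) = cp_fun G M (\<lambda>x. cnj (f x))"
  using assms by (auto simp: crossed_product_def operator_alg_def cp_fun_mult_op op_adjoint_mult_op elim!: Linf_fst)

lemma shift_shift:
  assumes g: "g \<in> carrier G" and z: "z \<in> space P"
  shows "shift g (shift (inv\<^bsub>G\<^esub> g) z) = z" "shift (inv\<^bsub>G\<^esub> g) (shift g z) = z"
  using z g by (auto simp: shift_def cp_measure_def space_pair_measure act_inv gr.m_assoc[symmetric])

lemma star_cp_unitary:
  assumes g: "g \<in> carrier G" shows "star CP (cp_unitary G M \<alpha> g) = cp_unitary G M \<alpha> (inv\<^bsub>G\<^esub> g)"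
proof -
  have "AE z in P. shift g (shift (inv\<^bsub>G\<^esub> g) z) = z" by (rule AE_I2) (rule shift_shift[OF g])
  then show ?thesis
    using g by (simp add: crossed_product_def operator_alg_def cp_unitary_koopman op_adjoint_koopman shift_mp)
qed

lemma cp_unitary_inv_left:
  assumes g: "g \<in> carrier G" shows "cp_unitary G M \<alpha> (inv\<^bsub>G\<^esub> g) \<otimes>\<^bsub>CP\<^esub> cp_unitary G M \<alpha> g = \<one>\<^bsub>CP\<^esub>"
proof -
  have 1: "measure_preserving P P (shift g)" "measure_preserving P P (shift (inv\<^bsub>G\<^esub> g))"
    using g by (simp_all add: shift_mp)
  have "koopman P P (\<lambda>z. shift g (shift (inv\<^bsub>G\<^esub> g) z)) = (\<lambda>\<xi>\<in>carrier (L2_space P). \<xi>)"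
    by (intro koopman_AE_id measure_preserving_comp[OF 1(2,1)] AE_I2 shift_shift g)
  then show ?thesis
    by (simp add: crossed_product_def operator_alg_def cp_unitary_koopman koopman_comp[OF 1(2,1)])
qed

lemma cp_unitary_inv_right:
  assumes "g \<in> carrier G" shows "cp_unitary G M \<alpha> g \<otimes>\<^bsub>CP\<^esub> cp_unitary G M \<alpha> (inv\<^bsub>G\<^esub> g) = \<one>\<^bsub>CP\<^esub>"
  using cp_unitary_inv_left[of "inv\<^bsub>G\<^esub> g"] assms by simp

lemma emeasure_cp_slice:
  assumes E: "E \<in> sets M" and g: "g \<in> carrier G" shows "emeasure P (E \<times> {g}) = emeasure M E"
proof -
  interpret sigma_finite_measure "count_space (carrier G)"
    by (rule sigma_finite_measure_count_space_countable[OF countable_G])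
  have "emeasure P (E \<times> {g}) = emeasure M E * emeasure (count_space (carrier G)) {g}"
    unfolding cp_measure_def by (rule emeasure_pair_measure_Times) (use E g in auto)
  then show ?thesis using g by simp
qed

definition vec :: "'a \<times> 'g \<Rightarrow> complex" where "vec = (\<lambda>(x, k). if k = \<one>\<^bsub>G\<^esub> then 1 else 0)"

lemma vec_indicator: "z \<in> space P \<Longrightarrow> vec z = indicator (space M \<times> {\<one>\<^bsub>G\<^esub>}) z"
  by (auto simp: vec_def cp_measure_def space_pair_measure indicator_def split: if_splits)

lemma indicator_slice_L2:
  assumes E: "E \<in> sets M" shows "indicator (E \<times> {\<one>\<^bsub>G\<^esub>}) \<in> L2_fun P"
proof -
  interpret prob_space M by (rule prob)
  have S: "E \<times> {\<one>\<^bsub>G\<^esub>} \<in> sets P" using E by (simp add: cp_measure_def)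
  have "emeasure P (E \<times> {\<one>\<^bsub>G\<^esub>}) < \<infinity>"
    using E by (simp add: emeasure_cp_slice emeasure_eq_measure)
  then have "integrable P (indicator (E \<times> {\<one>\<^bsub>G\<^esub>}) :: _ \<Rightarrow> real)" using S by simp
  moreover have "(\<lambda>z. (cmod (indicator (E \<times> {\<one>\<^bsub>G\<^esub>}) z))\<^sup>2) = indicator (E \<times> {\<one>\<^bsub>G\<^esub>})"
    by (auto simp: indicator_def fun_eq_iff)
  ultimately show ?thesis using S by (simp add: L2_fun_def)
qed

lemma vec_L2: "vec \<in> L2_fun P"
proof (rule L2_fun_cong_AE[OF indicator_slice_L2[OF sets.top]])
  show "AE z in P. vec z = indicator (space M \<times> {\<one>\<^bsub>G\<^esub>}) z" by (rule AE_I2) (rule vec_indicator)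
  have "(indicator (space M \<times> {\<one>\<^bsub>G\<^esub>}) :: _ \<Rightarrow> complex) \<in> borel_measurable P"
    by (rule L2_fun_measurable[OF indicator_slice_L2[OF sets.top]])
  then show "vec \<in> borel_measurable P" by (subst measurable_cong[OF vec_indicator])
qed

lemma cp_vector_vec: "cp_vector G M = ae_class P vec"
  by (simp add: cp_vector_def vec_def)

lemma tr_CP: "tr CP T = inner_prod (L2_space P) (T (ae_class P vec)) (ae_class P vec)"
  by (simp add: crossed_product_def operator_alg_def cp_vector_vec)

text \<open>This value links measure and 2-norm: it shows that the part of the space not covered by
  finitely many E(h, g) is negligible in the matrix algebras.\<close>

lemma tr_cp_fun_indicator:
  assumes E: "E \<in> sets M" shows "tr CP (cp_fun G M (indicator E)) = complex_of_real (measure M E)"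
proof -
  interpret prob_space M by (rule prob)
  let ?S = "E \<times> {\<one>\<^bsub>G\<^esub>}"
  have S: "?S \<in> sets P" using E by (simp add: cp_measure_def)
  have E0: "E \<subseteq> space M" by (rule sets.sets_into_space[OF E])
  have eq: "indicator E (fst z) * vec z = indicator ?S z" if "z \<in> space P" for z
    using that by (auto simp: vec_def indicator_def split: prod.splits)
  have "mult_op P (\<lambda>z. indicator E (fst z)) (ae_class P vec) = ae_class P (\<lambda>z. indicator E (fst z) * vec z)"
    by (rule mult_op_ae_class[OF vec_L2])
  also have "\<dots> = ae_class P (indicator ?S)"
    by (rule ae_class_eqI) (rule AE_I2[OF eq])
  finally have "tr CP (cp_fun G M (indicator E)) = L2_ip P (indicator ?S) vec"
    by (simp add: tr_CP cp_fun_mult_op L2_space_inner[OF indicator_slice_L2[OF E] vec_L2])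
  also have "\<dots> = (LINT z|P. complex_of_real (indicator ?S z))"
    unfolding L2_ip_def
    by (rule Bochner_Integration.integral_cong) (auto simp: vec_def indicator_def)
  also have "\<dots> = complex_of_real (measure P ?S)"
    using S by (simp add: integral_complex_of_real)
  also have "measure P ?S = measure M E"
    using E by (simp add: measure_def emeasure_cp_slice)
  finally show ?thesis .
qed

end

section \<open>Embedding the crossed product of \<beta> into that of \<alpha>\<close>

context oe_data
begin

abbreviation "cpAd \<equiv> koopman_conj A.P B.P \<Phi> \<Psi>"

lemma \<Psi>_mp: "measure_preserving B.P A.P \<Psi>"
  using cp_iso by (simp add: measure_iso_def)

lemma Linf_comp: assumes "f \<in> Linf_fun N" shows "(\<lambda>x. f (\<phi> x)) \<in> Linf_fun M"
proof -
  obtain c where c: "AE x in N. cmod (f x) \<le> c" and f[measurable]: "f \<in> borel_measurable N"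
    using assms by (auto simp: Linf_fun_def)
  note [measurable] = measure_preserving_measurable[OF \<phi>_mp]
  have "AE x in M. cmod (f (\<phi> x)) \<le> c" by (rule measure_preserving_AE[OF \<phi>_mp c])
  then show ?thesis unfolding Linf_fun_def by auto
qed

lemma Ad_cp_fun:
  assumes f: "f \<in> Linf_fun N" shows "cpAd (cp_fun H N f) = cp_fun G M (\<lambda>x. f (\<phi> x))"
proof -
  obtain c where c: "(\<lambda>z. f (fst z)) \<in> borel_measurable B.P" "AE z in B.P. cmod (f (fst z)) \<le> c"
    by (rule B.Linf_fst[OF f])
  have "fst (\<Phi> z) = \<phi> (fst z)" for z by (cases z) (simp add: \<Phi>_def)
  then show ?thesis
    using mult_op_koopman_conj[OF \<Phi>_mp \<Psi>_mp measure_iso.\<Psi>\<Phi>[OF cp_iso] c]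
    by (simp add: A.cp_fun_mult_op B.cp_fun_mult_op)
qed

text \<open>The set E(h, g) of the overview; within X it is the level set of
  \<open>\<lambda>x. coc x g\<close> at h. For fixed h these sets partition X.\<close>

definition part :: "'h \<Rightarrow> 'g \<Rightarrow> 'a set" where
  "part h g = {x \<in> X. \<phi> (\<alpha> (inv\<^bsub>G\<^esub> g) x) = \<beta> (inv\<^bsub>H\<^esub> h) (\<phi> x)}"

lemma part_sets:
  assumes h: "h \<in> carrier H" and g: "g \<in> carrier G" shows "part h g \<in> sets M"
proof -
  have "part h g = (\<lambda>x. coc x g) -` {h} \<inter> space M \<inter> X"
  proof (rule Set.set_eqI)
    fix x show "x \<in> part h g \<longleftrightarrow> x \<in> (\<lambda>x. coc x g) -` {h} \<inter> space M \<inter> X"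
    proof (cases "x \<in> X")
      case True
      then show ?thesis using coc(2)[OF True g] coc_eqI[OF True g h] A.X_space[OF True]
        by (auto simp: part_def)
    qed (simp add: part_def)
  qed
  also have "\<dots> \<in> sets M"
    using measurable_sets[OF coc_measurable[OF g], of "{h}"] h by auto
  finally show ?thesis .
qed

text \<open>Injectivity of \<phi> on X, followed by freeness of \<alpha>.\<close>

lemma part_disjoint:
  assumes "h \<in> carrier H" "g \<in> carrier G" "g' \<in> carrier G" "x \<in> part h g" "x \<in> part h g'"
  shows "g = g'"
proof -
  have x: "x \<in> X" and eq: "\<phi> (\<alpha> (inv\<^bsub>G\<^esub> g) x) = \<phi> (\<alpha> (inv\<^bsub>G\<^esub> g') x)"
    using assms by (auto simp: part_def)
  have X': "\<alpha> (inv\<^bsub>G\<^esub> g) x \<in> X" "\<alpha> (inv\<^bsub>G\<^esub> g') x \<in> X"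
    using x assms by (simp_all add: A.X_inv)
  have "\<alpha> (inv\<^bsub>G\<^esub> g) x = \<alpha> (inv\<^bsub>G\<^esub> g') x"
    using arg_cong[OF eq, of \<psi>] \<psi>\<phi>[OF X'(1)] \<psi>\<phi>[OF X'(2)] by simp
  then have "inv\<^bsub>G\<^esub> g = inv\<^bsub>G\<^esub> g'" using assms by (intro A.act_inj[OF x]) auto
  then show ?thesis using assms by (metis A.gr.inv_inv)
qed

text \<open>The translate of \<open>\<phi> x\<close> by the inverse of h returns under \<psi> to the
  G-orbit of x.\<close>

lemma part_cover:
  assumes h: "h \<in> carrier H" and x: "x \<in> X" shows "\<exists>g\<in>carrier G. x \<in> part h g"
proof -
  obtain g where g: "g \<in> carrier G" "\<psi> (\<beta> (inv\<^bsub>H\<^esub> h) (\<phi> x)) = \<alpha> g (\<psi> (\<phi> x))"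
    using \<psi>_orbit[OF \<phi>_X[OF x], of "inv\<^bsub>H\<^esub> h"] h by auto
  have "\<beta> (inv\<^bsub>H\<^esub> h) (\<phi> x) = \<phi> (\<psi> (\<beta> (inv\<^bsub>H\<^esub> h) (\<phi> x)))"
    using h \<phi>\<psi>[OF B.X_inv[OF \<phi>_X[OF x], of "inv\<^bsub>H\<^esub> h"]] by simp
  also have "\<dots> = \<phi> (\<alpha> g x)" using g(2) \<psi>\<phi>[OF x] by simp
  finally show ?thesis using g(1) x by (intro bexI[of _ "inv\<^bsub>G\<^esub> g"]) (auto simp: part_def)
qed

lemma Ad_cp_unitary:
  assumes h: "h \<in> carrier H"
  shows "cpAd (cp_unitary H N \<beta> h) = koopman A.P A.P (\<lambda>z. \<Psi> (B.shift h (\<Phi> z)))"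
  by (simp add: B.cp_unitary_koopman koopman_koopman_conj[OF \<Phi>_mp \<Psi>_mp B.shift_mp[OF h]])

lemma Ad_cp_unitary_bounded:
  assumes h: "h \<in> carrier H" shows "cpAd (cp_unitary H N \<beta> h) \<in> bounded_ops (L2_space A.P)"
  unfolding Ad_cp_unitary[OF h]
  by (intro koopman_bounded measure_preserving_comp[OF measure_preserving_comp[OF \<Phi>_mp B.shift_mp[OF h]] \<Psi>_mp])

text \<open>The localised form of V = \<Sum> 1_E u_g, which stands in for the infinite sum from here
  on.\<close>

lemma part_Ad_cp_unitary:
  assumes h: "h \<in> carrier H" and g: "g \<in> carrier G"
  shows "cp_fun G M (indicator (part h g)) \<otimes>\<^bsub>A.CP\<^esub> cpAd (cp_unitary H N \<beta> h) =
         cp_fun G M (indicator (part h g)) \<otimes>\<^bsub>A.CP\<^esub> cp_unitary G M \<alpha> g"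
proof -
  have "AE z in A.P. indicator (part h g) (fst z) \<noteq> (0::complex) \<longrightarrow> \<Psi> (B.shift h (\<Phi> z)) = A.shift g z"
    using AE_cp_X
  proof eventually_elim
    case (elim z)
    then show ?case using shift_conj[OF h g, of "fst z" "snd z"] by (auto simp: part_def indicator_def)
  qed
  then show ?thesis
    unfolding Ad_cp_unitary[OF h] A.cp_unitary_koopman A.cp_fun_mult_op
    using mult_op_koopman_cong[OF measure_preserving_comp[OF measure_preserving_comp[OF \<Phi>_mp B.shift_mp[OF h]] \<Psi>_mp] A.shift_mp[OF g]]
    by (simp add: crossed_product_def operator_alg_def)
qed

text \<open>Let T commute with the generators and let e be the indicator of E(h, g). Then e T V = T
  e V = T e u_g = e u_g T = e V T. The sets E(h, g) cover almost the whole space, so T V and V T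
  agree on every vector.\<close>

lemma Ad_cp_unitary_in:
  assumes h: "h \<in> carrier H" shows "cpAd (cp_unitary H N \<beta> h) \<in> carrier A.CP"
  unfolding A.carrier_CP commutant_def[of _ "commutant (L2_space A.P) A.gens"]
proof (intro CollectI conjI ballI Ad_cp_unitary_bounded[OF h])
  let ?K = "cpAd (cp_unitary H N \<beta> h)" and ?C = "carrier (L2_space A.P)"
  let ?e = "\<lambda>g. cp_fun G M (indicator (part h g))"
  fix T assume T: "T \<in> commutant (L2_space A.P) A.gens"
  have Tb: "T \<in> bounded_ops (L2_space A.P)" using T by (simp add: commutant_def)
  note TC = bounded_opsD(2)[OF Tb] and KC = bounded_opsD(2)[OF Ad_cp_unitary_bounded[OF h]]
  have comm: "T (S \<xi>) = S (T \<xi>)" if "S \<in> A.gens" "\<xi> \<in> ?C" for S \<xi>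
  proof -
    have "compose ?C T S = compose ?C S T" using T that(1) by (simp add: commutant_def)
    then have "compose ?C T S \<xi> = compose ?C S T \<xi>" by simp
    then show ?thesis using that(2) by (simp add: compose_def)
  qed
  have gen_e: "?e g \<in> A.gens" if "g \<in> carrier G" for g
    using Linf_indicator[OF part_sets[OF h that]] by (auto simp: A.cp_Linf_eq)
  have gen_u: "cp_unitary G M \<alpha> g \<in> A.gens" if "g \<in> carrier G" for g using that by auto
  have ek: "?e g (?K \<xi>) = ?e g (cp_unitary G M \<alpha> g \<xi>)" if "g \<in> carrier G" "\<xi> \<in> ?C" for g \<xi>
  proof -
    have "(?e g \<otimes>\<^bsub>A.CP\<^esub> ?K) \<xi> = (?e g \<otimes>\<^bsub>A.CP\<^esub> cp_unitary G M \<alpha> g) \<xi>"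
      by (simp add: part_Ad_cp_unitary[OF h that(1)])
    then show ?thesis using that(2) by (simp add: crossed_product_def operator_alg_def compose_def)
  qed
  show "compose ?C ?K T = compose ?C T ?K"
  proof (rule extensionalityI[of _ ?C])
    fix \<xi> assume \<xi>: "\<xi> \<in> ?C"
    have e: "?e g (T (?K \<xi>)) = ?e g (?K (T \<xi>))" if g: "g \<in> carrier G" for g
    proof -
      have "?e g (T (?K \<xi>)) = T (?e g (?K \<xi>))" using comm[OF gen_e[OF g] KC[OF \<xi>]] by simp
      also have "\<dots> = T (?e g (cp_unitary G M \<alpha> g \<xi>))" using ek[OF g \<xi>] by simp
      also have "\<dots> = ?e g (T (cp_unitary G M \<alpha> g \<xi>))"
        by (rule comm[OF gen_e[OF g] bounded_opsD(2)[OF A.cp_unitary_bounded[OF g] \<xi>]])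
      also have "\<dots> = ?e g (cp_unitary G M \<alpha> g (T \<xi>))" using comm[OF gen_u[OF g] \<xi>] by simp
      also have "\<dots> = ?e g (?K (T \<xi>))" using ek[OF g TC[OF \<xi>]] by simp
      finally show ?thesis .
    qed
    \<comment> \<open>Countability of G merges the null sets belonging to the single g into
      one.\<close>
    have "AE z in A.P. \<forall>g\<in>carrier G. indicator (part h g) (fst z) * rep (T (?K \<xi>)) z
        = (indicator (part h g) (fst z) * rep (?K (T \<xi>)) z :: complex)"
      unfolding AE_ball_countable[OF A.countable_G]
    proof
      fix g assume g: "g \<in> carrier G"
      show "AE z in A.P. indicator (part h g) (fst z) * rep (T (?K \<xi>)) z
        = (indicator (part h g) (fst z) * rep (?K (T \<xi>)) z :: complex)"
      proof (rule mult_op_eqD[OF TC[OF KC[OF \<xi>]] KC[OF TC[OF \<xi>]]])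
        show "(\<lambda>z. indicator (part h g) (fst z) :: complex) \<in> borel_measurable A.P"
          by (rule A.Linf_fst[OF Linf_indicator[OF part_sets[OF h g]]])
        show "mult_op A.P (\<lambda>z. indicator (part h g) (fst z)) (T (?K \<xi>)) =
          mult_op A.P (\<lambda>z. indicator (part h g) (fst z)) (?K (T \<xi>))"
          using e[OF g] by (simp add: A.cp_fun_mult_op)
      qed
    qed
    then have "AE z in A.P. rep (T (?K \<xi>)) z = rep (?K (T \<xi>)) z"
      using AE_cp_X
    proof eventually_elim
      case (elim z)
      obtain g where g: "g \<in> carrier G" "fst z \<in> part h g" using part_cover[OF h] elim by blast
      then show ?case using elim(1) by (auto dest!: bspec[of _ _ g])
    qed
    then have "ae_class A.P (rep (T (?K \<xi>))) = ae_class A.P (rep (?K (T \<xi>)))" by (rule ae_class_eqI)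
    then show "compose ?C ?K T \<xi> = compose ?C T ?K \<xi>"
      using \<xi> by (simp add: compose_def ae_class_rep TC KC)
  qed (auto simp: compose_def)
qed

text \<open>The cocycle at x is injective and fixes the neutral element, so \<Phi> matches the
  slices over the two neutral elements. Thus the trace vectors correspond.\<close>

lemma Ad_vec: "koopman A.P B.P \<Phi> (ae_class B.P B.vec) = ae_class A.P A.vec"
  unfolding koopman_ae_class[OF \<Phi>_mp B.vec_L2]
proof (rule ae_class_eqI)
  show "AE z in A.P. B.vec (\<Phi> z) = A.vec z"
    using AE_cp_X
  proof eventually_elim
    case (elim z)
    obtain x k where z: "z = (x, k)" "x \<in> X" "k \<in> carrier G" using elim by (cases z) auto
    have one: "coc x \<one>\<^bsub>G\<^esub> = \<one>\<^bsub>H\<^esub>"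
      using z A.X_space B.X_space[OF \<phi>_X] by (intro coc_eqI) (auto simp: A.act_one B.act_one)
    have "coc x k = \<one>\<^bsub>H\<^esub> \<longleftrightarrow> k = \<one>\<^bsub>G\<^esub>"
      using bij_betw_imp_inj_on[OF coc_bij[OF z(2)]] z(3) one by (auto dest!: inj_onD[of _ _ k "\<one>\<^bsub>G\<^esub>"])
    then show ?case by (simp add: z A.vec_def B.vec_def \<Phi>_def)
  qed
qed

text \<open>Containment is checked on generators and extended by \<open>Ad_bicommutant\<close>. The
  traces are vector states, and the unitary matches the two vectors.\<close>

lemma cp_embedding: "embedding B.CP A.CP cpAd"
proof -
  interpret iso: measure_iso A.P B.P \<Phi> \<Psi> by (rule cp_iso)
  have in_CP: "cpAd T \<in> carrier A.CP" if "T \<in> carrier B.CP" for T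
    unfolding A.carrier_CP
  proof (rule iso.Ad_bicommutant[OF B.gens_bounded])
    show "T \<in> commutant (L2_space B.P) (commutant (L2_space B.P) B.gens)"
      using that by (simp add: B.carrier_CP)
    fix S assume "S \<in> B.gens"
    then have "cpAd S \<in> carrier A.CP"
      by (auto simp: B.cp_Linf_eq Ad_cp_fun Ad_cp_unitary_in A.cp_fun_in Linf_comp)
    then show "cpAd S \<in> commutant (L2_space A.P) (commutant (L2_space A.P) A.gens)"
      by (simp add: A.carrier_CP)
  qed
  have vV: "koopman B.P A.P \<Psi> (ae_class A.P A.vec) = ae_class B.P B.vec"
    using iso.VW[OF ae_class_in_L2[OF B.vec_L2]] by (simp add: Ad_vec)
  have tr: "inner_prod (L2_space A.P) (cpAd T (cp_vector G M)) (cp_vector G M)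
      = inner_prod (L2_space B.P) (T (cp_vector H N)) (cp_vector H N)" if T: "T \<in> carrier B.CP" for T
  proof -
    have "T \<in> bounded_ops (L2_space B.P)" using T B.CP_bounded by blast
    then have Tv: "T (ae_class B.P B.vec) \<in> carrier (L2_space B.P)"
      by (rule bounded_opsD(2)) (rule ae_class_in_L2[OF B.vec_L2])
    have "inner_prod (L2_space A.P) (cpAd T (ae_class A.P A.vec)) (ae_class A.P A.vec)
      = inner_prod (L2_space A.P) (iso.W (T (ae_class B.P B.vec))) (iso.W (ae_class B.P B.vec))"
      by (simp add: iso.Ad_app[OF ae_class_in_L2[OF A.vec_L2]] vV Ad_vec)
    also have "\<dots> = inner_prod (L2_space B.P) (T (ae_class B.P B.vec)) (ae_class B.P B.vec)"
      by (rule iso.W_inner[OF Tv ae_class_in_L2[OF B.vec_L2]])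
    finally show ?thesis by (simp add: A.cp_vector_vec B.cp_vector_vec)
  qed
  show ?thesis
    unfolding crossed_product_def
    by (rule iso.Ad_embedding)
       (use B.CP_bounded in_CP tr in \<open>auto simp: A.carrier_CP B.carrier_CP\<close>)
qed

end

lemma hyperlinear_action_oe:
  assumes "pmp_action G M \<alpha>" "free_action G M \<alpha>" "pmp_action H N \<beta>" "free_action H N \<beta>"
    and "orbit_equivalent G M \<alpha> H N \<beta>" and "hyperlinear_action \<omega> R G M \<alpha>"
  shows "hyperlinear_action \<omega> R H N \<beta>"
proof -
  obtain X Y \<phi> \<psi> where "oe_data G M \<alpha> X H N \<beta> Y \<phi> \<psi>"
    using oe_data_exists[OF assms(1-5)] by blast
  then interpret oe_data G M \<alpha> X H N \<beta> Y \<phi> \<psi> .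
  show ?thesis
    using assms(6) embedding_comp[OF cp_embedding] unfolding hyperlinear_action_def by blast
qed

section \<open>Almost permutation matrices\<close>

text \<open>A and its image have complements of equal size, and any bijection between these
  completes r.\<close>

lemma permutation_extends:
  assumes A: "A \<subseteq> {..<n}" and inj: "inj_on r A" and r: "r ` A \<subseteq> {..<n::nat}"
  shows "\<exists>s. s permutes {..<n} \<and> (\<forall>i\<in>A. s i = r i)"
proof -
  have fA: "finite A" using A finite_subset by blast
  have "card ({..<n} - A) = card ({..<n} - r ` A)"
    using A r fA inj by (simp add: card_Diff_subset card_image)
  then obtain t where t: "bij_betw t ({..<n} - A) ({..<n} - r ` A)"
    using finite_same_card_bij[of "{..<n} - A" "{..<n} - r ` A"] by auto
  define s where "s i = (if i \<in> A then r i else if i < n then t i else i)" for i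
  have "bij_betw s A (r ` A)"
    using inj by (simp add: bij_betw_def s_def inj_on_def)
  moreover have "bij_betw s ({..<n} - A) ({..<n} - r ` A)"
    using t by (rule bij_betw_cong[THEN iffD1, rotated]) (auto simp: s_def)
  ultimately have "bij_betw s (A \<union> ({..<n} - A)) (r ` A \<union> ({..<n} - r ` A))"
    by (rule bij_betw_combine) auto
  then have "bij_betw s {..<n} {..<n}" using A r by (simp add: Un_absorb1)
  then have "s permutes {..<n}" by (rule bij_imp_permutes) (use A in \<open>auto simp: s_def\<close>)
  then show ?thesis by (intro exI[of _ s]) (auto simp: s_def)
qed

text \<open>Each row \<open>i\<close> with \<open>d g i\<close> bounded away from \<open>0\<close> is close to the row of the permutation matrix of
  \<open>p g\<close>. This defines a partial map on most of \<open>{..<n}\<close>; as the columns of \<open>v\<close> have norm about \<open>1\<close>,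
  only few columns are missed by it.\<close>

lemma permutation_approximation:
  fixes v :: "nat \<Rightarrow> nat \<Rightarrow> complex" and d :: "'g \<Rightarrow> nat \<Rightarrow> complex" and p :: "'g \<Rightarrow> nat \<Rightarrow> nat"
  assumes F: "finite F" and p: "\<And>g. g \<in> F \<Longrightarrow> p g permutes {..<n}"
    and d1: "(\<Sum>i<n. (cmod (1 - (\<Sum>g\<in>F. d g i)))\<^sup>2) \<le> e"
    and dv: "4 * (real (card F))\<^sup>2 *
      (\<Sum>g\<in>F. \<Sum>i<n. \<Sum>j<n. (cmod (d g i * (v i j - (if i = p g j then 1 else 0))))\<^sup>2) \<le> e"
    and rows: "(\<Sum>i<n. \<bar>(\<Sum>j<n. (cmod (v i j))\<^sup>2) - 1\<bar>) \<le> e"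
    and cols: "(\<Sum>j<n. \<bar>(\<Sum>i<n. (cmod (v i j))\<^sup>2) - 1\<bar>) \<le> e"
  shows "\<exists>\<sigma>. \<sigma> permutes {..<n} \<and> (\<Sum>i<n. \<Sum>j<n. (cmod (v i j - (if i = \<sigma> j then 1 else 0)))\<^sup>2) \<le> 31 * e"
proof -
  define m where "m = real (card F)"
  define R where "R i = (\<Sum>j<n. (cmod (v i j))\<^sup>2)" for i
  define C where "C j = (\<Sum>i<n. (cmod (v i j))\<^sup>2)" for j
  have R0: "0 \<le> R i" for i unfolding R_def by (intro sum_nonneg) auto
  have Rsum: "(\<Sum>i\<in>S. R i) \<le> real (card S) + e" if "S \<subseteq> {..<n}" for S
  proof -
    have "(\<Sum>i\<in>S. R i) \<le> (\<Sum>i\<in>S. 1 + \<bar>R i - 1\<bar>)" by (intro sum_mono) auto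
    also have "\<dots> = real (card S) + (\<Sum>i\<in>S. \<bar>R i - 1\<bar>)" by (simp add: sum.distrib)
    also have "(\<Sum>i\<in>S. \<bar>R i - 1\<bar>) \<le> (\<Sum>i<n. \<bar>R i - 1\<bar>)" by (rule sum_mono2) (use that in auto)
    finally show ?thesis using rows by (simp add: R_def)
  qed
  \<comment> \<open>The threshold 1 / (2 m) serves both cases. If no \<open>d g i\<close> exceeds it
    in modulus, their sum has modulus at most 1/2 and the row costs at least 1/4 in
    \<open>d1\<close>. If one does, the factor 4 m^2 in \<open>dv\<close> makes up for its
    square.\<close>
  define A where "A = {i. i < n \<and> (\<exists>g\<in>F. cmod (d g i) > 1 / (2 * m))}"
  have An: "A \<subseteq> {..<n}" by (auto simp: A_def)
  then have fA: "finite A" using finite_subset by blast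
  have far: "1 / 4 \<le> (cmod (1 - (\<Sum>g\<in>F. d g i)))\<^sup>2" if "i \<in> {..<n} - A" for i
  proof -
    have "cmod (\<Sum>g\<in>F. d g i) \<le> (\<Sum>g\<in>F. cmod (d g i))" by (rule norm_sum)
    also have "\<dots> \<le> (\<Sum>g\<in>F. 1 / (2 * m))" by (intro sum_mono) (use that in \<open>auto simp: A_def not_less\<close>)
    also have "\<dots> \<le> 1 / 2" by (simp add: m_def)
    finally have "1 / 2 \<le> cmod (1 - (\<Sum>g\<in>F. d g i))"
      using norm_triangle_ineq2[of 1 "\<Sum>g\<in>F. d g i"] by simp
    then have "(1 / 2)\<^sup>2 \<le> (cmod (1 - (\<Sum>g\<in>F. d g i)))\<^sup>2" by (intro power_mono) auto
    then show ?thesis by (simp add: power2_eq_square)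
  qed
  have cA: "real (card ({..<n} - A)) \<le> 4 * e"
  proof -
    have "real (card ({..<n} - A)) * (1 / 4) = (\<Sum>i\<in>{..<n} - A. 1 / 4)" by simp
    also have "\<dots> \<le> (\<Sum>i\<in>{..<n} - A. (cmod (1 - (\<Sum>g\<in>F. d g i)))\<^sup>2)" by (intro sum_mono far)
    also have "\<dots> \<le> (\<Sum>i<n. (cmod (1 - (\<Sum>g\<in>F. d g i)))\<^sup>2)" by (rule sum_mono2) auto
    finally show ?thesis using d1 by simp
  qed
  have "\<forall>i\<in>A. \<exists>g\<in>F. cmod (d g i) > 1 / (2 * m)" by (auto simp: A_def)
  then obtain \<gamma> where \<gamma>: "\<And>i. i \<in> A \<Longrightarrow> \<gamma> i \<in> F" "\<And>i. i \<in> A \<Longrightarrow> cmod (d (\<gamma> i) i) > 1 / (2 * m)"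
    by metis
  \<comment> \<open>The column in which row i of the permutation matrix of
    \<open>p (\<gamma> i)\<close> has its entry 1.\<close>
  define r where "r i = Hilbert_Choice.inv (p (\<gamma> i)) i" for i
  have r_eq: "i = p (\<gamma> i) j \<longleftrightarrow> j = r i" if "i \<in> A" for i j
    using permutes_inv_eq[OF p[OF \<gamma>(1)[OF that]], of i j] by (auto simp: r_def)
  have rn: "r ` A \<subseteq> {..<n}"
  proof
    fix j assume "j \<in> r ` A"
    then obtain i where i: "i \<in> A" "j = r i" by blast
    then show "j \<in> {..<n}"
      using permutes_in_image[OF permutes_inv[OF p[OF \<gamma>(1)[OF i(1)]]], of i] An by (auto simp: r_def)
  qed
  define D where "D i = (\<Sum>j<n. (cmod (v i j - (if j = r i then 1 else 0)))\<^sup>2)" for i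
  have D0: "0 \<le> D i" for i unfolding D_def by (intro sum_nonneg) auto
  have DA: "(\<Sum>i\<in>A. D i) \<le> e"
  proof -
    let ?t = "\<lambda>g i. \<Sum>j<n. (cmod (d g i * (v i j - (if i = p g j then 1 else 0))))\<^sup>2"
    have "D i \<le> 4 * m\<^sup>2 * (\<Sum>g\<in>F. ?t g i)" if i: "i \<in> A" for i
    proof -
      have m: "m > 0" using \<gamma>(1)[OF i] F by (auto simp: m_def card_gt_0_iff)
      have "1 \<le> 2 * m * cmod (d (\<gamma> i) i)" using \<gamma>(2)[OF i] m by (simp add: field_simps)
      then have "1 \<le> (2 * m * cmod (d (\<gamma> i) i))\<^sup>2" by (rule one_le_power)
      then have "1 * D i \<le> (2 * m * cmod (d (\<gamma> i) i))\<^sup>2 * D i" by (rule mult_right_mono) (rule D0)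
      also have "\<dots> = 4 * m\<^sup>2 * ?t (\<gamma> i) i"
        using r_eq[OF i] by (simp add: D_def norm_mult power_mult_distrib sum_distrib_left mult.assoc)
      also have "\<dots> \<le> 4 * m\<^sup>2 * (\<Sum>g\<in>F. ?t g i)"
        by (intro mult_left_mono member_le_sum \<gamma>(1)[OF i] F sum_nonneg) auto
      finally show ?thesis by simp
    qed
    then have "(\<Sum>i\<in>A. D i) \<le> (\<Sum>i\<in>A. 4 * m\<^sup>2 * (\<Sum>g\<in>F. ?t g i))" by (rule sum_mono)
    also have "\<dots> \<le> (\<Sum>i<n. 4 * m\<^sup>2 * (\<Sum>g\<in>F. ?t g i))"
      by (rule sum_mono2) (use An in \<open>auto intro!: mult_nonneg_nonneg sum_nonneg\<close>)
    also have "\<dots> = 4 * m\<^sup>2 * (\<Sum>g\<in>F. \<Sum>i<n. ?t g i)"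
      by (simp only: sum_distrib_left[symmetric]) (subst sum.swap, rule refl)
    finally show ?thesis using dv by (simp add: m_def)
  qed
  define B where "B = {..<n} - r ` A"
  \<comment> \<open>Columns missed by r receive their mass from the rows outside A, at most 4e + e
    in all, and from the errors of the rows in A, at most e. Their norms are 1 up to a total defect
    of e, so there are at most 7e of them.\<close>
  have BC: "real (card B) \<le> 7 * e"
  proof -
    have "(\<Sum>j\<in>B. C j) = (\<Sum>i<n. \<Sum>j\<in>B. (cmod (v i j))\<^sup>2)"
      unfolding C_def by (rule sum.swap)
    also have "\<dots> = (\<Sum>i\<in>{..<n} - A. \<Sum>j\<in>B. (cmod (v i j))\<^sup>2) + (\<Sum>i\<in>A. \<Sum>j\<in>B. (cmod (v i j))\<^sup>2)"
      by (rule sum.subset_diff[OF An]) simp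
    also have "\<dots> \<le> (\<Sum>i\<in>{..<n} - A. R i) + (\<Sum>i\<in>A. D i)"
    proof (intro add_mono sum_mono)
      show "(\<Sum>j\<in>B. (cmod (v i j))\<^sup>2) \<le> R i" for i
        unfolding R_def by (rule sum_mono2) (auto simp: B_def)
      show "(\<Sum>j\<in>B. (cmod (v i j))\<^sup>2) \<le> D i" if "i \<in> A" for i
      proof -
        have "(\<Sum>j\<in>B. (cmod (v i j))\<^sup>2) = (\<Sum>j\<in>B. (cmod (v i j - (if j = r i then 1 else 0)))\<^sup>2)"
          by (rule sum.cong) (use that in \<open>auto simp: B_def\<close>)
        also have "\<dots> \<le> D i" unfolding D_def by (rule sum_mono2) (auto simp: B_def)
        finally show ?thesis .
      qed
    qed
    also have "\<dots> \<le> (4 * e + e) + e"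
      using Rsum[of "{..<n} - A"] cA DA by auto
    finally have up: "(\<Sum>j\<in>B. C j) \<le> 6 * e" by simp
    have "real (card B) = (\<Sum>j\<in>B. 1)" by simp
    also have "\<dots> \<le> (\<Sum>j\<in>B. C j + \<bar>C j - 1\<bar>)" by (intro sum_mono) auto
    also have "\<dots> = (\<Sum>j\<in>B. C j) + (\<Sum>j\<in>B. \<bar>C j - 1\<bar>)" by (rule sum.distrib)
    also have "(\<Sum>j\<in>B. \<bar>C j - 1\<bar>) \<le> (\<Sum>j<n. \<bar>C j - 1\<bar>)" by (rule sum_mono2) (auto simp: B_def)
    finally show ?thesis using up cols by (simp add: C_def)
  qed
  \<comment> \<open>One row for each column that is hit. The rows left out are then exactly as many
    as the missed columns.\<close>
  obtain A' where A': "A' \<subseteq> A" "inj_on r A'" "r ` A = r ` A'"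
    using subset_image_inj[of "r ` A" r A] by auto
  have A'n: "A' \<subseteq> {..<n}" and fA': "finite A'" using A' An fA finite_subset by auto
  have "card ({..<n} - A') = card B"
    using A'n fA' rn A' by (simp add: B_def card_Diff_subset card_image)
  then have cA': "real (card ({..<n} - A')) \<le> 7 * e" using BC by simp
  obtain s where s: "s permutes {..<n}" and sr: "\<And>i. i \<in> A' \<Longrightarrow> s i = r i"
    using permutation_extends[OF A'n A'(2)] A'(3) rn by auto
  have s_eq: "i = Hilbert_Choice.inv s j \<longleftrightarrow> j = s i" for i j
    using permutes_inv_eq[OF s, of j i] by auto
  define E where "E i = (\<Sum>j<n. (cmod (v i j - (if j = s i then 1 else 0)))\<^sup>2)" for i
  have E1: "E i \<le> 2 * R i + 2" if "i < n" for i
  proof -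
    have "E i \<le> (\<Sum>j<n. 2 * (cmod (v i j))\<^sup>2 + 2 * (if j = s i then 1 else 0))"
      unfolding E_def
    proof (rule sum_mono)
      fix j show "(cmod (v i j - (if j = s i then 1 else 0)))\<^sup>2 \<le> 2 * (cmod (v i j))\<^sup>2 + 2 * (if j = s i then 1 else 0)"
        using cmod_add_square_le[of "v i j" "-1"] by auto
    qed
    also have "\<dots> = 2 * R i + 2 * (\<Sum>j<n. if j = s i then 1 else 0)"
      unfolding R_def by (simp only: sum.distrib sum_distrib_left)
    also have "(\<Sum>j<n. if j = s i then 1 else 0) = (1::real)"
      using permutes_in_image[OF s, of i] that by simp
    finally show ?thesis by simp
  qed
  \<comment> \<open>Origin of 31: the at most 7e rows outside A' contribute 2 (7e + e) + 2 (7e) by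
    the crude bound \<open>E1\<close>, the rows in A' contribute e.\<close>
  have "(\<Sum>i<n. E i) = (\<Sum>i\<in>{..<n} - A'. E i) + (\<Sum>i\<in>A'. E i)"
    by (rule sum.subset_diff[OF A'n]) simp
  also have "(\<Sum>i\<in>{..<n} - A'. E i) \<le> (\<Sum>i\<in>{..<n} - A'. 2 * R i + 2)" by (intro sum_mono E1) auto
  also have "\<dots> = 2 * (\<Sum>i\<in>{..<n} - A'. R i) + 2 * real (card ({..<n} - A'))"
    by (simp add: sum.distrib sum_distrib_left)
  also have "\<dots> \<le> 2 * (7 * e + e) + 2 * (7 * e)"
    using Rsum[of "{..<n} - A'"] cA' by auto
  also have "(\<Sum>i\<in>A'. E i) = (\<Sum>i\<in>A'. D i)"
    by (rule sum.cong) (simp_all add: E_def D_def sr)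
  also have "\<dots> \<le> (\<Sum>i\<in>A. D i)" by (rule sum_mono2[OF fA A'(1)]) (rule D0)
  also have "\<dots> \<le> e" by (rule DA)
  finally have "(\<Sum>i<n. E i) \<le> 31 * e" by simp
  then show ?thesis
    using permutes_inv[OF s] by (intro exI[of _ "Hilbert_Choice.inv s"]) (simp add: s_eq E_def)
qed

section \<open>Matrix norms\<close>

text \<open>The square of the unnormalised Hilbert-Schmidt norm. Working with squares keeps the
  estimates linear in sums over entries; the inequality |a + b|^2 <= 2 |a|^2 + 2 |b|^2 takes the
  place of the triangle inequality.\<close>

definition frob :: "nat \<Rightarrow> complex mat \<Rightarrow> real" where
  "frob n A = (\<Sum>i<n. \<Sum>j<n. (cmod (A $$ (i, j)))\<^sup>2)"

lemma frob_nonneg: "0 \<le> frob n A"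
  unfolding frob_def by (intro sum_nonneg) auto

text \<open>The factor c, in practice 1 or -1, treats sums and differences together; comparing
  entries only avoids conditions on dimensions.\<close>

lemma frob_add_le:
  assumes "\<And>i j. i < n \<Longrightarrow> j < n \<Longrightarrow> C $$ (i, j) = A $$ (i, j) + c * B $$ (i, j)" "cmod c = 1"
  shows "frob n C \<le> 2 * frob n A + 2 * frob n B"
proof -
  have "frob n C \<le> (\<Sum>i<n. \<Sum>j<n. 2 * (cmod (A $$ (i, j)))\<^sup>2 + 2 * (cmod (B $$ (i, j)))\<^sup>2)"
    unfolding frob_def
  proof (intro sum_mono)
    fix i j assume "i \<in> {..<n}" "j \<in> {..<n}"
    then show "(cmod (C $$ (i, j)))\<^sup>2 \<le> 2 * (cmod (A $$ (i, j)))\<^sup>2 + 2 * (cmod (B $$ (i, j)))\<^sup>2"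
      using cmod_add_square_le[of "A $$ (i, j)" "c * B $$ (i, j)"] assms by (simp add: norm_mult)
  qed
  also have "\<dots> = 2 * frob n A + 2 * frob n B"
    unfolding frob_def by (simp only: sum.distrib sum_distrib_left)
  finally show ?thesis .
qed

lemma mat_adjoint_index:
  assumes A: "A \<in> carrier_mat n n" and "i < n" "j < n"
  shows "mat_adjoint A $$ (i, j) = cnj (A $$ (j, i))"
  using assms unfolding mat_adjoint_def by (simp add: mat_of_rows_def)

lemma mat_adjoint_carrier: "A \<in> carrier_mat n n \<Longrightarrow> mat_adjoint A \<in> carrier_mat n n"
  unfolding mat_adjoint_def by (simp add: mat_of_rows_def)

lemma mat_add_index:
  "A \<in> carrier_mat n n \<Longrightarrow> B \<in> carrier_mat n n \<Longrightarrow> i < n \<Longrightarrow> j < n \<Longrightarrow> (A + B) $$ (i, j) = A $$ (i, j) + B $$ (i, j)"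
  by auto

lemma mat_diff_index:
  "A \<in> carrier_mat n n \<Longrightarrow> B \<in> carrier_mat n n \<Longrightarrow> i < n \<Longrightarrow> j < n \<Longrightarrow> (A - B) $$ (i, j) = A $$ (i, j) - B $$ (i, j)"
  by auto

lemma mat_mult_index:
  assumes "A \<in> carrier_mat n n" "B \<in> carrier_mat n n" "i < n" "j < n"
  shows "(A * B) $$ (i, j) = (\<Sum>k<n. A $$ (i, k) * B $$ (k, j))"
  using assms by (simp add: scalar_prod_def lessThan_atLeast0)

lemma adjoint_mult_diag:
  assumes A: "A \<in> carrier_mat n n" and i: "i < n"
  shows "(mat_adjoint A * A) $$ (i, i) = complex_of_real (\<Sum>k<n. (cmod (A $$ (k, i)))\<^sup>2)"
    "(A * mat_adjoint A) $$ (i, i) = complex_of_real (\<Sum>k<n. (cmod (A $$ (i, k)))\<^sup>2)"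
  using mat_mult_index[OF mat_adjoint_carrier[OF A] A i i] mat_mult_index[OF A mat_adjoint_carrier[OF A] i i]
  by (simp_all add: mat_adjoint_index[OF A] i complex_norm_square mult.commute del: of_real_power)

lemma tr_adjoint_mult:
  assumes A: "A \<in> carrier_mat n n"
  shows "tr (matrix_alg n) (mat_adjoint A * A) = complex_of_real (frob n A / real n)"
proof -
  have "(\<Sum>i<n. (mat_adjoint A * A) $$ (i, i)) = complex_of_real (\<Sum>i<n. \<Sum>k<n. (cmod (A $$ (k, i)))\<^sup>2)"
    by (simp add: adjoint_mult_diag[OF A])
  also have "(\<Sum>i<n. \<Sum>k<n. (cmod (A $$ (k, i)))\<^sup>2) = frob n A"
    unfolding frob_def by (rule sum.swap)
  finally show ?thesis by (simp add: matrix_alg_def)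
qed

lemma tnorm2_matrix:
  assumes "A \<in> carrier_mat n n" shows "tnorm2 (matrix_alg n) A = sqrt (frob n A / real n)"
proof -
  have "tr (matrix_alg n) (star (matrix_alg n) A \<otimes>\<^bsub>matrix_alg n\<^esub> A) = complex_of_real (frob n A / real n)"
    using tr_adjoint_mult[OF assms] by (simp add: matrix_alg_def)
  then show ?thesis by (simp add: tnorm2_def)
qed

text \<open>Cauchy-Schwarz for the n diagonal entries. It shows that a sequence vanishing in 2-norm
  has vanishing trace.\<close>

lemma tr_matrix_le:
  assumes n: "0 < n" shows "cmod (tr (matrix_alg n) A) \<le> sqrt (frob n A / real n)"
proof (rule real_le_rsqrt)
  have "cmod (\<Sum>i<n. A $$ (i, i)) \<le> (\<Sum>i<n. cmod (A $$ (i, i)))" by (rule norm_sum)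
  then have "(cmod (\<Sum>i<n. A $$ (i, i)))\<^sup>2 \<le> (\<Sum>i<n. cmod (A $$ (i, i)))\<^sup>2"
    by (intro power_mono) auto
  also have "\<dots> \<le> (\<Sum>i<n. (cmod (A $$ (i, i)))\<^sup>2) * real (card {..<n})"
    by (rule sum_squared_le_sum_of_squares)
  also have "(\<Sum>i<n. (cmod (A $$ (i, i)))\<^sup>2) \<le> frob n A"
    unfolding frob_def by (intro sum_mono member_le_sum[where f="\<lambda>j. (cmod (A $$ (_, j)))\<^sup>2"]) auto
  finally have "(cmod (\<Sum>i<n. A $$ (i, i)))\<^sup>2 \<le> frob n A * real n" using n by (simp add: mult_right_mono)
  then show "(cmod (tr (matrix_alg n) A))\<^sup>2 \<le> frob n A / real n"
    using n by (simp add: matrix_alg_def norm_divide power_divide field_simps power2_eq_square)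
qed

section \<open>The operator norm of matrices\<close>

definition vsq :: "nat \<Rightarrow> (nat \<Rightarrow> complex) \<Rightarrow> real" where
  "vsq n v = (\<Sum>i<n. (cmod (v i))\<^sup>2)"

definition app :: "nat \<Rightarrow> complex mat \<Rightarrow> (nat \<Rightarrow> complex) \<Rightarrow> nat \<Rightarrow> complex" where
  "app n A v i = (\<Sum>j<n. A $$ (i, j) * v j)"

lemma vec_norm_sq:
  assumes "v \<in> carrier_vec n" shows "Re (v \<bullet>c v) = vsq n (\<lambda>i. v $ i)"
  using assms
  by (simp add: scalar_prod_def vsq_def lessThan_atLeast0 complex_norm_square[symmetric] Re_sum del: of_real_power)

text \<open>Vectors with a dimension are exchanged for functions of which only the values below n
  count, so that the estimates below carry no conditions on vectors.\<close>

lemma opnorm_matrix: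
  assumes A: "A \<in> carrier_mat n n"
  shows "opnorm (matrix_alg n) A = Sup {sqrt (vsq n (app n A v)) | v. vsq n v \<le> 1}"
proof -
  have eq: "Re ((A *\<^sub>v v) \<bullet>c (A *\<^sub>v v)) = vsq n (app n A (\<lambda>i. v $ i))" if v: "v \<in> carrier_vec n" for v
  proof -
    have "Re ((A *\<^sub>v v) \<bullet>c (A *\<^sub>v v)) = vsq n (\<lambda>i. (A *\<^sub>v v) $ i)"
      by (rule vec_norm_sq) (use A v in auto)
    also have "\<dots> = vsq n (app n A (\<lambda>i. v $ i))"
      unfolding vsq_def app_def using A v by (auto simp: scalar_prod_def lessThan_atLeast0 intro!: sum.cong)
    finally show ?thesis .
  qed
  have "{sqrt (Re ((A *\<^sub>v v) \<bullet>c (A *\<^sub>v v))) | v. v \<in> carrier_vec n \<and> Re (v \<bullet>c v) \<le> 1}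
      = {sqrt (vsq n (app n A v)) | v. vsq n v \<le> 1}" (is "?L = ?R")
  proof
    show "?L \<subseteq> ?R" using eq vec_norm_sq by fastforce
    show "?R \<subseteq> ?L"
    proof
      fix t assume "t \<in> ?R"
      then obtain v where v: "t = sqrt (vsq n (app n A v))" "vsq n v \<le> 1" by blast
      define w where "w = vec n v"
      have w: "w \<in> carrier_vec n" by (simp add: w_def)
      have 1: "vsq n (\<lambda>i. w $ i) = vsq n v" by (simp add: vsq_def w_def)
      have 2: "app n A (\<lambda>i. w $ i) = app n A v" by (simp add: app_def w_def fun_eq_iff)
      have "t = sqrt (Re ((A *\<^sub>v w) \<bullet>c (A *\<^sub>v w))) \<and> w \<in> carrier_vec n \<and> Re (w \<bullet>c w) \<le> 1"
        using v w by (simp add: eq[OF w] vec_norm_sq[OF w] 1 2)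
      then show "t \<in> ?L" by blast
    qed
  qed
  then show ?thesis by (simp add: matrix_alg_def)
qed

lemma app_frob_le: "vsq n (app n A v) \<le> frob n A * vsq n v"
proof -
  have "(cmod (app n A v i))\<^sup>2 \<le> (\<Sum>j<n. (cmod (A $$ (i, j)))\<^sup>2) * vsq n v" for i
  proof -
    have "cmod (app n A v i) \<le> (\<Sum>j<n. cmod (A $$ (i, j)) * cmod (v j))"
      unfolding app_def norm_mult[symmetric] by (rule norm_sum)
    then have "(cmod (app n A v i))\<^sup>2 \<le> (\<Sum>j<n. cmod (A $$ (i, j)) * cmod (v j))\<^sup>2"
      by (intro power_mono) auto
    also have "\<dots> \<le> (\<Sum>j<n. (cmod (A $$ (i, j)))\<^sup>2) * (\<Sum>j<n. (cmod (v j))\<^sup>2)"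
      by (rule Cauchy_Schwarz_ineq_sum)
    finally show ?thesis by (simp add: vsq_def)
  qed
  then show ?thesis unfolding vsq_def[of n "app n A v"] frob_def sum_distrib_right by (intro sum_mono)
qed

lemma opnorm_ge:
  assumes A: "A \<in> carrier_mat n n" and v: "vsq n v \<le> 1"
  shows "sqrt (vsq n (app n A v)) \<le> opnorm (matrix_alg n) A"
  unfolding opnorm_matrix[OF A]
proof (rule cSup_upper)
  show "bdd_above {sqrt (vsq n (app n A v)) | v. vsq n v \<le> 1}"
  proof (rule bdd_aboveI[of _ "sqrt (frob n A)"])
    fix t assume "t \<in> {sqrt (vsq n (app n A v)) | v. vsq n v \<le> 1}"
    then obtain v where v: "t = sqrt (vsq n (app n A v))" "vsq n v \<le> 1" by blast
    have "vsq n (app n A v) \<le> frob n A"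
      using app_frob_le[of n A v] mult_left_mono[OF v(2) frob_nonneg[of n A]] by simp
    then show "t \<le> sqrt (frob n A)" using v by simp
  qed
qed (use v in blast)

lemma opnorm_le:
  assumes A: "A \<in> carrier_mat n n" and "\<And>v. vsq n v \<le> 1 \<Longrightarrow> vsq n (app n A v) \<le> c\<^sup>2" "0 \<le> c"
  shows "opnorm (matrix_alg n) A \<le> c"
  unfolding opnorm_matrix[OF A]
proof (rule cSup_least)
  have "vsq n (\<lambda>_. 0) \<le> 1" by (simp add: vsq_def)
  then show "{sqrt (vsq n (app n A v)) | v. vsq n v \<le> 1} \<noteq> {}" by blast
  fix t assume "t \<in> {sqrt (vsq n (app n A v)) | v. vsq n v \<le> 1}"
  then show "t \<le> c" using assms by (auto intro!: real_le_lsqrt)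
qed

text \<open>Cruder than the triangle inequality, but its purpose is only that sums and differences
  of bounded sequences are bounded.\<close>

lemma opnorm_add_le:
  assumes C: "C \<in> carrier_mat n n" and A: "A \<in> carrier_mat n n" and B: "B \<in> carrier_mat n n"
    and eq: "\<And>i j. i < n \<Longrightarrow> j < n \<Longrightarrow> C $$ (i, j) = A $$ (i, j) + c * B $$ (i, j)" and c: "cmod c = 1"
    and a: "opnorm (matrix_alg n) A \<le> a" and b: "opnorm (matrix_alg n) B \<le> b"
  shows "opnorm (matrix_alg n) C \<le> sqrt (2 * a\<^sup>2 + 2 * b\<^sup>2)"
proof (rule opnorm_le[OF C])
  fix v assume v: "vsq n v \<le> 1"
  have bound: "vsq n (app n D v) \<le> t\<^sup>2" if "D \<in> carrier_mat n n" "opnorm (matrix_alg n) D \<le> t" for D t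
  proof -
    have "sqrt (vsq n (app n D v)) \<le> t" using opnorm_ge[OF that(1) v] that(2) by simp
    then show ?thesis by (rule sqrt_le_D)
  qed
  have "vsq n (app n C v) \<le> (\<Sum>i<n. 2 * (cmod (app n A v i))\<^sup>2 + 2 * (cmod (app n B v i))\<^sup>2)"
    unfolding vsq_def
  proof (rule sum_mono)
    fix i assume i: "i \<in> {..<n}"
    have "app n C v i = app n A v i + c * app n B v i"
      unfolding app_def using i by (simp add: eq sum.distrib sum_distrib_left algebra_simps)
    then show "(cmod (app n C v i))\<^sup>2 \<le> 2 * (cmod (app n A v i))\<^sup>2 + 2 * (cmod (app n B v i))\<^sup>2"
      using cmod_add_square_le[of "app n A v i" "c * app n B v i"] c by (simp add: norm_mult)
  qed
  also have "\<dots> = 2 * vsq n (app n A v) + 2 * vsq n (app n B v)"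
    unfolding vsq_def by (simp only: sum.distrib sum_distrib_left)
  also have "\<dots> \<le> 2 * a\<^sup>2 + 2 * b\<^sup>2" using bound[OF A a] bound[OF B b] by simp
  finally show "vsq n (app n C v) \<le> (sqrt (2 * a\<^sup>2 + 2 * b\<^sup>2))\<^sup>2" by simp
qed simp

text \<open>Each diagonal entry is a coordinate of the image of a unit vector. It follows that the
  traces along a bounded sequence are bounded and converge along the ultrafilter.\<close>

lemma tr_opnorm_le:
  assumes A: "A \<in> carrier_mat n n" and n: "0 < n"
  shows "cmod (tr (matrix_alg n) A) \<le> opnorm (matrix_alg n) A"
proof -
  have d: "cmod (A $$ (i, i)) \<le> opnorm (matrix_alg n) A" if i: "i < n" for i
  proof -
    let ?v = "\<lambda>j. if j = i then 1 else 0"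
    have a: "app n A ?v k = A $$ (k, i)" for k using i by (simp add: app_def if_distrib cong: if_cong)
    have "(cmod (?v j))\<^sup>2 = (if j = i then 1 else 0)" for j by simp
    then have v: "vsq n ?v \<le> 1" using i by (simp add: vsq_def)
    have "(cmod (A $$ (i, i)))\<^sup>2 \<le> vsq n (app n A ?v)"
      unfolding vsq_def a by (rule member_le_sum) (use i in auto)
    then have "cmod (A $$ (i, i)) \<le> sqrt (vsq n (app n A ?v))" by (rule real_le_rsqrt)
    also have "\<dots> \<le> opnorm (matrix_alg n) A" by (rule opnorm_ge[OF A v])
    finally show ?thesis .
  qed
  have "cmod (\<Sum>i<n. A $$ (i, i)) \<le> (\<Sum>i<n. cmod (A $$ (i, i)))" by (rule norm_sum)
  also have "\<dots> \<le> (\<Sum>i<n. opnorm (matrix_alg n) A)" by (intro sum_mono d) auto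
  finally have "cmod (\<Sum>i<n. A $$ (i, i)) \<le> real n * opnorm (matrix_alg n) A" by simp
  then show ?thesis using n by (simp add: matrix_alg_def norm_divide field_simps)
qed

section \<open>Permutation matrices\<close>

definition perm_mat :: "nat \<Rightarrow> (nat \<Rightarrow> nat) \<Rightarrow> complex mat" where
  "perm_mat n p = mat n n (\<lambda>(i, j). if i = p j then 1 else 0)"

lemma permutation_matrices_eq: "permutation_matrices n = {perm_mat n p | p. p permutes {..<n}}"
  by (simp add: permutation_matrices_def perm_mat_def)

lemma perm_mat_carrier: "perm_mat n p \<in> carrier_mat n n"
  by (simp add: perm_mat_def)

lemma opnorm_perm_mat:
  assumes p: "p permutes {..<n}" shows "opnorm (matrix_alg n) (perm_mat n p) \<le> 1"
proof (rule opnorm_le[OF perm_mat_carrier])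
  fix v assume v: "vsq n v \<le> 1"
  let ?q = "Hilbert_Choice.inv p"
  have "app n (perm_mat n p) v i = v (?q i)" if i: "i < n" for i
  proof -
    have "i = p j \<longleftrightarrow> j = ?q i" for j using permutes_inv_eq[OF p, of i j] by auto
    moreover have "?q i < n" using permutes_in_image[OF permutes_inv[OF p], of i] i by simp
    ultimately show ?thesis using i
      by (simp add: app_def perm_mat_def if_distrib if_distribR cong: if_cong)
  qed
  then have "vsq n (app n (perm_mat n p) v) = (\<Sum>i<n. (cmod (v (?q i)))\<^sup>2)"
    by (simp add: vsq_def)
  also have "\<dots> = vsq n v"
    unfolding vsq_def using sum.permute[OF permutes_inv[OF p], of "\<lambda>i. (cmod (v i))\<^sup>2"] by (simp add: comp_def)
  finally show "vsq n (app n (perm_mat n p) v) \<le> 1\<^sup>2" using v by simp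
qed simp

text \<open>Finiteness is what allows a nearest permutation matrix to be chosen.\<close>

lemma permutation_matrices_finite: "finite (permutation_matrices n)"
proof -
  have "permutation_matrices n = perm_mat n ` {p. p permutes {..<n}}"
    by (auto simp: permutation_matrices_eq)
  then show ?thesis by (simp add: finite_permutations)
qed

lemma permutation_matrices_nonempty: "permutation_matrices n \<noteq> {}"
  unfolding permutation_matrices_eq using permutes_id by blast

lemma permutation_matrices_carrier: "q \<in> permutation_matrices n \<Longrightarrow> q \<in> carrier_mat n n"
  by (auto simp: permutation_matrices_eq perm_mat_carrier)

section \<open>Tracial ultraproducts of matrix algebras\<close>

text \<open>By compactness of a closed disc the image filter has a cluster point, and an ultrafilter
  converges to its cluster points.\<close>

lemma free_ultrafilter_convergent:
  fixes f :: "nat \<Rightarrow> complex"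
  assumes \<omega>: "free_ultrafilter \<omega>" and f: "\<And>k. cmod (f k) \<le> c"
  shows "\<exists>l. (f \<longlongrightarrow> l) \<omega>"
proof -
  have "compact (cball (0::complex) c)" by simp
  moreover have "filtermap f \<omega> \<noteq> bot" using \<omega> by (simp add: free_ultrafilter_def filtermap_bot_iff)
  moreover have "eventually (\<lambda>z. z \<in> cball 0 c) (filtermap f \<omega>)"
    using f by (simp add: eventually_filtermap)
  ultimately obtain l where l: "inf (nhds l) (filtermap f \<omega>) \<noteq> bot"
    unfolding compact_filter by blast
  have "(f \<longlongrightarrow> l) \<omega>"
  proof (rule topological_tendstoI)
    fix S assume S: "open S" "l \<in> S"
    show "eventually (\<lambda>k. f k \<in> S) \<omega>"
    proof (rule ccontr)
      assume "\<not> eventually (\<lambda>k. f k \<in> S) \<omega>"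
      then have "eventually (\<lambda>k. f k \<notin> S) \<omega>" using \<omega> unfolding free_ultrafilter_def by blast
      then have "eventually (\<lambda>z. z \<notin> S) (filtermap f \<omega>)" by (simp add: eventually_filtermap)
      moreover have "eventually (\<lambda>z. z \<in> S) (nhds l)" using S by (rule eventually_nhds_in_open)
      ultimately have "eventually (\<lambda>_. False) (inf (nhds l) (filtermap f \<omega>))"
        unfolding eventually_inf by blast
      then show False using l by (simp add: trivial_limit_def)
    qed
  qed
  then show ?thesis by blast
qed

section \<open>Classes of sequences of matrices\<close>

locale matrix_ultraproduct =
  fixes \<omega> :: "nat filter" and n :: "nat \<Rightarrow> nat"
  assumes \<omega>: "free_ultrafilter \<omega>" and n_pos: "0 < n k"
begin

abbreviation "Mk \<equiv> (\<lambda>k. matrix_alg (n k))"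
abbreviation "BS \<equiv> bounded_seqs Mk"
abbreviation "NS \<equiv> null_seqs \<omega> Mk"
abbreviation "U \<equiv> ultraproduct \<omega> Mk"
abbreviation "cl \<equiv> seq_class \<omega> Mk"

text \<open>The square of the 2-norm for the normalised trace, given by entries so that it can be
  estimated before a sequence is known to be bounded.\<close>

definition fro :: "(nat \<Rightarrow> complex mat) \<Rightarrow> nat \<Rightarrow> real" where
  "fro x k = frob (n k) (x k) / real (n k)"

lemma fro_nonneg: "0 \<le> fro x k"
  by (simp add: fro_def frob_nonneg)

lemma \<omega>_nontrivial: "\<omega> \<noteq> bot"
  using \<omega> by (simp add: free_ultrafilter_def)

lemma BS_carrier: "x \<in> carrier BS \<Longrightarrow> x k \<in> carrier_mat (n k) (n k)"
  by (simp add: bounded_seqs_def matrix_alg_def)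

lemma BS_I: "(\<And>k. x k \<in> carrier_mat (n k) (n k)) \<Longrightarrow> (\<And>k. opnorm (Mk k) (x k) \<le> c) \<Longrightarrow> x \<in> carrier BS"
  by (auto simp: bounded_seqs_def matrix_alg_def)

lemma BS_bound: assumes "x \<in> carrier BS" obtains c where "\<And>k. opnorm (Mk k) (x k) \<le> c"
  using assms by (auto simp: bounded_seqs_def)

lemma BS_lincomb:
  assumes x: "x \<in> carrier BS" and y: "y \<in> carrier BS" and c: "cmod c = 1"
    and z: "\<And>k. z k \<in> carrier_mat (n k) (n k)"
    and eq: "\<And>k i j. i < n k \<Longrightarrow> j < n k \<Longrightarrow> z k $$ (i, j) = x k $$ (i, j) + c * y k $$ (i, j)"
  shows "z \<in> carrier BS"
proof -
  obtain a b where a: "\<And>k. opnorm (Mk k) (x k) \<le> a" and b: "\<And>k. opnorm (Mk k) (y k) \<le> b"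
    using BS_bound[OF x] BS_bound[OF y] by metis
  show ?thesis
    by (rule BS_I[OF z opnorm_add_le[OF z BS_carrier[OF x] BS_carrier[OF y] eq c a b]])
qed

lemma fro_lincomb:
  assumes "(fro x \<longlongrightarrow> 0) \<omega>" "(fro y \<longlongrightarrow> 0) \<omega>" "cmod c = 1"
    and eq: "\<And>k i j. i < n k \<Longrightarrow> j < n k \<Longrightarrow> z k $$ (i, j) = x k $$ (i, j) + c * y k $$ (i, j)"
  shows "(fro z \<longlongrightarrow> 0) \<omega>"
proof (rule tendsto_sandwich[of "\<lambda>_. 0"])
  have "fro z k \<le> 2 * fro x k + 2 * fro y k" for k
    using divide_right_mono[OF frob_add_le[of "n k" "z k" "x k" c "y k", OF eq assms(3)], of "real (n k)"]
    by (simp add: fro_def add_divide_distrib)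
  then show "\<forall>\<^sub>F k in \<omega>. fro z k \<le> 2 * fro x k + 2 * fro y k" by simp
  have "((\<lambda>k. 2 * fro x k + 2 * fro y k) \<longlongrightarrow> 2 * 0 + 2 * 0) \<omega>"
    by (intro tendsto_intros assms)
  then show "((\<lambda>k. 2 * fro x k + 2 * fro y k) \<longlongrightarrow> 0) \<omega>" by simp
qed (auto simp: fro_nonneg)

lemma NS_iff: "x \<in> NS \<longleftrightarrow> x \<in> carrier BS \<and> (fro x \<longlongrightarrow> 0) \<omega>"
proof -
  have "((\<lambda>k. tnorm2 (Mk k) (x k)) \<longlongrightarrow> 0) \<omega> \<longleftrightarrow> (fro x \<longlongrightarrow> 0) \<omega>" if x: "x \<in> carrier BS"
  proof -
    have eq: "(\<lambda>k. tnorm2 (Mk k) (x k)) = (\<lambda>k. sqrt (fro x k))"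
      by (simp add: tnorm2_matrix[OF BS_carrier[OF x]] fro_def)
    show ?thesis
    proof
      assume "((\<lambda>k. tnorm2 (Mk k) (x k)) \<longlongrightarrow> 0) \<omega>"
      then have "((\<lambda>k. (sqrt (fro x k))\<^sup>2) \<longlongrightarrow> 0\<^sup>2) \<omega>" unfolding eq by (rule tendsto_power)
      then show "(fro x \<longlongrightarrow> 0) \<omega>" by (simp add: fro_nonneg)
    next
      assume "(fro x \<longlongrightarrow> 0) \<omega>"
      then have "((\<lambda>k. sqrt (fro x k)) \<longlongrightarrow> sqrt 0) \<omega>" by (rule tendsto_real_sqrt)
      then show "((\<lambda>k. tnorm2 (Mk k) (x k)) \<longlongrightarrow> 0) \<omega>" unfolding eq by simp
    qed
  qed
  then show ?thesis by (auto simp: null_seqs_def)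
qed

lemma cl_eq: "cl c = {y. \<exists>h\<in>NS. y = (\<lambda>k. h k + c k)}"
  by (auto simp: seq_class_def a_r_coset_def' bounded_seqs_def matrix_alg_def)

lemma NS_zero: "(\<lambda>k. 0\<^sub>m (n k) (n k)) \<in> NS"
proof -
  have "opnorm (Mk k) (0\<^sub>m (n k) (n k)) \<le> 0" for k
  proof (rule opnorm_le[OF zero_carrier_mat])
    have "app (n k) (0\<^sub>m (n k) (n k)) v i = 0" if "i < n k" for v i
      unfolding app_def using that by (intro sum.neutral) simp
    then show "vsq (n k) (app (n k) (0\<^sub>m (n k) (n k)) v) \<le> 0\<^sup>2" for v by (simp add: vsq_def)
  qed simp
  then have "(\<lambda>k. 0\<^sub>m (n k) (n k)) \<in> carrier BS" by (intro BS_I) auto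
  moreover have "fro (\<lambda>k. 0\<^sub>m (n k) (n k)) = (\<lambda>k. 0)"
    by (simp add: fun_eq_iff fro_def frob_def)
  ultimately show ?thesis by (simp add: NS_iff)
qed

text \<open>Since 0 is a null sequence, matrix sizes alone decide this. It thus applies to products
  and adjoints of representatives ahead of any bound on their norms.\<close>

lemma cl_self_mat: assumes "\<And>k. c k \<in> carrier_mat (n k) (n k)" shows "c \<in> cl c"
proof -
  have "c = (\<lambda>k. 0\<^sub>m (n k) (n k) + c k)"
    by (rule ext) (rule left_add_zero_mat[OF assms, symmetric])
  then show ?thesis unfolding cl_eq by (intro CollectI bexI[OF _ NS_zero])
qed

lemma cl_self: "c \<in> carrier BS \<Longrightarrow> c \<in> cl c"
  by (rule cl_self_mat[OF BS_carrier])

lemma cl_BS: assumes c: "c \<in> carrier BS" and a: "a \<in> cl c" shows "a \<in> carrier BS"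
proof -
  obtain h where h: "h \<in> NS" "a = (\<lambda>k. h k + c k)" using a by (auto simp: cl_eq)
  have hB: "h \<in> carrier BS" using h by (simp add: NS_iff)
  show ?thesis
    by (rule BS_lincomb[OF hB c, of 1]) (simp_all add: h(2) BS_carrier[OF hB] BS_carrier[OF c] mat_add_index[OF BS_carrier[OF hB] BS_carrier[OF c]])
qed

text \<open>The common part c cancels, leaving the difference of two null sequences.\<close>

lemma cl_diff:
  assumes c: "c \<in> carrier BS" and a: "a \<in> cl c" and b: "b \<in> cl c"
    and z: "\<And>k i j. i < n k \<Longrightarrow> j < n k \<Longrightarrow> z k $$ (i, j) = a k $$ (i, j) - b k $$ (i, j)"
  shows "(fro z \<longlongrightarrow> 0) \<omega>"
proof -
  obtain h where h: "h \<in> NS" "a = (\<lambda>k. h k + c k)" using a by (auto simp: cl_eq)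
  obtain h' where h': "h' \<in> NS" "b = (\<lambda>k. h' k + c k)" using b by (auto simp: cl_eq)
  have B: "h \<in> carrier BS" "h' \<in> carrier BS" using h h' by (auto simp: NS_iff)
  show ?thesis
  proof (rule fro_lincomb[where c="-1"])
    show "(fro h \<longlongrightarrow> 0) \<omega>" "(fro h' \<longlongrightarrow> 0) \<omega>" using h h' by (auto simp: NS_iff)
    show "z k $$ (i, j) = h k $$ (i, j) + - 1 * h' k $$ (i, j)" if "i < n k" "j < n k" for k i j
      using that BS_carrier[OF B(1), of k] BS_carrier[OF B(2), of k] BS_carrier[OF c, of k]
      by (simp add: z h(2) h'(2))
  qed simp
qed

lemma cl_eqI:
  assumes c: "c \<in> carrier BS" and p: "p \<in> carrier BS"
    and z: "\<And>k i j. i < n k \<Longrightarrow> j < n k \<Longrightarrow> z k $$ (i, j) = c k $$ (i, j) - p k $$ (i, j)"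
    and lim: "(fro z \<longlongrightarrow> 0) \<omega>"
  shows "cl c = cl p"
proof -
  have sub: "cl a \<subseteq> cl b" if a: "a \<in> carrier BS" and b: "b \<in> carrier BS"
    and lim: "(fro (\<lambda>k. a k - b k) \<longlongrightarrow> 0) \<omega>" for a b
  proof
    fix y assume "y \<in> cl a"
    then obtain h where h: "h \<in> NS" "y = (\<lambda>k. h k + a k)" by (auto simp: cl_eq)
    have hB: "h \<in> carrier BS" and h0: "(fro h \<longlongrightarrow> 0) \<omega>" using h by (auto simp: NS_iff)
    note cs = BS_carrier[OF a] BS_carrier[OF b] BS_carrier[OF hB]
    have dB: "(\<lambda>k. a k - b k) \<in> carrier BS"
      by (rule BS_lincomb[OF a b, of "-1"]) (simp_all add: cs minus_carrier_mat mat_diff_index[OF cs(1,2)])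
    \<comment> \<open>A member h + a of the class of a equals (h + (a - b)) + b, a member of the
      class of b.\<close>
    define h' where "h' = (\<lambda>k. h k + (a k - b k))"
    have "h' \<in> carrier BS"
      by (rule BS_lincomb[OF hB dB, of 1]) (simp_all add: h'_def cs BS_carrier[OF dB] mat_add_index[OF cs(3) BS_carrier[OF dB]])
    moreover have "(fro h' \<longlongrightarrow> 0) \<omega>"
      by (rule fro_lincomb[OF h0 lim, of 1]) (simp_all add: h'_def mat_add_index[OF cs(3) BS_carrier[OF dB]])
    ultimately have "h' \<in> NS" by (simp add: NS_iff)
    moreover have "y = (\<lambda>k. h' k + b k)"
    proof
      fix k show "y k = h' k + b k"
        unfolding h(2) h'_def using cs(1)[of k] cs(2)[of k] cs(3)[of k]
        by (intro eq_matI) auto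
    qed
    ultimately show "y \<in> cl b" unfolding cl_eq by blast
  qed
  note cp = mat_diff_index[OF BS_carrier[OF c] BS_carrier[OF p]] mat_diff_index[OF BS_carrier[OF p] BS_carrier[OF c]]
  have "fro (\<lambda>k. c k - p k) = fro z"
    by (auto simp: fro_def frob_def fun_eq_iff z cp intro!: sum.cong)
  moreover have "fro (\<lambda>k. p k - c k) = fro z"
    by (auto simp: fro_def frob_def fun_eq_iff z cp norm_minus_commute intro!: sum.cong)
  ultimately show ?thesis using sub[OF c p] sub[OF p c] lim by auto
qed

lemma U_carrier: "X \<in> carrier U \<Longrightarrow> \<exists>c\<in>carrier BS. X = cl c"
  by (auto simp: ultraproduct_def Let_def FactRing_def A_RCOSETS_def' seq_class_def)

text \<open>In this form any product of representatives is visibly a member of the product class,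
  which is how \<open>\<Theta>_mult\<close> uses it.\<close>

lemma U_mult: "X \<otimes>\<^bsub>U\<^esub> Y = (\<Union>a\<in>X. \<Union>b\<in>Y. cl (\<lambda>k. a k * b k))"
  by (simp add: ultraproduct_def Let_def FactRing_def rcoset_mult_def seq_class_def bounded_seqs_def matrix_alg_def)

lemma U_add: "X \<oplus>\<^bsub>U\<^esub> Y = {\<lambda>k. a k + b k | a b. a \<in> X \<and> b \<in> Y}"
  by (auto simp: ultraproduct_def Let_def FactRing_def set_add_def' bounded_seqs_def matrix_alg_def)

lemma U_one: "\<one>\<^bsub>U\<^esub> = cl (\<lambda>k. 1\<^sub>m (n k))"
  by (simp add: ultraproduct_def Let_def FactRing_def seq_class_def bounded_seqs_def matrix_alg_def)

lemma U_star: "star U X = cl (\<lambda>k. mat_adjoint (rep X k))"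
  by (simp add: ultraproduct_def Let_def matrix_alg_def)

lemma U_tr: "tr U X = Lim \<omega> (\<lambda>k. tr (Mk k) (rep X k))"
  by (simp add: ultraproduct_def Let_def)

lemma rep_in: assumes "X \<in> carrier U" shows "rep X \<in> X"
proof -
  obtain c where "c \<in> carrier BS" "X = cl c" using U_carrier[OF assms] by blast
  then have "c \<in> X" using cl_self by simp
  then show ?thesis unfolding rep_def by (rule someI[of "\<lambda>x. x \<in> X"])
qed

end

section \<open>Calculus of representatives for an embedding into matrices\<close>

locale matrix_embedding = matrix_ultraproduct \<omega> n for \<omega> and n :: "nat \<Rightarrow> nat" +
  fixes A :: "('x, 'y) tracial_alg_scheme" and \<Theta> :: "'x \<Rightarrow> (nat \<Rightarrow> complex mat) set"
  assumes emb: "embedding A (ultraproduct \<omega> (\<lambda>k. matrix_alg (n k))) \<Theta>"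
begin

lemma hom: "\<Theta> \<in> Ring.ring_hom A U"
  using emb by (simp add: embedding_def)

lemma \<Theta>_closed: "x \<in> carrier A \<Longrightarrow> \<Theta> x \<in> carrier U"
  by (rule ring_hom_closed[OF hom])

lemma \<Theta>_cl: "x \<in> carrier A \<Longrightarrow> \<exists>c\<in>carrier BS. \<Theta> x = cl c"
  using U_carrier[OF \<Theta>_closed] .

lemma \<Theta>_BS: "x \<in> carrier A \<Longrightarrow> a \<in> \<Theta> x \<Longrightarrow> a \<in> carrier BS"
  using \<Theta>_cl cl_BS by blast

lemma \<Theta>_mat: "x \<in> carrier A \<Longrightarrow> a \<in> \<Theta> x \<Longrightarrow> a k \<in> carrier_mat (n k) (n k)"
  by (rule BS_carrier[OF \<Theta>_BS])

lemma \<Theta>_diff: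
  assumes "x \<in> carrier A" "a \<in> \<Theta> x" "b \<in> \<Theta> x"
    and "\<And>k i j. i < n k \<Longrightarrow> j < n k \<Longrightarrow> z k $$ (i, j) = a k $$ (i, j) - b k $$ (i, j)"
  shows "(fro z \<longlongrightarrow> 0) \<omega>"
proof -
  obtain c where "c \<in> carrier BS" "\<Theta> x = cl c" using \<Theta>_cl[OF assms(1)] by blast
  then show ?thesis using cl_diff assms by blast
qed

lemma \<Theta>_mult:
  assumes "x \<in> carrier A" "y \<in> carrier A" "a \<in> \<Theta> x" "b \<in> \<Theta> y"
  shows "(\<lambda>k. a k * b k) \<in> \<Theta> (x \<otimes>\<^bsub>A\<^esub> y)"
proof -
  have "(\<lambda>k. a k * b k) \<in> cl (\<lambda>k. a k * b k)"
    by (rule cl_self_mat) (use \<Theta>_mat assms in \<open>auto intro!: mult_carrier_mat\<close>)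
  then show ?thesis using assms by (auto simp: ring_hom_mult[OF hom] U_mult)
qed

lemma \<Theta>_add:
  assumes "x \<in> carrier A" "y \<in> carrier A" "a \<in> \<Theta> x" "b \<in> \<Theta> y"
  shows "(\<lambda>k. a k + b k) \<in> \<Theta> (x \<oplus>\<^bsub>A\<^esub> y)"
  using assms by (auto simp: ring_hom_add[OF hom] U_add)

lemma \<Theta>_one: "(\<lambda>k. 1\<^sub>m (n k)) \<in> \<Theta> \<one>\<^bsub>A\<^esub>"
  by (simp add: ring_hom_one[OF hom] U_one cl_self_mat)

lemma \<Theta>_rep: "x \<in> carrier A \<Longrightarrow> rep (\<Theta> x) \<in> \<Theta> x"
  by (rule rep_in[OF \<Theta>_closed])

lemma \<Theta>_star:
  assumes x: "x \<in> carrier A" shows "(\<lambda>k. mat_adjoint (rep (\<Theta> x) k)) \<in> \<Theta> (star A x)"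
proof -
  have "\<Theta> (star A x) = star U (\<Theta> x)" using emb x by (simp add: embedding_def)
  moreover have "(\<lambda>k. mat_adjoint (rep (\<Theta> x) k)) \<in> cl (\<lambda>k. mat_adjoint (rep (\<Theta> x) k))"
    by (intro cl_self_mat mat_adjoint_carrier \<Theta>_mat[OF x \<Theta>_rep[OF x]])
  ultimately show ?thesis by (simp add: U_star)
qed

text \<open>The trace of a class is the limit over one chosen representative, which exists because
  its traces are bounded. Any other representative differs from it by a sequence vanishing in
  2-norm, and the 2-norm dominates the trace.\<close>

lemma \<Theta>_tr:
  assumes x: "x \<in> carrier A" and a: "a \<in> \<Theta> x" shows "((\<lambda>k. tr (Mk k) (a k)) \<longlongrightarrow> tr A x) \<omega>"
proof -
  let ?r = "rep (\<Theta> x)"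
  have r: "?r \<in> \<Theta> x" by (rule \<Theta>_rep[OF x])
  obtain c where c: "\<And>k. opnorm (Mk k) (?r k) \<le> c" using BS_bound[OF \<Theta>_BS[OF x r]] by metis
  have "cmod (tr (Mk k) (?r k)) \<le> c" for k
    using tr_opnorm_le[OF \<Theta>_mat[OF x r] n_pos] c[of k] by (rule order_trans)
  then obtain l where l: "((\<lambda>k. tr (Mk k) (?r k)) \<longlongrightarrow> l) \<omega>"
    using free_ultrafilter_convergent[OF \<omega>, of "\<lambda>k. tr (Mk k) (?r k)" c] by blast
  have "tr A x = tr U (\<Theta> x)" using emb x by (simp add: embedding_def)
  also have "\<dots> = l" unfolding U_tr by (rule tendsto_Lim[OF \<omega>_nontrivial l])
  finally have l': "l = tr A x" by simp
  let ?z = "\<lambda>k. a k - ?r k"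
  have zf: "(fro ?z \<longlongrightarrow> 0) \<omega>"
    by (rule \<Theta>_diff[OF x a r]) (rule mat_diff_index[OF \<Theta>_mat[OF x a] \<Theta>_mat[OF x r]])
  have "((\<lambda>k. tr (Mk k) (?z k)) \<longlongrightarrow> 0) \<omega>"
  proof (rule Lim_null_comparison)
    show "\<forall>\<^sub>F k in \<omega>. norm (tr (Mk k) (?z k)) \<le> sqrt (fro ?z k)"
      using tr_matrix_le[OF n_pos] by (auto simp: fro_def)
    show "((\<lambda>k. sqrt (fro ?z k)) \<longlongrightarrow> 0) \<omega>" using tendsto_real_sqrt[OF zf] by simp
  qed
  then have "((\<lambda>k. tr (Mk k) (?z k) + tr (Mk k) (?r k)) \<longlongrightarrow> 0 + l) \<omega>" by (intro tendsto_add l)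
  moreover have "tr (Mk k) (?z k) + tr (Mk k) (?r k) = tr (Mk k) (a k)" for k
  proof -
    have "(\<Sum>i<n k. ?z k $$ (i, i)) + (\<Sum>i<n k. ?r k $$ (i, i)) = (\<Sum>i<n k. a k $$ (i, i))"
      unfolding sum.distrib[symmetric]
      by (rule sum.cong) (use \<Theta>_mat[OF x a, of k] \<Theta>_mat[OF x r, of k] in auto)
    then show ?thesis by (simp add: matrix_alg_def add_divide_distrib[symmetric])
  qed
  ultimately show ?thesis by (simp add: l')
qed

text \<open>Trace preservation for the product of x with its adjoint: the squared 2-norm of x is the
  limit of the squared 2-norms of the matrices.\<close>

lemma \<Theta>_fro_tendsto:
  assumes x: "x \<in> carrier A" and s: "star A x \<in> carrier A" and p: "star A x \<otimes>\<^bsub>A\<^esub> x \<in> carrier A"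
  shows "(fro (rep (\<Theta> x)) \<longlongrightarrow> Re (tr A (star A x \<otimes>\<^bsub>A\<^esub> x))) \<omega>"
proof -
  have "(\<lambda>k. mat_adjoint (rep (\<Theta> x) k) * rep (\<Theta> x) k) \<in> \<Theta> (star A x \<otimes>\<^bsub>A\<^esub> x)"
    by (rule \<Theta>_mult[OF s x \<Theta>_star[OF x] \<Theta>_rep[OF x]])
  from tendsto_Re[OF \<Theta>_tr[OF p this]] show ?thesis
    by (simp add: tr_adjoint_mult[OF \<Theta>_mat[OF x \<Theta>_rep[OF x]]] fro_def[abs_def])
qed

end

section \<open>Sofic actions\<close>

text \<open>Termwise |x| <= e / 2 + x^2 / (2e); the weights are such that each of the two halves
  contributes e / 2 on average.\<close>

lemma sum_abs_le_of_sum_squares: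
  fixes x :: "nat \<Rightarrow> real"
  assumes e: "0 < e" and x: "(\<Sum>i<m. (x i)\<^sup>2) \<le> e\<^sup>2 * real m"
  shows "(\<Sum>i<m. \<bar>x i\<bar>) \<le> e * real m"
proof -
  have "\<bar>x i\<bar> \<le> e / 2 + (x i)\<^sup>2 / (2 * e)" for i
  proof -
    have "2 * e * \<bar>x i\<bar> \<le> e\<^sup>2 + \<bar>x i\<bar>\<^sup>2" by (rule sum_squares_bound)
    then show ?thesis using e by (simp add: field_simps power2_eq_square)
  qed
  then have "(\<Sum>i<m. \<bar>x i\<bar>) \<le> (\<Sum>i<m. e / 2 + (x i)\<^sup>2 / (2 * e))" by (rule sum_mono)
  also have "\<dots> = real m * e / 2 + (\<Sum>i<m. (x i)\<^sup>2) / (2 * e)"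
    by (simp add: sum.distrib sum_divide_distrib)
  also have "\<dots> \<le> real m * e / 2 + (e\<^sup>2 * real m) / (2 * e)"
    using x e by (intro add_left_mono divide_right_mono) auto
  also have "\<dots> = e * real m" using e by (simp add: field_simps power2_eq_square)
  finally show ?thesis .
qed

lemma diag_le_frob:
  assumes "\<And>i. i < m \<Longrightarrow> cmod (x i) \<le> cmod (A $$ (i, i))"
  shows "(\<Sum>i<m. (cmod (x i))\<^sup>2) \<le> frob m A"
  unfolding frob_def
proof (rule sum_mono)
  fix i assume i: "i \<in> {..<m}"
  have "(cmod (x i))\<^sup>2 \<le> (cmod (A $$ (i, i)))\<^sup>2" using assms i by (intro power_mono) auto
  also have "\<dots> \<le> (\<Sum>j<m. (cmod (A $$ (i, j)))\<^sup>2)"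
    by (rule member_le_sum[where f="\<lambda>j. (cmod (A $$ (i, j)))\<^sup>2"]) (use i in auto)
  finally show "(cmod (x i))\<^sup>2 \<le> (\<Sum>j<m. (cmod (A $$ (i, j)))\<^sup>2)" .
qed

text \<open>Meant for the two products of an almost unitary matrix with its adjoint, whose diagonals
  consist of the squared norms of its rows and of its columns.\<close>

lemma near_unitary_diagonal:
  assumes v: "v \<in> carrier_mat m m" and w: "w \<in> carrier_mat m m" and e: "0 < e"
    and diag: "\<And>i. i < m \<Longrightarrow> (v * w) $$ (i, i) = complex_of_real (x i)"
    and near: "frob m (v * w - 1\<^sub>m m) \<le> e\<^sup>2 * real m"
  shows "(\<Sum>i<m. \<bar>x i - 1\<bar>) \<le> e * real m"
proof (rule sum_abs_le_of_sum_squares[OF e])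
  have "(\<Sum>i<m. (cmod (complex_of_real (x i - 1)))\<^sup>2) \<le> frob m (v * w - 1\<^sub>m m)"
  proof (rule diag_le_frob)
    fix i assume i: "i < m"
    then have "(v * w - 1\<^sub>m m) $$ (i, i) = complex_of_real (x i - 1)"
      using mat_diff_index[OF mult_carrier_mat[OF v w] one_carrier_mat i i] diag by simp
    then show "cmod (complex_of_real (x i - 1)) \<le> cmod ((v * w - 1\<^sub>m m) $$ (i, i))" by simp
  qed
  also note near
  finally show "(\<Sum>i<m. (x i - 1)\<^sup>2) \<le> e\<^sup>2 * real m"
    by (simp only: norm_of_real power2_abs)
qed

lemma diagonal_mult_index:
  assumes D: "D \<in> diagonal_matrices m" and B: "B \<in> carrier_mat m m" and i: "i < m" "j < m"
  shows "(D * B) $$ (i, j) = D $$ (i, i) * B $$ (i, j)"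
proof -
  have Dc: "D \<in> carrier_mat m m" and D0: "\<And>k. k < m \<Longrightarrow> k \<noteq> i \<Longrightarrow> D $$ (i, k) = 0"
    using D i by (auto simp: diagonal_matrices_def diagonal_mat_def)
  have "(D * B) $$ (i, j) = (\<Sum>k<m. D $$ (i, k) * B $$ (k, j))" by (rule mat_mult_index[OF Dc B i])
  also have "\<dots> = (\<Sum>k<m. if k = i then D $$ (i, i) * B $$ (i, j) else 0)"
    by (rule sum.cong) (auto simp: D0)
  finally show ?thesis using i by simp
qed

text \<open>The sets left uncovered by the first i group elements decrease to a null set, and the
  measure is continuous from above.\<close>

lemma (in oe_data) part_exhaust:
  assumes h: "h \<in> carrier H" and e: "0 < e"
  shows "\<exists>F. finite F \<and> F \<subseteq> carrier G \<and> measure M (space M - (\<Union>g\<in>F. part h g)) < e"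
proof -
  interpret prob_space M by (rule A.prob)
  have ne: "carrier G \<noteq> {}" using A.gr.one_closed by blast
  \<comment> \<open>An enumeration of G, with repetitions if G is finite.\<close>
  define \<gamma> where "\<gamma> = from_nat_into (carrier G)"
  have \<gamma>: "\<gamma> j \<in> carrier G" for j unfolding \<gamma>_def by (rule from_nat_into[OF ne])
  define S where "S i = space M - (\<Union>g\<in>\<gamma> ` {..i}. part h g)" for i
  have S: "S i \<in> sets M" for i
    unfolding S_def using part_sets[OF h \<gamma>] by (intro sets.Diff sets.top sets.finite_UN) auto
  have "decseq S" unfolding decseq_def S_def by fastforce
  then have lim: "(\<lambda>i. measure M (S i)) \<longlonglongrightarrow> measure M (\<Inter>i. S i)"
    using S by (intro finite_Lim_measure_decseq) auto
  have "AE x in M. x \<notin> (\<Inter>i. S i)"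
    using A.X_AE
  proof eventually_elim
    case (elim x)
    obtain g where g: "g \<in> carrier G" "x \<in> part h g" using part_cover[OF h elim] by blast
    obtain j where "g = \<gamma> j" unfolding \<gamma>_def using from_nat_into_surj[OF A.countable_G g(1)] by metis
    then have "x \<notin> S j" using g by (auto simp: S_def)
    then show ?case by blast
  qed
  then have "measure M (\<Inter>i. S i) = 0" using S by (subst prob_eq_0) auto
  then have "\<forall>\<^sub>F i in sequentially. measure M (S i) < e"
    using order_tendstoD(2)[OF lim] e by simp
  then obtain i where "measure M (S i) < e" by (auto simp: eventually_sequentially)
  then show ?thesis using \<gamma> by (intro exI[of _ "\<gamma> ` {..i}"]) (auto simp: S_def)
qed

section \<open>Permutation representatives for the conjugated unitaries\<close>

locale oe_sofic = oe_data G M \<alpha> X H N \<beta> Y \<phi> \<psi> +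
    ME: matrix_embedding \<omega> n "crossed_product G M \<alpha>" \<Theta>
  for G :: "('g, 'm) monoid_scheme" and M :: "'a measure" and \<alpha> X
    and H :: "('h, 'n) monoid_scheme" and N :: "'b measure" and \<beta> Y \<phi> \<psi> \<omega> n \<Theta> +
  assumes diag: "\<Theta> ` cp_Linf G M \<subseteq>
      ultraproduct_subset \<omega> (\<lambda>k. matrix_alg (n k)) (\<lambda>k. diagonal_matrices (n k))"
    and perm: "g \<in> carrier G \<Longrightarrow> \<Theta> (cp_unitary G M \<alpha> g) \<in>
      ultraproduct_subset \<omega> (\<lambda>k. matrix_alg (n k)) (\<lambda>k. permutation_matrices (n k))"
begin

lemma obtain_diag:
  assumes "f \<in> Linf_fun M"
  obtains d where "d \<in> \<Theta> (cp_fun G M f)" "\<And>k. d k \<in> diagonal_matrices (n k)"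
proof -
  have "\<Theta> (cp_fun G M f) \<in> ultraproduct_subset \<omega> ME.Mk (\<lambda>k. diagonal_matrices (n k))"
    using diag assms by (auto simp: A.cp_Linf_eq)
  then show ?thesis using ME.cl_self that by (auto simp: ultraproduct_subset_def)
qed

lemma obtain_perm:
  assumes "g \<in> carrier G"
  obtains q where "q \<in> \<Theta> (cp_unitary G M \<alpha> g)" "\<And>k. q k \<in> permutation_matrices (n k)"
  using perm[OF assms] ME.cl_self that by (auto simp: ultraproduct_subset_def)

lemma Linf_sum:
  assumes "finite F" "\<And>g. g \<in> F \<Longrightarrow> f g \<in> Linf_fun M" and f0: "f0 \<in> Linf_fun M"
  shows "(\<lambda>x. f0 x + (\<Sum>g\<in>F. f g x)) \<in> Linf_fun M"
  using assms(1,2)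
proof (induction F rule: finite_induct)
  case empty
  then show ?case using f0 by simp
next
  case (insert g F)
  obtain c where c: "AE x in M. cmod (f0 x + (\<Sum>g\<in>F. f g x)) \<le> c"
    and [measurable]: "(\<lambda>x. f0 x + (\<Sum>g\<in>F. f g x)) \<in> borel_measurable M"
    using insert by (auto simp: Linf_fun_def)
  obtain c' where c': "AE x in M. cmod (f g x) \<le> c'" and [measurable]: "f g \<in> borel_measurable M"
    using insert by (auto simp: Linf_fun_def)
  have eq: "f0 x + (\<Sum>g\<in>insert g F. f g x) = (f0 x + (\<Sum>g\<in>F. f g x)) + f g x" for x
    using insert by simp
  have "AE x in M. cmod ((f0 x + (\<Sum>g\<in>F. f g x)) + f g x) \<le> c + c'"
    using c c' by eventually_elim (rule norm_triangle_le, simp)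
  then show ?case unfolding eq Linf_fun_def by auto
qed

text \<open>The induction starts from f0, in the application the indicator of the uncovered
  remainder, and adds one function at a time.\<close>

lemma \<Theta>_sum:
  assumes "finite F" and f: "\<And>g. g \<in> F \<Longrightarrow> f g \<in> Linf_fun M" and f0: "f0 \<in> Linf_fun M"
    and b: "b \<in> \<Theta> (cp_fun G M f0)" and d: "\<And>g. g \<in> F \<Longrightarrow> d g \<in> \<Theta> (cp_fun G M (f g))"
  shows "(\<lambda>k. mat (n k) (n k) (\<lambda>ij. b k $$ ij + (\<Sum>g\<in>F. d g k $$ ij)))
    \<in> \<Theta> (cp_fun G M (\<lambda>x. f0 x + (\<Sum>g\<in>F. f g x)))"
  using assms(1) f d
proof (induction F rule: finite_induct)
  case empty
  have "b = (\<lambda>k. mat (n k) (n k) (\<lambda>ij. b k $$ ij))"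
  proof
    fix k show "b k = mat (n k) (n k) (\<lambda>ij. b k $$ ij)"
      using ME.\<Theta>_mat[OF A.cp_fun_in[OF f0] b, of k] by (intro eq_matI) auto
  qed
  then show ?case using b by simp
next
  case (insert g F)
  let ?a = "\<lambda>k. mat (n k) (n k) (\<lambda>ij. b k $$ ij + (\<Sum>g\<in>F. d g k $$ ij))"
  let ?f = "\<lambda>x. f0 x + (\<Sum>g\<in>F. f g x)"
  have L: "?f \<in> Linf_fun M" "f g \<in> Linf_fun M"
    using insert by (auto intro: Linf_sum f0)
  have a: "?a \<in> \<Theta> (cp_fun G M ?f)" and dg: "d g \<in> \<Theta> (cp_fun G M (f g))"
    by (rule insert.IH; use insert.prems in simp) (use insert.prems in simp)
  have "(\<lambda>k. ?a k + d g k) \<in> \<Theta> (cp_fun G M (\<lambda>x. ?f x + f g x))"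
    using ME.\<Theta>_add[OF A.cp_fun_in[OF L(1)] A.cp_fun_in[OF L(2)] a dg] by (simp add: A.cp_fun_add[OF L])
  moreover have "(\<lambda>x. f0 x + (\<Sum>g\<in>insert g F. f g x)) = (\<lambda>x. ?f x + f g x)"
    using insert by (simp add: fun_eq_iff)
  moreover have "(\<lambda>k. mat (n k) (n k) (\<lambda>ij. b k $$ ij + (\<Sum>g\<in>insert g F. d g k $$ ij))) = (\<lambda>k. ?a k + d g k)"
  proof
    fix k
    show "mat (n k) (n k) (\<lambda>ij. b k $$ ij + (\<Sum>g\<in>insert g F. d g k $$ ij)) = ?a k + d g k"
      using ME.\<Theta>_mat[OF A.cp_fun_in[OF L(2)] dg, of k] insert by (intro eq_matI) auto
  qed
  ultimately show ?case by simp
qed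

text \<open>Unitarity is transported from u_h by the embedding; the adjoint of V is the operator
  belonging to the inverse of h.\<close>

lemma Ad_unitary:
  assumes h: "h \<in> carrier H"
  defines "V \<equiv> cpAd (cp_unitary H N \<beta> h)" and "V' \<equiv> cpAd (cp_unitary H N \<beta> (inv\<^bsub>H\<^esub> h))"
  shows "V \<in> carrier A.CP" "V' \<in> carrier A.CP" "star A.CP V = V'"
    "V' \<otimes>\<^bsub>A.CP\<^esub> V = \<one>\<^bsub>A.CP\<^esub>" "V \<otimes>\<^bsub>A.CP\<^esub> V' = \<one>\<^bsub>A.CP\<^esub>"
proof -
  have h': "inv\<^bsub>H\<^esub> h \<in> carrier H" using h by simp
  have hom: "cpAd \<in> Ring.ring_hom B.CP A.CP" using cp_embedding by (simp add: embedding_def)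
  note u = B.cp_unitary_in[OF h] and u' = B.cp_unitary_in[OF h']
  show "V \<in> carrier A.CP" "V' \<in> carrier A.CP"
    unfolding V_def V'_def by (rule Ad_cp_unitary_in[OF h], rule Ad_cp_unitary_in[OF h'])
  have "star A.CP V = cpAd (star B.CP (cp_unitary H N \<beta> h))"
    unfolding V_def using cp_embedding u by (simp add: embedding_def)
  then show "star A.CP V = V'" by (simp add: B.star_cp_unitary[OF h] V'_def)
  show "V' \<otimes>\<^bsub>A.CP\<^esub> V = \<one>\<^bsub>A.CP\<^esub>"
    unfolding V_def V'_def ring_hom_mult[OF hom u' u, symmetric] B.cp_unitary_inv_left[OF h]
    by (rule ring_hom_one[OF hom])
  show "V \<otimes>\<^bsub>A.CP\<^esub> V' = \<one>\<^bsub>A.CP\<^esub>"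
    unfolding V_def V'_def ring_hom_mult[OF hom u u', symmetric] B.cp_unitary_inv_right[OF h]
    by (rule ring_hom_one[OF hom])
qed

text \<open>Supplies the hypotheses of \<open>permutation_approximation\<close> for all k in a set
  of the ultrafilter: d comes from diagonal representatives of the indicators of finitely many E(h,
  g), p from permutation representatives of the u_g, and the row and column norms from unitarity of
  V.\<close>

lemma eventually_near_permutation:
  assumes h: "h \<in> carrier H" and e: "0 < e"
  defines "v \<equiv> rep (\<Theta> (cpAd (cp_unitary H N \<beta> h)))"
  shows "\<forall>\<^sub>F k in \<omega>. \<exists>q\<in>permutation_matrices (n k). frob (n k) (v k - q) \<le> 31 * (e * real (n k))"
proof -
  define V where "V = cpAd (cp_unitary H N \<beta> h)"
  define V' where "V' = cpAd (cp_unitary H N \<beta> (inv\<^bsub>H\<^esub> h))"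
  note VV = Ad_unitary[OF h, folded V_def V'_def]
  have v: "v \<in> \<Theta> V" unfolding v_def V_def by (rule ME.\<Theta>_rep) (rule Ad_cp_unitary_in[OF h])
  have vs: "(\<lambda>k. mat_adjoint (v k)) \<in> \<Theta> V'"
    using ME.\<Theta>_star[OF VV(1)] unfolding v_def V_def[symmetric] VV(3) .
  note vm = ME.\<Theta>_mat[OF VV(1) v]
  have one_in: "\<one>\<^bsub>A.CP\<^esub> \<in> carrier A.CP"
    using A.cp_fun_in[of "\<lambda>_. 1"] by (auto simp: A.cp_fun_one Linf_fun_def)
  define z1 where "z1 k = mat_adjoint (v k) * v k - 1\<^sub>m (n k)" for k
  define z2 where "z2 k = v k * mat_adjoint (v k) - 1\<^sub>m (n k)" for k
  have z1: "(ME.fro z1 \<longlongrightarrow> 0) \<omega>"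
  proof (rule ME.\<Theta>_diff[OF one_in _ ME.\<Theta>_one])
    show "(\<lambda>k. mat_adjoint (v k) * v k) \<in> \<Theta> \<one>\<^bsub>A.CP\<^esub>"
      using ME.\<Theta>_mult[OF VV(2,1) vs v] by (simp add: VV)
  qed (auto simp: z1_def)
  have z2: "(ME.fro z2 \<longlongrightarrow> 0) \<omega>"
  proof (rule ME.\<Theta>_diff[OF one_in _ ME.\<Theta>_one])
    show "(\<lambda>k. v k * mat_adjoint (v k)) \<in> \<Theta> \<one>\<^bsub>A.CP\<^esub>"
      using ME.\<Theta>_mult[OF VV(1,2) v vs] by (simp add: VV)
  qed (auto simp: z2_def)
  \<comment> \<open>A remainder of measure e / 4 uses up half of the error allowed in
    \<open>d1\<close>, because of the factor 2 from squaring a sum.\<close>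
  obtain F where F: "finite F" "F \<subseteq> carrier G"
    and rest: "measure M (space M - (\<Union>g\<in>F. part h g)) < e / 4"
    using part_exhaust[OF h, of "e / 4"] e by auto
  define E0 where "E0 = space M - (\<Union>g\<in>F. part h g)"
  have E0: "E0 \<in> sets M"
    unfolding E0_def using part_sets[OF h] F by (intro sets.Diff sets.top sets.finite_UN) auto
  let ?e = "\<lambda>g. indicator (part h g) :: 'a \<Rightarrow> complex"
  have Le: "?e g \<in> Linf_fun M" if "g \<in> F" for g using that F by (intro Linf_indicator part_sets h) auto
  have L0: "indicator E0 \<in> Linf_fun M" by (rule Linf_indicator[OF E0])
  have "\<forall>g\<in>F. \<exists>d. d \<in> \<Theta> (cp_fun G M (?e g)) \<and> (\<forall>k. d k \<in> diagonal_matrices (n k))"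
    using obtain_diag[OF Le] by metis
  then obtain d where d: "\<And>g. g \<in> F \<Longrightarrow> d g \<in> \<Theta> (cp_fun G M (?e g))"
    "\<And>g k. g \<in> F \<Longrightarrow> d g k \<in> diagonal_matrices (n k)" by metis
  have "\<forall>g\<in>F. \<exists>q. q \<in> \<Theta> (cp_unitary G M \<alpha> g) \<and> (\<forall>k. q k \<in> permutation_matrices (n k))"
    using obtain_perm F(2) by (metis subsetD)
  then obtain q where q: "\<And>g. g \<in> F \<Longrightarrow> q g \<in> \<Theta> (cp_unitary G M \<alpha> g)"
    "\<And>g k. g \<in> F \<Longrightarrow> q g k \<in> permutation_matrices (n k)" by metis
  have "\<forall>g\<in>F. \<forall>k. \<exists>p. p permutes {..<n k} \<and> q g k = perm_mat (n k) p"
    using q(2) by (auto simp: permutation_matrices_eq)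
  then obtain p where p: "\<And>g k. g \<in> F \<Longrightarrow> p g k permutes {..<n k}"
    "\<And>g k. g \<in> F \<Longrightarrow> q g k = perm_mat (n k) (p g k)" by metis
  \<comment> \<open>Both sequences represent the same element, as 1_E V = 1_E u_g.\<close>
  have dv: "(ME.fro (\<lambda>k. d g k * v k - d g k * q g k) \<longlongrightarrow> 0) \<omega>" if g: "g \<in> F" for g
  proof -
    have gG: "g \<in> carrier G" using g F by blast
    note eC = A.cp_fun_in[OF Le[OF g]] and uC = A.cp_unitary_in[OF gG]
    have 1: "(\<lambda>k. d g k * v k) \<in> \<Theta> (cp_fun G M (?e g) \<otimes>\<^bsub>A.CP\<^esub> V)"
      by (rule ME.\<Theta>_mult[OF eC VV(1) d(1)[OF g] v])
    have 2: "(\<lambda>k. d g k * q g k) \<in> \<Theta> (cp_fun G M (?e g) \<otimes>\<^bsub>A.CP\<^esub> V)"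
      using ME.\<Theta>_mult[OF eC uC d(1)[OF g] q(1)[OF g]]
      unfolding V_def part_Ad_cp_unitary[OF h gG] .
    note dm = ME.\<Theta>_mat[OF eC d(1)[OF g]] and qm = permutation_matrices_carrier[OF q(2)[OF g]]
    have C: "cp_fun G M (?e g) \<otimes>\<^bsub>A.CP\<^esub> V \<in> carrier A.CP" by (rule A.CP_mult_closed[OF eC VV(1)])
    show ?thesis
      by (rule ME.\<Theta>_diff[OF C 1 2])
         (rule mat_diff_index[OF mult_carrier_mat[OF dm vm] mult_carrier_mat[OF dm qm]])
  qed
  \<comment> \<open>The remainder is represented by a sequence that may fail to be diagonal: only
    its 2-norm enters, whose square tends to the measure of E0.\<close>
  obtain b where b: "b \<in> \<Theta> (cp_fun G M (indicator E0))" and b_rep: "b = rep (\<Theta> (cp_fun G M (indicator E0)))"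
    using ME.\<Theta>_rep[OF A.cp_fun_in[OF L0]] by blast
  have bsq: "(ME.fro b \<longlongrightarrow> measure M E0) \<omega>"
  proof -
    have star: "star A.CP (cp_fun G M (indicator E0)) = cp_fun G M (indicator E0)"
      unfolding A.star_cp_fun[OF L0] by (rule arg_cong[where f="cp_fun G M"]) (auto simp: indicator_def)
    have prod: "cp_fun G M (indicator E0) \<otimes>\<^bsub>A.CP\<^esub> cp_fun G M (indicator E0) = cp_fun G M (indicator E0)"
      unfolding A.cp_fun_mult[OF L0] by (rule arg_cong[where f="cp_fun G M"]) (auto simp: indicator_def)
    show ?thesis
      using ME.\<Theta>_fro_tendsto[of "cp_fun G M (indicator E0)"] A.cp_fun_in[OF L0]
      unfolding star prod A.tr_cp_fun_indicator[OF E0] b_rep by simp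
  qed
  define a where "a k = mat (n k) (n k) (\<lambda>ij. b k $$ ij + (\<Sum>g\<in>F. d g k $$ ij))" for k
  \<comment> \<open>The parts with g in F are disjoint, so together with the remainder their
    indicators add up to 1 at every point of the space.\<close>
  have a: "a \<in> \<Theta> \<one>\<^bsub>A.CP\<^esub>"
  proof -
    have "a \<in> \<Theta> (cp_fun G M (\<lambda>x. indicator E0 x + (\<Sum>g\<in>F. ?e g x)))"
      unfolding a_def[abs_def] by (rule \<Theta>_sum[OF F(1) Le L0 b d(1)])
    moreover have "cp_fun G M (\<lambda>x. indicator E0 x + (\<Sum>g\<in>F. ?e g x)) = cp_fun G M (\<lambda>_. 1)"
    proof (rule A.cp_fun_cong)
      have "indicator E0 x + (\<Sum>g\<in>F. ?e g x) = 1" if x: "x \<in> space M" for x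
      proof (cases "x \<in> E0")
        case True
        then have "(\<Sum>g\<in>F. ?e g x) = 0" by (intro sum.neutral) (auto simp: E0_def)
        then show ?thesis using True by simp
      next
        case False
        then obtain g where g: "g \<in> F" "x \<in> part h g" using x by (auto simp: E0_def)
        have "(\<Sum>g'\<in>F. ?e g' x) = (\<Sum>g'\<in>F. if g' = g then 1 else 0)"
          using part_disjoint[OF h, of _ g x] g F(2) by (intro sum.cong) (auto simp: indicator_def)
        then show ?thesis using False g F by simp
      qed
      then show "AE x in M. indicator E0 x + (\<Sum>g\<in>F. ?e g x) = 1" by (rule AE_I2)
    qed
    ultimately show ?thesis by (simp add: A.cp_fun_one)
  qed
  define z3 where "z3 k = a k - 1\<^sub>m (n k)" for k
  have z3: "(ME.fro z3 \<longlongrightarrow> 0) \<omega>"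
    by (rule ME.\<Theta>_diff[OF one_in a ME.\<Theta>_one]) (auto simp: z3_def a_def)
  define m where "m = real (card F)"
  \<comment> \<open>The denominator collects the factor 4 m^2 of
    \<open>permutation_approximation\<close> and the number m of summands; the 1 keeps it positive
    if F is empty.\<close>
  define \<eta> where "\<eta> = e / (4 * m\<^sup>2 * m + 1)"
  have pos: "0 < 4 * m\<^sup>2 * m + 1" unfolding m_def by (intro add_nonneg_pos mult_nonneg_nonneg) auto
  have \<eta>: "0 < \<eta>" unfolding \<eta>_def using e pos by simp
  \<comment> \<open>Unitarity is required up to e^2, since passing from squares of diagonal entries
    to absolute values in \<open>near_unitary_diagonal\<close> costs a square root.\<close>
  have e2: "0 < e\<^sup>2" using e by simp
  have ev_dv: "\<forall>\<^sub>F k in \<omega>. \<forall>g\<in>F. ME.fro (\<lambda>k. d g k * v k - d g k * q g k) k < \<eta>"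
    using F(1) order_tendstoD(2)[OF dv \<eta>] by (simp add: eventually_ball_finite)
  have "\<forall>\<^sub>F k in \<omega>. ME.fro z1 k < e\<^sup>2" "\<forall>\<^sub>F k in \<omega>. ME.fro z2 k < e\<^sup>2"
    "\<forall>\<^sub>F k in \<omega>. ME.fro z3 k < e / 4" "\<forall>\<^sub>F k in \<omega>. ME.fro b k < e / 4"
    using order_tendstoD(2)[OF z1 e2] order_tendstoD(2)[OF z2 e2] order_tendstoD(2)[OF z3, of "e / 4"]
      order_tendstoD(2)[OF bsq, of "e / 4"] rest e by (simp_all add: E0_def)
  then show ?thesis using ev_dv
  proof eventually_elim
    case (elim k)
    let ?n = "n k"
    have n0: "0 < real ?n" using ME.n_pos[of k] by simp
    have froD: "frob ?n (x k) \<le> t * real ?n" if "ME.fro x k < t" for x t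
      using that n0 by (simp add: ME.fro_def field_simps)
    define vv where "vv i j = v k $$ (i, j)" for i j
    define dd where "dd g i = d g k $$ (i, i)" for g i
    have bm: "b k \<in> carrier_mat ?n ?n" by (rule ME.\<Theta>_mat[OF A.cp_fun_in[OF L0] b])
    have d1: "(\<Sum>i<?n. (cmod (1 - (\<Sum>g\<in>F. dd g i)))\<^sup>2) \<le> e * real ?n"
    proof -
      have "(\<Sum>i<?n. (cmod (1 - (\<Sum>g\<in>F. dd g i)))\<^sup>2) \<le>
        (\<Sum>i<?n. 2 * (cmod (b k $$ (i, i)))\<^sup>2 + 2 * (cmod (z3 k $$ (i, i)))\<^sup>2)"
      proof (rule sum_mono)
        fix i assume "i \<in> {..<?n}"
        \<comment> \<open>By the definitions of a and z3, the diagonal entries of b and of the d g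
          add up to 1 plus that of z3.\<close>
        then have eq: "1 - (\<Sum>g\<in>F. dd g i) = b k $$ (i, i) + - z3 k $$ (i, i)"
          by (simp add: z3_def a_def dd_def)
        show "(cmod (1 - (\<Sum>g\<in>F. dd g i)))\<^sup>2 \<le> 2 * (cmod (b k $$ (i, i)))\<^sup>2 + 2 * (cmod (z3 k $$ (i, i)))\<^sup>2"
          unfolding eq using cmod_add_square_le[of "b k $$ (i, i)" "- z3 k $$ (i, i)"] by simp
      qed
      also have "\<dots> = 2 * (\<Sum>i<?n. (cmod (b k $$ (i, i)))\<^sup>2) + 2 * (\<Sum>i<?n. (cmod (z3 k $$ (i, i)))\<^sup>2)"
        by (simp only: sum.distrib sum_distrib_left)
      also have "\<dots> \<le> 2 * frob ?n (b k) + 2 * frob ?n (z3 k)"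
        by (intro add_mono mult_left_mono diag_le_frob) auto
      also have "\<dots> \<le> 2 * (e / 4 * real ?n) + 2 * (e / 4 * real ?n)"
        using froD[OF elim(3)] froD[OF elim(4)] by simp
      finally show ?thesis by simp
    qed
    have d2: "4 * (real (card F))\<^sup>2 *
      (\<Sum>g\<in>F. \<Sum>i<?n. \<Sum>j<?n. (cmod (dd g i * (vv i j - (if i = p g k j then 1 else 0))))\<^sup>2) \<le> e * real ?n"
    proof -
      have "(\<Sum>i<?n. \<Sum>j<?n. (cmod (dd g i * (vv i j - (if i = p g k j then 1 else 0))))\<^sup>2) \<le> \<eta> * real ?n"
        if g: "g \<in> F" for g
      proof -
        have "dd g i * (vv i j - (if i = p g k j then 1 else 0)) = (d g k * v k - d g k * q g k) $$ (i, j)"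
          if ij: "i < ?n" "j < ?n" for i j
        proof -
          note qc = permutation_matrices_carrier[OF q(2)[OF g, of k]]
          have dc: "d g k \<in> carrier_mat ?n ?n" using d(2)[OF g, of k] by (simp add: diagonal_matrices_def)
          have "(d g k * v k - d g k * q g k) $$ (i, j) = (d g k * v k) $$ (i, j) - (d g k * q g k) $$ (i, j)"
            by (rule mat_diff_index[OF mult_carrier_mat[OF dc vm] mult_carrier_mat[OF dc qc] ij])
          also have "\<dots> = d g k $$ (i, i) * v k $$ (i, j) - d g k $$ (i, i) * q g k $$ (i, j)"
            by (simp only: diagonal_mult_index[OF d(2)[OF g] vm ij] diagonal_mult_index[OF d(2)[OF g] qc ij])
          finally show ?thesis using ij by (simp add: dd_def vv_def p(2)[OF g] perm_mat_def algebra_simps)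
        qed
        then have "(\<Sum>i<?n. \<Sum>j<?n. (cmod (dd g i * (vv i j - (if i = p g k j then 1 else 0))))\<^sup>2)
          = frob ?n (d g k * v k - d g k * q g k)"
          unfolding frob_def by (intro sum.cong refl) auto
        then show ?thesis using froD[of "\<lambda>k. d g k * v k - d g k * q g k" \<eta>] elim(5) g by simp
      qed
      then have "(\<Sum>g\<in>F. \<Sum>i<?n. \<Sum>j<?n. (cmod (dd g i * (vv i j - (if i = p g k j then 1 else 0))))\<^sup>2) \<le> (\<Sum>g\<in>F. \<eta> * real ?n)"
        by (rule sum_mono)
      also have "\<dots> = m * (\<eta> * real ?n)" by (simp add: m_def)
      finally have "4 * m\<^sup>2 * (\<Sum>g\<in>F. \<Sum>i<?n. \<Sum>j<?n. (cmod (dd g i * (vv i j - (if i = p g k j then 1 else 0))))\<^sup>2)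
        \<le> 4 * m\<^sup>2 * (m * (\<eta> * real ?n))" by (intro mult_left_mono) auto
      also have "\<dots> = (4 * m\<^sup>2 * m * \<eta>) * real ?n" by simp
      also have "\<dots> \<le> e * real ?n"
      proof (rule mult_right_mono)
        have "(4 * m\<^sup>2 * m + 1) * \<eta> = e" unfolding \<eta>_def using pos by simp
        then show "4 * m\<^sup>2 * m * \<eta> \<le> e" using \<eta> by (simp add: distrib_right)
      qed simp
      finally show ?thesis by (simp add: m_def)
    qed
    have r: "(\<Sum>i<?n. \<bar>(\<Sum>j<?n. (cmod (vv i j))\<^sup>2) - 1\<bar>) \<le> e * real ?n"
      unfolding vv_def
      by (rule near_unitary_diagonal[OF vm mat_adjoint_carrier[OF vm] e adjoint_mult_diag(2)[OF vm]
            froD[OF elim(2), unfolded z2_def]])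
    have c: "(\<Sum>j<?n. \<bar>(\<Sum>i<?n. (cmod (vv i j))\<^sup>2) - 1\<bar>) \<le> e * real ?n"
      unfolding vv_def
      by (rule near_unitary_diagonal[OF mat_adjoint_carrier[OF vm] vm e adjoint_mult_diag(1)[OF vm]
            froD[OF elim(1), unfolded z1_def]])
    obtain \<sigma> where \<sigma>: "\<sigma> permutes {..<?n}"
      "(\<Sum>i<?n. \<Sum>j<?n. (cmod (vv i j - (if i = \<sigma> j then 1 else 0)))\<^sup>2) \<le> 31 * (e * real ?n)"
      using permutation_approximation[OF F(1) _ d1 d2 r c] p(1) by blast
    have "frob ?n (v k - perm_mat ?n \<sigma>) = (\<Sum>i<?n. \<Sum>j<?n. (cmod (vv i j - (if i = \<sigma> j then 1 else 0)))\<^sup>2)"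
      unfolding frob_def
      by (intro sum.cong refl) (simp add: mat_diff_index[OF vm perm_mat_carrier] vv_def perm_mat_def)
    then show ?case
      using \<sigma> by (intro bexI[of _ "perm_mat ?n \<sigma>"]) (auto simp: permutation_matrices_eq)
  qed
qed

text \<open>The permutation matrices found so far depend on the error e. A permutation matrix
  nearest to \<open>v k\<close>, chosen at each k, is at least as good for every e simultaneously,
  so a single sequence represents the class.\<close>

lemma Ad_unitary_permutation:
  assumes h: "h \<in> carrier H"
  shows "\<Theta> (cpAd (cp_unitary H N \<beta> h)) \<in>
    ultraproduct_subset \<omega> (\<lambda>k. matrix_alg (n k)) (\<lambda>k. permutation_matrices (n k))"
proof -
  define V where "V = cpAd (cp_unitary H N \<beta> h)"
  have VC: "V \<in> carrier A.CP" unfolding V_def by (rule Ad_cp_unitary_in[OF h])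
  define v where "v = rep (\<Theta> V)"
  have v: "v \<in> \<Theta> V" unfolding v_def by (rule ME.\<Theta>_rep[OF VC])
  note vm = ME.\<Theta>_mat[OF VC v]
  define q where "q k = arg_min_on (\<lambda>q. frob (n k) (v k - q)) (permutation_matrices (n k))" for k
  have q: "q k \<in> permutation_matrices (n k)" for k
    unfolding q_def by (rule arg_min_if_finite(1)[OF permutation_matrices_finite permutation_matrices_nonempty])
  have qmin: "frob (n k) (v k - q k) \<le> frob (n k) (v k - q')" if "q' \<in> permutation_matrices (n k)" for k q'
    unfolding q_def by (rule arg_min_least[OF permutation_matrices_finite permutation_matrices_nonempty that])
  have qB: "q \<in> carrier ME.BS"
  proof (rule ME.BS_I)
    show "q k \<in> carrier_mat (n k) (n k)" for k by (rule permutation_matrices_carrier[OF q])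
    show "opnorm (ME.Mk k) (q k) \<le> 1" for k
      using q[of k] by (auto simp: permutation_matrices_eq opnorm_perm_mat)
  qed
  have lim: "(ME.fro (\<lambda>k. v k - q k) \<longlongrightarrow> 0) \<omega>"
  proof (rule order_tendstoI)
    fix t :: real assume "t < 0"
    then show "\<forall>\<^sub>F k in \<omega>. t < ME.fro (\<lambda>k. v k - q k) k"
      by (intro always_eventually allI less_le_trans[OF _ ME.fro_nonneg])
  next
    \<comment> \<open>With e = t / 62 the bound 31 e is t / 2, which leaves the strict
      inequality.\<close>
    fix t :: real assume t: "0 < t"
    have "\<forall>\<^sub>F k in \<omega>. \<exists>q\<in>permutation_matrices (n k). frob (n k) (v k - q) \<le> 31 * (t / 62 * real (n k))"
      unfolding v_def V_def by (rule eventually_near_permutation[OF h]) (use t in simp)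
    then show "\<forall>\<^sub>F k in \<omega>. ME.fro (\<lambda>k. v k - q k) k < t"
    proof eventually_elim
      case (elim k)
      then have "frob (n k) (v k - q k) \<le> 31 * (t / 62 * real (n k))" using qmin order_trans by blast
      also have "\<dots> < t * real (n k)" using t ME.n_pos[of k] by simp
      finally show ?case using ME.n_pos[of k] by (simp add: ME.fro_def divide_less_eq)
    qed
  qed
  obtain c where c: "c \<in> carrier ME.BS" "\<Theta> V = ME.cl c" using ME.\<Theta>_cl[OF VC] by blast
  note vB = ME.\<Theta>_BS[OF VC v]
  have cV: "c \<in> \<Theta> V" using ME.cl_self[OF c(1)] c(2) by simp
  have "ME.cl c = ME.cl v"
    by (rule ME.cl_eqI[OF c(1) vB, of "\<lambda>k. c k - v k"])
       (auto intro!: ME.\<Theta>_diff[OF VC cV v] mat_diff_index[OF ME.BS_carrier[OF c(1)] vm])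
  also have "\<dots> = ME.cl q"
    by (rule ME.cl_eqI[OF vB qB mat_diff_index[OF vm ME.BS_carrier[OF qB]] lim])
  finally show ?thesis
    using c(2) q qB unfolding V_def[symmetric] ultraproduct_subset_def by blast
qed

end

text \<open>The matrix sizes stay the same and \<Theta> is composed with the conjugation.
  Diagonality persists because the conjugation maps bounded functions on Y to bounded functions on
  X; the unitaries are covered by \<open>Ad_unitary_permutation\<close>.\<close>

lemma sofic_action_oe:
  assumes "free_ultrafilter \<omega>"
    and "pmp_action G M \<alpha>" "free_action G M \<alpha>" "pmp_action H N \<beta>" "free_action H N \<beta>"
    and "orbit_equivalent G M \<alpha> H N \<beta>" and "sofic_action \<omega> G M \<alpha>"
  shows "sofic_action \<omega> H N \<beta>"
proof -
  obtain X Y \<phi> \<psi> where oe: "oe_data G M \<alpha> X H N \<beta> Y \<phi> \<psi>"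
    using oe_data_exists[OF assms(2-6)] by blast
  obtain n :: "nat \<Rightarrow> nat" and \<Theta> where n: "\<And>k. 0 < n k"
    and \<Theta>: "embedding (crossed_product G M \<alpha>) (ultraproduct \<omega> (\<lambda>k. matrix_alg (n k))) \<Theta>"
      "\<Theta> ` cp_Linf G M \<subseteq> ultraproduct_subset \<omega> (\<lambda>k. matrix_alg (n k)) (\<lambda>k. diagonal_matrices (n k))"
      "\<And>g. g \<in> carrier G \<Longrightarrow> \<Theta> (cp_unitary G M \<alpha> g) \<in>
        ultraproduct_subset \<omega> (\<lambda>k. matrix_alg (n k)) (\<lambda>k. permutation_matrices (n k))"
    using assms(7) unfolding sofic_action_def by (elim exE conjE) (rule that, auto)
  interpret oe_sofic G M \<alpha> X H N \<beta> Y \<phi> \<psi> \<omega> n \<Theta>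
    by (intro oe_sofic.intro oe matrix_embedding.intro matrix_ultraproduct.intro
        matrix_embedding_axioms.intro oe_sofic_axioms.intro assms(1) n \<Theta>)
  show ?thesis
    unfolding sofic_action_def
  proof (intro exI conjI allI ballI)
    show "0 < n k" for k by (rule n)
    show "embedding B.CP (ultraproduct \<omega> (\<lambda>k. matrix_alg (n k))) (\<lambda>T. \<Theta> (cpAd T))"
      by (rule embedding_comp[OF cp_embedding \<Theta>(1)])
    show "(\<lambda>T. \<Theta> (cpAd T)) ` cp_Linf H N \<subseteq>
        ultraproduct_subset \<omega> (\<lambda>k. matrix_alg (n k)) (\<lambda>k. diagonal_matrices (n k))"
      using \<Theta>(2) Linf_comp by (auto simp: B.cp_Linf_eq A.cp_Linf_eq Ad_cp_fun)
    show "\<Theta> (cpAd (cp_unitary H N \<beta> h)) \<in>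
        ultraproduct_subset \<omega> (\<lambda>k. matrix_alg (n k)) (\<lambda>k. permutation_matrices (n k))"
      if "h \<in> carrier H" for h by (rule Ad_unitary_permutation[OF that])
  qed
qed

theorem theorem1p5:
  fixes G :: "('g, 'm) monoid_scheme" and M :: "'a measure" and \<alpha> :: "'g \<Rightarrow> 'a \<Rightarrow> 'a"
    and H :: "('h, 'n) monoid_scheme" and N :: "'b measure" and \<beta> :: "'h \<Rightarrow> 'b \<Rightarrow> 'b"
    and \<omega> :: "nat filter"
    and K :: "'v hilbert" and R :: "('v \<Rightarrow> 'v) set" and \<tau> :: "('v \<Rightarrow> 'v) \<Rightarrow> complex"
  assumes "free_ultrafilter \<omega>"
    and "hyperfinite_II1_factor K R \<tau>"
    and "pmp_action G M \<alpha>" and "free_action G M \<alpha>"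
    and "pmp_action H N \<beta>" and "free_action H N \<beta>"
    and "orbit_equivalent G M \<alpha> H N \<beta>"
  shows "(hyperlinear_action \<omega> (operator_alg K R \<tau>) G M \<alpha> \<longrightarrow>
            hyperlinear_action \<omega> (operator_alg K R \<tau>) H N \<beta>) \<and>
         (sofic_action \<omega> G M \<alpha> \<longrightarrow> sofic_action \<omega> H N \<beta>)"
  using hyperlinear_action_oe[OF assms(3-7)] sofic_action_oe[OF assms(1,3-7)] by blast

end
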